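(* Under the assumptions of the previous result (so $H_2-H_1>\frac14$ and $T>0$ is such that (E$_T$) has a unique solution $h_T$ with $h_T(t)t^{1/2-H_1}\in L^2[0,T]$), the maximum likelihood estimator $\widehat\theta_T=N(T)/(\kappa\langle N\rangle(T))$ is unbiased under every $P_\theta$, and under $P_\theta$ the estimation error is Gaussian: $$\widehat\theta_T-\theta\sim\mathcal N\Big(0,\ \frac{1}{\kappa^2\gamma_{H_1}^2\int_0^Th_T(s)\,s^{1-2H_1}\,ds}\Big).$$
   Context: Standing setup. Fix $\frac12<H_1<H_2<1$. On $(\Omega,\mathcal F,P_0)$ let $W_1,W_2$ be independent standard Wiener processes; $\gamma_{H_1}>0$ is the normalizing constant of the Molchan martingale of an fBm with index $H_1$ (i.e. $\int_0^t(t-s)^{1/2-H_1}s^{1/2-H_1}dB^{H_1}(s)=\gamma_{H_1}\int_0^ts^{1/2-H_1}dW(s)$). $X_1(t)=\gamma_{H_1}\int_0^ts^{1/2-H_1}dW_1(s)$, $X_2(t)=\int_0^tK_{H_1,H_2}(t,s)dW_2(s)$, $X=X_1+X_2$, $\mathcal F^X_t=\sigma\{X(s),s\le t\}$, where $K_{H_1,H_2}(t,s)=\beta_{H_2}s^{1/2-H_2}\int_s^t (t-u)^{1/2-H_1}u^{H_2-H_1}(u-s)^{H_2-3/2}du$ for $0<s<t$ (zero otherwise) and $\beta_H=\big(H(2H-1)/\mathrm B(H-\frac12,2-2H)\big)^{1/2}$. $\mathcal B_{H_1}=\mathrm B(\frac32-H_1,\frac32-H_1)$, $\kappa=(2-2H_1)\mathcal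 B_{H_1}/\gamma_{H_1}^2$. $P_\theta$ is given by $dP_\theta/dP_0=\exp\{\theta\kappa X_1(T)-\frac12\theta^2\kappa^2\gamma_{H_1}^2T^{2-2H_1}/(2-2H_1)\}$, so that under $P_\theta$, $X(t)=\theta\mathcal B_{H_1}t^{2-2H_1}+\widetilde X_1(t)+X_2(t)$ with $\widetilde X_1\overset{d}{=}X_1$ independent of $X_2$. $k(s,u)=\int_0^{s\wedge u}\partial_sK_{H_1,H_2}(s,v)\partial_uK_{H_1,H_2}(u,v)dv$; (E$_T$) is the equation $\gamma_{H_1}^2u^{1-2H_1}=\gamma_{H_1}^2h(u)u^{1-2H_1}+\int_0^Th(s)k(s,u)ds$, $u\in(0,T]$. $N(T)=\int_0^Th_T\,dX:=\gamma_{H_1}\int_0^Th_T(t)t^{1/2-H_1}dW_1(t)+\int_0^T\big(\int_s^Th_T(t)\partial_tK_{H_1,H_2}(t,s)dt\big)dW_2(s)$ (it equals $E_0(X_1(T)\mid\mathcal F^X_T)$), and $\langle N\rangle(T)=\gamma_{H_1}^2\int_0^Th_T(t)t^{1-2H_1}dt$. *)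

theory Defs
  imports "HOL-Probability.Probability"
begin

definition wiener_process :: "'a measure \<Rightarrow> (real \<Rightarrow> 'a \<Rightarrow> real) \<Rightarrow> bool" where
  "wiener_process M W \<longleftrightarrow>
     prob_space M \<and>
     (\<forall>t. W t \<in> borel_measurable M) \<and>
     (\<forall>\<omega>\<in>space M. W 0 \<omega> = 0) \<and>
     (\<forall>s t. 0 \<le> s \<and> s < t \<longrightarrow>
        distributed M lborel (\<lambda>\<omega>. W t \<omega> - W s \<omega>)
          (\<lambda>x. ennreal (normal_density 0 (sqrt (t - s)) x))) \<and>
     (\<forall>(n::nat) (ts::nat \<Rightarrow> real). 0 \<le> ts 0 \<and> (\<forall>i<n. ts i \<le> ts (Suc i)) \<longrightarrow>
        prob_space.indep_vars M (\<lambda>_. borel) (\<lambda>i \<omega>. W (ts (Suc i)) \<omega> - W (ts i) \<omega>) {..<n}) \<and>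
     (AE \<omega> in M. continuous_on {0..} (\<lambda>t. W t \<omega>))"

definition indep_processes ::
  "'a measure \<Rightarrow> (real \<Rightarrow> 'a \<Rightarrow> real) \<Rightarrow> (real \<Rightarrow> 'a \<Rightarrow> real) \<Rightarrow> bool" where
  "indep_processes M W1 W2 \<longleftrightarrow>
     prob_space.indep_var M (PiM UNIV (\<lambda>_::real. borel)) (\<lambda>\<omega> t. W1 t \<omega>)
                            (PiM UNIV (\<lambda>_::real. borel)) (\<lambda>\<omega> t. W2 t \<omega>)"

definition step_fun :: "nat \<Rightarrow> (nat \<Rightarrow> real) \<Rightarrow> (nat \<Rightarrow> real) \<Rightarrow> real \<Rightarrow> real" where
  "step_fun n ts cs s = (\<Sum>i<n. cs i * indicator {ts i<..ts (Suc i)} s)"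

definition step_int :: "(real \<Rightarrow> 'a \<Rightarrow> real) \<Rightarrow> nat \<Rightarrow> (nat \<Rightarrow> real) \<Rightarrow> (nat \<Rightarrow> real) \<Rightarrow> 'a \<Rightarrow> real" where
  "step_int W n ts cs \<omega> = (\<Sum>i<n. cs i * (W (ts (Suc i)) \<omega> - W (ts i) \<omega>))"

definition is_wiener_integral ::
  "'a measure \<Rightarrow> (real \<Rightarrow> 'a \<Rightarrow> real) \<Rightarrow> real \<Rightarrow> (real \<Rightarrow> real) \<Rightarrow> ('a \<Rightarrow> real) \<Rightarrow> bool" where
  "is_wiener_integral M W T f Y \<longleftrightarrow>
     f \<in> borel_measurable lborel \<and>
     set_integrable lborel {0..T} (\<lambda>s. (f s)\<^sup>2) \<and>
     Y \<in> borel_measurable M \<and> integrable M (\<lambda>\<omega>. (Y \<omega>)\<^sup>2) \<and>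
     (\<exists>(n::nat \<Rightarrow> nat) (ts::nat \<Rightarrow> nat \<Rightarrow> real) (cs::nat \<Rightarrow> nat \<Rightarrow> real).
        (\<forall>k. 0 \<le> ts k 0 \<and> ts k (n k) \<le> T \<and> (\<forall>i<n k. ts k i \<le> ts k (Suc i))) \<and>
        (\<lambda>k. LINT s:{0..T}|lborel. (f s - step_fun (n k) (ts k) (cs k) s)\<^sup>2) \<longlonglongrightarrow> 0 \<and>
        (\<lambda>k. integral\<^sup>L M (\<lambda>\<omega>. (Y \<omega> - step_int W (n k) (ts k) (cs k) \<omega>)\<^sup>2)) \<longlonglongrightarrow> 0)"

text \<open>The Wiener integral (a chosen version; unique up to M-null sets).\<close>
definition wiener_integral ::
  "'a measure \<Rightarrow> (real \<Rightarrow> 'a \<Rightarrow> real) \<Rightarrow> real \<Rightarrow> (real \<Rightarrow> real) \<Rightarrow> 'a \<Rightarrow> real" where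
  "wiener_integral M W T f = (SOME Y. is_wiener_integral M W T f Y)"

text \<open>Normalizing constant of the Molchan martingale of an fBm with index H:
  gamma_H^2 = 2H(2-2H) Gamma(3/2-H) Gamma(H+1/2) B(3/2-H,3/2-H).\<close>
definition gammaH :: "real \<Rightarrow> real" where
  "gammaH H = sqrt (2 * H * (2 - 2 * H) * Gamma (3/2 - H) * Gamma (H + 1/2)
                     * Beta (3/2 - H) (3/2 - H))"

definition betaH :: "real \<Rightarrow> real" where
  "betaH H = sqrt (H * (2 * H - 1) / Beta (H - 1/2) (2 - 2 * H))"

definition BH :: "real \<Rightarrow> real" where
  "BH H1 = Beta (3/2 - H1) (3/2 - H1)"

definition kappa :: "real \<Rightarrow> real" where
  "kappa H1 = (2 - 2 * H1) * BH H1 / (gammaH H1)\<^sup>2"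

definition KH :: "real \<Rightarrow> real \<Rightarrow> real \<Rightarrow> real \<Rightarrow> real" where
  "KH H1 H2 t s = (if 0 < s \<and> s < t then
      betaH H2 * s powr (1/2 - H2) *
        (LINT u:{s..t}|lborel. (t - u) powr (1/2 - H1) * u powr (H2 - H1) * (u - s) powr (H2 - 3/2))
    else 0)"

definition dKH :: "real \<Rightarrow> real \<Rightarrow> real \<Rightarrow> real \<Rightarrow> real" where
  "dKH H1 H2 t s = deriv (\<lambda>t'. KH H1 H2 t' s) t"

definition kH :: "real \<Rightarrow> real \<Rightarrow> real \<Rightarrow> real \<Rightarrow> real" where
  "kH H1 H2 s u = (LINT v:{0..min s u}|lborel. dKH H1 H2 s v * dKH H1 H2 u v)"

definition solves_ET :: "real \<Rightarrow> real \<Rightarrow> real \<Rightarrow> (real \<Rightarrow> real) \<Rightarrow> bool" where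
  "solves_ET H1 H2 T h \<longleftrightarrow>
     h \<in> borel_measurable lborel \<and>
     set_integrable lborel {0..T} (\<lambda>t. (h t * t powr (1/2 - H1))\<^sup>2) \<and>
     (\<forall>u\<in>{0<..T}.
        set_integrable lborel {0<..T} (\<lambda>s. h s * kH H1 H2 s u) \<and>
        (gammaH H1)\<^sup>2 * u powr (1 - 2 * H1) =
          (gammaH H1)\<^sup>2 * h u * u powr (1 - 2 * H1)
          + (LINT s:{0<..T}|lborel. h s * kH H1 H2 s u))"

definition X1T :: "real \<Rightarrow> 'a measure \<Rightarrow> (real \<Rightarrow> 'a \<Rightarrow> real) \<Rightarrow> real \<Rightarrow> 'a \<Rightarrow> real" where
  "X1T H1 P0 W1 T \<omega> = gammaH H1 * wiener_integral P0 W1 T (\<lambda>s. s powr (1/2 - H1)) \<omega>"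

definition NT :: "real \<Rightarrow> real \<Rightarrow> 'a measure \<Rightarrow> (real \<Rightarrow> 'a \<Rightarrow> real) \<Rightarrow> (real \<Rightarrow> 'a \<Rightarrow> real)
                  \<Rightarrow> real \<Rightarrow> (real \<Rightarrow> real) \<Rightarrow> 'a \<Rightarrow> real" where
  "NT H1 H2 P0 W1 W2 T h \<omega> =
     gammaH H1 * wiener_integral P0 W1 T (\<lambda>t. h t * t powr (1/2 - H1)) \<omega>
     + wiener_integral P0 W2 T (\<lambda>s. LINT t:{s..T}|lborel. h t * dKH H1 H2 t s) \<omega>"

definition bracketNT :: "real \<Rightarrow> real \<Rightarrow> (real \<Rightarrow> real) \<Rightarrow> real" where
  "bracketNT H1 T h = (gammaH H1)\<^sup>2 * (LINT t:{0..T}|lborel. h t * t powr (1 - 2 * H1))"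

definition Ptheta :: "real \<Rightarrow> 'a measure \<Rightarrow> (real \<Rightarrow> 'a \<Rightarrow> real) \<Rightarrow> real \<Rightarrow> real \<Rightarrow> 'a measure" where
  "Ptheta H1 P0 W1 T \<theta> = density P0 (\<lambda>\<omega>. ennreal (exp (\<theta> * kappa H1 * X1T H1 P0 W1 T \<omega>
        - 1/2 * \<theta>\<^sup>2 * (kappa H1)\<^sup>2 * (gammaH H1)\<^sup>2 * T powr (2 - 2 * H1) / (2 - 2 * H1))))"

definition mle :: "real \<Rightarrow> real \<Rightarrow> 'a measure \<Rightarrow> (real \<Rightarrow> 'a \<Rightarrow> real) \<Rightarrow> (real \<Rightarrow> 'a \<Rightarrow> real)
                  \<Rightarrow> real \<Rightarrow> (real \<Rightarrow> real) \<Rightarrow> 'a \<Rightarrow> real" where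
  "mle H1 H2 P0 W1 W2 T h \<omega> = NT H1 H2 P0 W1 W2 T h \<omega> / (kappa H1 * bracketNT H1 T h)"

end

theory Submission
  imports Defs
begin

text \<open>
  Write \<open>g(t) = t powr (1/2 - H1)\<close>, \<open>f = h g\<close> and let \<open>k\<close> be the transform of \<open>h\<close> by
  \<open>\<partial>\<^sub>t K\<close>. Under \<open>P\<^sub>0\<close> the statistic \<open>N = \<gamma> \<integral>f dW\<^sub>1 + \<integral>k dW\<^sub>2\<close> and \<open>X\<^sub>1(T) = \<gamma> \<integral>g dW\<^sub>1\<close> are jointly
  centred Gaussian, as limits in \<open>L\<^sup>2\<close> of linear combinations of independent increments. Tilting by the
  exponential of a multiple of \<open>X\<^sub>1(T)\<close> keeps the variance of \<open>N\<close> and shifts its mean by the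
  covariance, which is \<open>\<theta> \<kappa> \<gamma>\<^sup>2 \<integral>f g = \<theta> \<kappa> \<langle>N\<rangle>\<close>. Multiplying the integral equation by \<open>h\<close> and integrating gives
  \<open>\<gamma>\<^sup>2 \<integral>f g = \<gamma>\<^sup>2 \<integral>f\<^sup>2 + \<integral>\<integral>h(s) h(u) kH(s,u)\<close>, and the double integral is \<open>\<integral>k\<^sup>2\<close> by Fubini, so that the variance of
  \<open>N\<close> is also \<open>\<langle>N\<rangle>\<close>. Fubini, and \<open>k \<in> L\<^sup>2\<close>, follow from the bound
  \<open>|\<partial>\<^sub>t K(t,s)| \<le> C s powr (1/2 - H2) t powr (H2 - H1) (t - s) powr (H2 - H1 - 1)\<close> and Schur's test.
\<close>

section \<open>Square-integrable functions\<close>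

text \<open>\<open>wiener_integral\<close> picks an arbitrary version, known only as an L2 limit of
  step integrals, and each of the three Wiener integrals involved brings its own approximating
  partitions. So the probabilistic lemmas hold for every version, and partitions are merged before
  independence of increments is used. L2 convergence does not control the unbounded density of
  \<open>Ptheta\<close>. What is carried to the limit is therefore the mixed transform E exp(i u N +
  c Z) for real u and c, where Z is the Wiener integral of g: a uniform exponential moment bound
  makes it continuous, its modulus carries the variances and its phase the covariance. The law of N
  under the tilted measure is then read off by uniqueness of characteristic functions, and nothing
  has to be said about the paths under \<open>Ptheta\<close>. A second obstacle is that the
  estimator divides by <N>, whose sign is not visible in its definition. It becomes visible only
  once <N> is known to be a variance, and strict positivity needs (E_T) at individual points, not
  just almost everywhere.\<close>

lemma integrable_mult_of_sq:
  fixes f g :: "'a \<Rightarrow> real"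
  assumes [measurable]: "f \<in> borel_measurable M" "g \<in> borel_measurable M"
    and "integrable M (\<lambda>x. (f x)\<^sup>2)" "integrable M (\<lambda>x. (g x)\<^sup>2)"
  shows "integrable M (\<lambda>x. f x * g x)"
proof (rule Bochner_Integration.integrable_bound)
  show "integrable M (\<lambda>x. (f x)\<^sup>2 + (g x)\<^sup>2)" using assms by simp
  show "AE x in M. norm (f x * g x) \<le> norm ((f x)\<^sup>2 + (g x)\<^sup>2)"
  proof (rule AE_I2)
    fix x
    have "2 * (\<bar>f x\<bar> * \<bar>g x\<bar>) \<le> (f x)\<^sup>2 + (g x)\<^sup>2"
      using sum_squares_bound[of "\<bar>f x\<bar>" "\<bar>g x\<bar>"] by simp
    moreover have "0 \<le> \<bar>f x\<bar> * \<bar>g x\<bar>" by simp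
    ultimately have "\<bar>f x\<bar> * \<bar>g x\<bar> \<le> (f x)\<^sup>2 + (g x)\<^sup>2" by linarith
    then show "norm (f x * g x) \<le> norm ((f x)\<^sup>2 + (g x)\<^sup>2)"
      by (simp add: abs_mult)
  qed
qed simp

lemma integrable_sq_add:
  fixes f g :: "'a \<Rightarrow> real"
  assumes [measurable]: "f \<in> borel_measurable M" "g \<in> borel_measurable M"
    and "integrable M (\<lambda>x. (f x)\<^sup>2)" "integrable M (\<lambda>x. (g x)\<^sup>2)"
  shows "integrable M (\<lambda>x. (f x + g x)\<^sup>2)"
  using integrable_mult_of_sq[OF assms] assms by (simp add: power2_sum mult.assoc)

lemma integrable_sq_diff:
  fixes f g :: "'a \<Rightarrow> real"
  assumes [measurable]: "f \<in> borel_measurable M" "g \<in> borel_measurable M"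
    and "integrable M (\<lambda>x. (f x)\<^sup>2)" "integrable M (\<lambda>x. (g x)\<^sup>2)"
  shows "integrable M (\<lambda>x. (f x - g x)\<^sup>2)"
  using integrable_mult_of_sq[OF assms] assms by (simp add: power2_diff mult.assoc)

lemma Cauchy_Schwarz_integral:
  fixes f g :: "'a \<Rightarrow> real"
  assumes [measurable]: "f \<in> borel_measurable M" "g \<in> borel_measurable M"
    and f: "integrable M (\<lambda>x. (f x)\<^sup>2)" and g: "integrable M (\<lambda>x. (g x)\<^sup>2)"
  shows "(\<integral>x. \<bar>f x * g x\<bar> \<partial>M)\<^sup>2 \<le> (\<integral>x. (f x)\<^sup>2 \<partial>M) * (\<integral>x. (g x)\<^sup>2 \<partial>M)"
proof -
  have i: "integrable M (\<lambda>x. \<bar>f x * g x\<bar>)"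
    using integrable_mult_of_sq[OF assms] by simp
  have "(\<integral>\<^sup>+x. ennreal \<bar>f x\<bar> * ennreal \<bar>g x\<bar> \<partial>M) = ennreal (\<integral>x. \<bar>f x * g x\<bar> \<partial>M)"
    using nn_integral_eq_integral[OF i] by (simp add: abs_mult ennreal_mult)
  then have "ennreal ((\<integral>x. \<bar>f x * g x\<bar> \<partial>M)\<^sup>2) = (\<integral>\<^sup>+x. ennreal \<bar>f x\<bar> * ennreal \<bar>g x\<bar> \<partial>M)\<^sup>2"
    by (simp add: ennreal_power)
  also have "\<dots> \<le> (\<integral>\<^sup>+x. (ennreal \<bar>f x\<bar>)\<^sup>2 \<partial>M) * (\<integral>\<^sup>+x. (ennreal \<bar>g x\<bar>)\<^sup>2 \<partial>M)"
    by (rule Cauchy_Schwarz_nn_integral) auto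
  also have "\<dots> = ennreal ((\<integral>x. (f x)\<^sup>2 \<partial>M) * (\<integral>x. (g x)\<^sup>2 \<partial>M))"
    by (simp add: ennreal_power ennreal_mult nn_integral_eq_integral[OF f] nn_integral_eq_integral[OF g])
  finally show ?thesis by (simp add: ennreal_le_iff)
qed

lemma Cauchy_Schwarz_integral_sqrt:
  fixes f g :: "'a \<Rightarrow> real"
  assumes [measurable]: "f \<in> borel_measurable M" "g \<in> borel_measurable M"
    and f: "integrable M (\<lambda>x. (f x)\<^sup>2)" and g: "integrable M (\<lambda>x. (g x)\<^sup>2)"
  shows "(\<integral>x. \<bar>f x * g x\<bar> \<partial>M) \<le> sqrt (\<integral>x. (f x)\<^sup>2 \<partial>M) * sqrt (\<integral>x. (g x)\<^sup>2 \<partial>M)"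
  using real_le_rsqrt[OF Cauchy_Schwarz_integral[OF assms]] by (simp add: real_sqrt_mult)

text \<open>F G - f g is a product of two errors minus two products of one error with a fixed limit,
  so Cauchy--Schwarz suffices and no bound on the norms of the approximants is needed. With F = G it
  gives convergence of variances, otherwise of covariances.\<close>

lemma tendsto_integral_mult_L2:
  fixes f g :: "'a \<Rightarrow> real" and F G :: "nat \<Rightarrow> 'a \<Rightarrow> real"
  assumes [measurable]: "f \<in> borel_measurable M" "g \<in> borel_measurable M"
      "\<And>k. F k \<in> borel_measurable M" "\<And>k. G k \<in> borel_measurable M"
    and f: "integrable M (\<lambda>x. (f x)\<^sup>2)" and g: "integrable M (\<lambda>x. (g x)\<^sup>2)"
    and F: "\<And>k. integrable M (\<lambda>x. (F k x)\<^sup>2)" and G: "\<And>k. integrable M (\<lambda>x. (G k x)\<^sup>2)"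
    and Ff: "(\<lambda>k. \<integral>x. (f x - F k x)\<^sup>2 \<partial>M) \<longlonglongrightarrow> 0" and Gg: "(\<lambda>k. \<integral>x. (g x - G k x)\<^sup>2 \<partial>M) \<longlonglongrightarrow> 0"
  shows "(\<lambda>k. \<integral>x. F k x * G k x \<partial>M) \<longlonglongrightarrow> (\<integral>x. f x * g x \<partial>M)"
proof -
  define a where "a k = (\<integral>x. (f x - F k x)\<^sup>2 \<partial>M)" for k
  define b where "b k = (\<integral>x. (g x - G k x)\<^sup>2 \<partial>M)" for k
  define nf where "nf = (\<integral>x. (f x)\<^sup>2 \<partial>M)"
  define ng where "ng = (\<integral>x. (g x)\<^sup>2 \<partial>M)"
  note dF = integrable_sq_diff[OF assms(1,3) f F] and dG = integrable_sq_diff[OF assms(2,4) g G]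
  have le: "\<bar>(\<integral>x. F k x * G k x \<partial>M) - (\<integral>x. f x * g x \<partial>M)\<bar>
      \<le> sqrt (a k) * sqrt (b k) + sqrt (a k) * sqrt ng + sqrt nf * sqrt (b k)" for k
  proof -
    let ?p = "\<lambda>x. (f x - F k x) * (g x - G k x)"
    let ?q = "\<lambda>x. (f x - F k x) * g x"
    let ?r = "\<lambda>x. f x * (g x - G k x)"
    have i: "integrable M ?p" "integrable M ?q" "integrable M ?r"
      using dF dG f g by (auto intro!: integrable_mult_of_sq)
    have *: "\<bar>\<integral>x. u x * v x \<partial>M\<bar> \<le> sqrt (\<integral>x. (u x)\<^sup>2 \<partial>M) * sqrt (\<integral>x. (v x)\<^sup>2 \<partial>M)"
      if "u \<in> borel_measurable M" "v \<in> borel_measurable M"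
        "integrable M (\<lambda>x. (u x)\<^sup>2)" "integrable M (\<lambda>x. (v x)\<^sup>2)" for u v :: "'a \<Rightarrow> real"
      using order_trans[OF integral_norm_bound[of M "\<lambda>x. u x * v x"], unfolded real_norm_def,
          OF Cauchy_Schwarz_integral_sqrt[OF that]] .
    have pqr: "\<bar>integral\<^sup>L M ?p\<bar> \<le> sqrt (a k) * sqrt (b k)"
      "\<bar>integral\<^sup>L M ?q\<bar> \<le> sqrt (a k) * sqrt ng" "\<bar>integral\<^sup>L M ?r\<bar> \<le> sqrt nf * sqrt (b k)"
      unfolding a_def b_def ng_def nf_def by (rule *; use dF dG f g in simp)+
    have "(\<integral>x. F k x * G k x \<partial>M) - (\<integral>x. f x * g x \<partial>M) = (\<integral>x. F k x * G k x - f x * g x \<partial>M)"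
      using f g F G by (intro Bochner_Integration.integral_diff[symmetric] integrable_mult_of_sq) auto
    also have "\<dots> = (\<integral>x. ?p x - ?q x - ?r x \<partial>M)"
      by (intro Bochner_Integration.integral_cong) (auto simp: algebra_simps)
    also have "\<dots> = integral\<^sup>L M ?p - integral\<^sup>L M ?q - integral\<^sup>L M ?r"
      using i by simp
    finally have eq: "(\<integral>x. F k x * G k x \<partial>M) - (\<integral>x. f x * g x \<partial>M) = integral\<^sup>L M ?p - integral\<^sup>L M ?q - integral\<^sup>L M ?r" .
    have "\<bar>(\<integral>x. F k x * G k x \<partial>M) - (\<integral>x. f x * g x \<partial>M)\<bar> \<le> \<bar>integral\<^sup>L M ?p\<bar> + \<bar>integral\<^sup>L M ?q\<bar> + \<bar>integral\<^sup>L M ?r\<bar>"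
      unfolding eq by (rule order_trans[OF abs_triangle_ineq4 add_mono[OF abs_triangle_ineq4 order_refl]])
    also have "\<dots> \<le> sqrt (a k) * sqrt (b k) + sqrt (a k) * sqrt ng + sqrt nf * sqrt (b k)"
      by (intro add_mono pqr)
    finally show ?thesis .
  qed
  have s: "(\<lambda>k. sqrt (a k)) \<longlonglongrightarrow> 0" "(\<lambda>k. sqrt (b k)) \<longlonglongrightarrow> 0"
    using tendsto_real_sqrt[OF Ff] tendsto_real_sqrt[OF Gg] by (simp_all add: a_def b_def)
  have "(\<lambda>k. sqrt (a k) * sqrt (b k) + sqrt (a k) * sqrt ng + sqrt nf * sqrt (b k)) \<longlonglongrightarrow> 0"
    using tendsto_add[OF tendsto_add[OF tendsto_mult[OF s] tendsto_mult_right[OF s(1), of "sqrt ng"]]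
        tendsto_mult_left[OF s(2), of "sqrt nf"]] by simp
  then have "(\<lambda>k. (\<integral>x. F k x * G k x \<partial>M) - (\<integral>x. f x * g x \<partial>M)) \<longlonglongrightarrow> 0"
    by (rule Lim_null_comparison[rotated]) (use le in simp)
  then show ?thesis by (simp add: LIM_zero_iff)
qed

lemma (in finite_measure) integral_abs_le_sqrt:
  fixes f :: "'a \<Rightarrow> real"
  assumes [measurable]: "f \<in> borel_measurable M" and f: "integrable M (\<lambda>x. (f x)\<^sup>2)"
  shows "(\<integral>x. \<bar>f x\<bar> \<partial>M) \<le> sqrt (\<integral>x. (f x)\<^sup>2 \<partial>M) * sqrt (measure M (space M))"
  using Cauchy_Schwarz_integral_sqrt[of f M "\<lambda>_. 1"] f by simp

text \<open>Riesz--Fischer. On a finite measure an L2 Cauchy sequence is L1 Cauchy, which yields an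
  almost everywhere convergent subsequence. Fatou's lemma along it turns the bound between terms
  into a bound on the distance to the limit.\<close>

lemma (in finite_measure) L2_complete:
  fixes Y :: "nat \<Rightarrow> 'a \<Rightarrow> real"
  assumes Ym[measurable]: "\<And>k. Y k \<in> borel_measurable M" and Yi: "\<And>k. integrable M (\<lambda>x. (Y k x)\<^sup>2)"
    and C: "\<And>e. e > 0 \<Longrightarrow> \<exists>N. \<forall>i\<ge>N. \<forall>j\<ge>N. (\<integral>x. (Y i x - Y j x)\<^sup>2 \<partial>M) < e"
  obtains Z where "Z \<in> borel_measurable M" "integrable M (\<lambda>x. (Z x)\<^sup>2)"
    "(\<lambda>k. \<integral>x. (Z x - Y k x)\<^sup>2 \<partial>M) \<longlonglongrightarrow> 0"
proof -
  note Yd = integrable_sq_diff[OF Ym Ym Yi Yi]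
  have Y1: "integrable M (Y k)" for k
    by (rule square_integrable_imp_integrable) (use Yi in auto)
  have C1: "\<exists>N. \<forall>i\<ge>N. \<forall>j\<ge>N. (\<integral>x. norm (Y i x - Y j x) \<partial>M) < e" if e: "e > 0" for e
  proof -
    \<comment> \<open>The added 1 keeps \<open>m\<close> positive when the whole space has measure
      zero.\<close>
    define m where "m = measure M (space M) + 1"
    have m: "m > 0" by (simp add: m_def add_nonneg_pos)
    obtain N where N: "\<And>i j. i \<ge> N \<Longrightarrow> j \<ge> N \<Longrightarrow> (\<integral>x. (Y i x - Y j x)\<^sup>2 \<partial>M) < (e / sqrt m)\<^sup>2"
      using C[of "(e / sqrt m)\<^sup>2"] e m by auto
    have "(\<integral>x. norm (Y i x - Y j x) \<partial>M) < e" if "i \<ge> N" "j \<ge> N" for i j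
    proof -
      have "(\<integral>x. norm (Y i x - Y j x) \<partial>M) \<le> sqrt (\<integral>x. (Y i x - Y j x)\<^sup>2 \<partial>M) * sqrt (measure M (space M))"
        using integral_abs_le_sqrt[of "\<lambda>x. Y i x - Y j x"] Yd by simp
      also have "\<dots> \<le> sqrt (\<integral>x. (Y i x - Y j x)\<^sup>2 \<partial>M) * sqrt m"
        by (intro mult_left_mono) (auto simp: m_def)
      also have "\<dots> < e / sqrt m * sqrt m"
        using real_sqrt_less_mono[OF N[OF that]] m e by (intro mult_strict_right_mono) auto
      finally show ?thesis using m by simp
    qed
    then show ?thesis by blast
  qed
  obtain r where r: "strict_mono r" and ae: "AE x in M. Cauchy (\<lambda>i. Y (r i) x)"
    using cauchy_L1_AE_cauchy_subseq[OF Y1 C1] by blast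
  define Z where "Z x = lim (\<lambda>i. Y (r i) x)" for x
  have [measurable]: "Z \<in> borel_measurable M"
    unfolding Z_def by (rule borel_measurable_lim_metric) simp
  have lim: "AE x in M. (\<lambda>i. Y (r i) x) \<longlonglongrightarrow> Z x"
    using ae by eventually_elim (auto simp: Z_def dest: Cauchy_convergent convergent_LIMSEQ_iff[THEN iffD1])
  have fatou: "(\<integral>\<^sup>+x. ennreal ((Z x - Y k x)\<^sup>2) \<partial>M) \<le> ennreal e"
    if N: "\<And>i j. i \<ge> N \<Longrightarrow> j \<ge> N \<Longrightarrow> (\<integral>x. (Y i x - Y j x)\<^sup>2 \<partial>M) < e" and k: "k \<ge> N" for e N k
  proof -
    have "(\<integral>\<^sup>+x. ennreal ((Z x - Y k x)\<^sup>2) \<partial>M) = (\<integral>\<^sup>+x. liminf (\<lambda>i. ennreal ((Y (r i) x - Y k x)\<^sup>2)) \<partial>M)"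
      using lim
    proof (intro nn_integral_cong_AE, eventually_elim)
      case (elim x)
      then have "(\<lambda>i. ennreal ((Y (r i) x - Y k x)\<^sup>2)) \<longlonglongrightarrow> ennreal ((Z x - Y k x)\<^sup>2)"
        by (intro tendsto_intros)
      then show ?case by (intro lim_imp_Liminf[symmetric]) auto
    qed
    also have "\<dots> \<le> liminf (\<lambda>i. \<integral>\<^sup>+x. ennreal ((Y (r i) x - Y k x)\<^sup>2) \<partial>M)"
      by (rule nn_integral_liminf) simp
    also have "\<dots> \<le> ennreal e"
    proof (rule Liminf_le)
      have "r i \<ge> N" if "i \<ge> N" for i using seq_suble[OF r, of i] that by linarith
      then show "\<forall>\<^sub>F i in sequentially. (\<integral>\<^sup>+x. ennreal ((Y (r i) x - Y k x)\<^sup>2) \<partial>M) \<le> ennreal e"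
        using N k by (auto simp: eventually_sequentially nn_integral_eq_integral[OF Yd] less_imp_le
            intro!: exI[of _ N] ennreal_leI)
    qed simp
    finally show ?thesis .
  qed
  have Zd: "integrable M (\<lambda>x. (Z x - Y k x)\<^sup>2) \<and> (\<integral>x. (Z x - Y k x)\<^sup>2 \<partial>M) \<le> e"
    if N: "\<And>i j. i \<ge> N \<Longrightarrow> j \<ge> N \<Longrightarrow> (\<integral>x. (Y i x - Y j x)\<^sup>2 \<partial>M) < e" and k: "k \<ge> N" and "e \<ge> 0" for e N k
  proof -
    have i: "integrable M (\<lambda>x. (Z x - Y k x)\<^sup>2)"
      using fatou[OF N k] by (intro integrableI_bounded) (auto intro: le_less_trans)
    then show ?thesis using fatou[OF N k] \<open>e \<ge> 0\<close>
      by (simp add: nn_integral_eq_integral[OF i])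
  qed
  show ?thesis
  proof
    obtain N where N: "\<forall>i\<ge>N. \<forall>j\<ge>N. (\<integral>x. (Y i x - Y j x)\<^sup>2 \<partial>M) < 1" using C[of 1] by auto
    have "integrable M (\<lambda>x. (Z x - Y N x)\<^sup>2)" using Zd[of N 1 N] N by auto
    from integrable_sq_add[OF _ _ this Yi[of N]] show "integrable M (\<lambda>x. (Z x)\<^sup>2)" by simp
    show "(\<lambda>k. \<integral>x. (Z x - Y k x)\<^sup>2 \<partial>M) \<longlonglongrightarrow> 0"
    proof (rule LIMSEQ_I)
      fix e :: real assume e: "e > 0"
      then obtain N where N: "\<forall>i\<ge>N. \<forall>j\<ge>N. (\<integral>x. (Y i x - Y j x)\<^sup>2 \<partial>M) < e/2" using C[of "e/2"] by auto
      have "norm ((\<integral>x. (Z x - Y k x)\<^sup>2 \<partial>M) - 0) < e" if "k \<ge> N" for k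
        using Zd[of N "e/2" k] N that e by auto
      then show "\<exists>no. \<forall>n\<ge>no. norm ((\<integral>x. (Z x - Y n x)\<^sup>2 \<partial>M) - 0) < e" by blast
    qed
  qed simp
qed

section \<open>Step functions\<close>

text \<open>A density instead of a restricted space: the sigma-algebra stays the Borel sets of the
  whole line, so measurability never has to be relativised to [0,T], and set integrals become plain
  integrals.\<close>

definition lebT :: "real \<Rightarrow> real measure" where
  "lebT T = density lborel (indicator {0..T})"

lemma sets_lebT [simp, measurable_cong]: "sets (lebT T) = sets borel"
  by (simp add: lebT_def)

lemma space_lebT [simp]: "space (lebT T) = UNIV"
  by (simp add: lebT_def)

lemma set_integral_eq_lebT:
  fixes F :: "real \<Rightarrow> real"
  assumes [measurable]: "F \<in> borel_measurable borel"
  shows "(LINT s:{0..T}|lborel. F s) = (\<integral>s. F s \<partial>lebT T)"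
  using integral_density[of F lborel "indicator {0..T}"]
  by (simp add: set_lebesgue_integral_def lebT_def ennreal_indicator)

lemma set_integrable_iff_lebT:
  fixes F :: "real \<Rightarrow> real"
  assumes [measurable]: "F \<in> borel_measurable borel"
  shows "set_integrable lborel {0..T} F \<longleftrightarrow> integrable (lebT T) F"
  using integrable_density[of F lborel "indicator {0..T}"]
  by (simp add: set_integrable_def lebT_def ennreal_indicator)

lemma emeasure_lebT:
  assumes [measurable]: "A \<in> sets borel"
  shows "emeasure (lebT T) A = emeasure lborel ({0..T} \<inter> A)"
  by (simp add: lebT_def emeasure_restricted)

lemma finite_measure_lebT: "finite_measure (lebT T)"
  by standard (simp add: emeasure_lebT emeasure_lborel_Icc_eq)

lemma AE_lebT_iff: "(AE s in lebT T. P s) \<longleftrightarrow> (AE s in lborel. s \<in> {0..T} \<longrightarrow> P s)"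
  unfolding lebT_def by (subst AE_density) (auto simp: indicator_def cong: AE_cong)

text \<open>The condition that \<open>is_wiener_integral\<close> puts on its approximations. Cells
  may be empty; the refinements below remove such cells.\<close>

definition partition_in :: "real \<Rightarrow> nat \<Rightarrow> (nat \<Rightarrow> real) \<Rightarrow> bool" where
  "partition_in T n ts \<longleftrightarrow> 0 \<le> ts 0 \<and> ts n \<le> T \<and> (\<forall>i<n. ts i \<le> ts (Suc i))"

lemma borel_measurable_step_fun [measurable]: "step_fun n ts cs \<in> borel_measurable borel"
  unfolding step_fun_def[abs_def] by measurable

section \<open>Refinement of partitions\<close>

lemma partition_mono:
  fixes p :: "nat \<Rightarrow> real"
  assumes "\<And>i. i < n \<Longrightarrow> p i \<le> p (Suc i)" "i \<le> j" "j \<le> n"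
  shows "p i \<le> p j"
  using assms(2,3)
proof (induct j rule: dec_induct)
  case (step k)
  from step.prems have "k < n" "k \<le> n" by linarith+
  from order_trans[OF step.hyps(3)[OF this(2)] assms(1)[OF this(1)]] show ?case .
qed (rule order_refl)

lemma partition_strict_mono:
  fixes p :: "nat \<Rightarrow> real"
  assumes "\<And>i. i < n \<Longrightarrow> p i < p (Suc i)" "i < j" "j \<le> n"
  shows "p i < p j"
proof -
  have "p (Suc i) \<le> p j" by (rule partition_mono[where n = n and p = p]) (use assms in \<open>simp_all add: less_imp_le Suc_le_eq\<close>)
  then show ?thesis using assms(1)[of i] assms(2,3) by simp
qed

text \<open>Each coarse increment telescopes over the fine cells inside it. A fine cell lies in a
  coarse one exactly when its right endpoint does, because cells are open on the left; so the new
  coefficient is the step function evaluated at that endpoint.\<close>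

lemma increments_refine:
  fixes V :: "real \<Rightarrow> real"
  assumes p: "\<And>j. j < m \<Longrightarrow> p j < p (Suc j)"
    and ts: "\<And>i. i < n \<Longrightarrow> ts i \<le> ts (Suc i)" and sub: "\<And>i. i \<le> n \<Longrightarrow> ts i \<in> p ` {..m}"
  shows "(\<Sum>i<n. cs i * (V (ts (Suc i)) - V (ts i)))
    = (\<Sum>j<m. step_fun n ts cs (p (Suc j)) * (V (p (Suc j)) - V (p j)))"
proof -
  note mono = partition_strict_mono[where n = m and p = p, OF p]
  have *: "V (ts (Suc i)) - V (ts i)
      = (\<Sum>j<m. indicator {ts i<..ts (Suc i)} (p (Suc j)) * (V (p (Suc j)) - V (p j)))"
    if i: "i < n" for i
  proof -
    obtain k where k: "k \<le> m" "ts i = p k" using sub[of i] i by auto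
    obtain l where l: "l \<le> m" "ts (Suc i) = p l" using sub[of "Suc i"] i by auto
    have iff: "p x < p y \<longleftrightarrow> x < y" if "x \<le> m" "y \<le> m" for x y
      using mono[of x y] mono[of y x] that by (cases x y rule: linorder_cases) auto
    have kl: "k \<le> l" using ts[OF i] iff[OF l(1) k(1)] k l by linarith
    have "(\<Sum>j<m. indicator {ts i<..ts (Suc i)} (p (Suc j)) * (V (p (Suc j)) - V (p j)))
        = (\<Sum>j\<in>{k..<l}. V (p (Suc j)) - V (p j))"
    proof (rule sum.mono_neutral_cong_right)
      have ind: "p (Suc j) \<in> {ts i<..ts (Suc i)} \<longleftrightarrow> j \<in> {k..<l}" if "j < m" for j
        using iff[of k "Suc j"] iff[of l "Suc j"] that k l by auto
      show "\<forall>j\<in>{..<m} - {k..<l}. indicator {ts i<..ts (Suc i)} (p (Suc j)) * (V (p (Suc j)) - V (p j)) = 0"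
        using ind by auto
      show "indicator {ts i<..ts (Suc i)} (p (Suc j)) * (V (p (Suc j)) - V (p j)) = V (p (Suc j)) - V (p j)"
        if "j \<in> {k..<l}" for j
        using ind[of j] that l by auto
    qed (use l in auto)
    also have "\<dots> = V (p l) - V (p k)"
      using sum_Suc_diff'[OF kl, of "\<lambda>j. V (p j)"] .
    finally show ?thesis by (simp add: k l)
  qed
  have "(\<Sum>i<n. cs i * (V (ts (Suc i)) - V (ts i)))
      = (\<Sum>i<n. \<Sum>j<m. cs i * (indicator {ts i<..ts (Suc i)} (p (Suc j)) * (V (p (Suc j)) - V (p j))))"
    by (intro sum.cong refl) (simp only: * sum_distrib_left lessThan_iff)
  also have "\<dots> = (\<Sum>j<m. \<Sum>i<n. cs i * (indicator {ts i<..ts (Suc i)} (p (Suc j)) * (V (p (Suc j)) - V (p j))))"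
    by (rule sum.swap)
  also have "\<dots> = (\<Sum>j<m. step_fun n ts cs (p (Suc j)) * (V (p (Suc j)) - V (p j)))"
    by (simp only: step_fun_def sum_distrib_right mult.assoc)
  finally show ?thesis .
qed

lemma step_int_refine:
  assumes "\<And>j. j < m \<Longrightarrow> p j < p (Suc j)"
    and "\<And>i. i < n \<Longrightarrow> ts i \<le> ts (Suc i)" "\<And>i. i \<le> n \<Longrightarrow> ts i \<in> p ` {..m}"
  shows "step_int W n ts cs = step_int W m p (\<lambda>j. step_fun n ts cs (p (Suc j)))"
proof
  show "step_int W n ts cs \<omega> = step_int W m p (\<lambda>j. step_fun n ts cs (p (Suc j))) \<omega>" for \<omega>
    unfolding step_int_def by (rule increments_refine) (use assms in auto)
qed

text \<open>A step function evaluated at \<^term>\<open>s\<close> is the step integral of the path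
  \<open>t \<mapsto> 1[s \<le> t]\<close>, so its refinement is an instance of that of step integrals.\<close>
lemma step_fun_refine:
  assumes p: "\<And>j. j < m \<Longrightarrow> p j < p (Suc j)"
    and ts: "\<And>i. i < n \<Longrightarrow> ts i \<le> ts (Suc i)" and sub: "\<And>i. i \<le> n \<Longrightarrow> ts i \<in> p ` {..m}"
  shows "step_fun n ts cs = step_fun m p (\<lambda>j. step_fun n ts cs (p (Suc j)))"
proof
  fix s :: real
  have ind: "indicator {a<..b} s = of_bool (s \<le> b) - (of_bool (s \<le> a) :: real)" if "a \<le> b" for a b
    using that by (auto simp: indicator_def)
  have "step_fun n ts cs s = (\<Sum>i<n. cs i * (of_bool (s \<le> ts (Suc i)) - of_bool (s \<le> ts i)))"
    unfolding step_fun_def by (intro sum.cong refl) (simp add: ind ts)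
  also have "\<dots> = (\<Sum>j<m. step_fun n ts cs (p (Suc j)) * (of_bool (s \<le> p (Suc j)) - of_bool (s \<le> p j)))"
    by (rule increments_refine) (use assms in auto)
  also have "\<dots> = step_fun m p (\<lambda>j. step_fun n ts cs (p (Suc j))) s"
    unfolding step_fun_def[of m p] by (intro sum.cong refl) (simp add: ind p less_imp_le)
  finally show "step_fun n ts cs s = step_fun m p (\<lambda>j. step_fun n ts cs (p (Suc j))) s" .
qed

text \<open>Sorting the finite set of all partition points removes repetitions, so the merged
  partition is strictly increasing. Strictness matters because \<open>wiener_process\<close>
  prescribes a normal law only for increments over nonempty intervals. The same new coefficients
  serve the step functions and their integrals.\<close>

lemma common_refinement:
  assumes "partition_in T n ts" "partition_in T n' ts'"
  obtains m p a b where "0 \<le> p 0" "p m \<le> T" "\<And>j. j < m \<Longrightarrow> p j < p (Suc j)"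
    "step_fun n ts cs = step_fun m p a" "step_fun n' ts' cs' = step_fun m p b"
    "\<And>W :: real \<Rightarrow> 'a \<Rightarrow> real. step_int W n ts cs = step_int W m p a"
    "\<And>W :: real \<Rightarrow> 'a \<Rightarrow> real. step_int W n' ts' cs' = step_int W m p b"
proof -
  define S where "S = ts ` {..n} \<union> ts' ` {..n'}"
  define l where "l = sorted_list_of_set S"
  define m where "m = length l - 1"
  have S: "finite S" "S \<noteq> {}" by (auto simp: S_def)
  then have l: "set l = S" "sorted l" "distinct l" by (auto simp: l_def)
  have len: "length l = Suc m" using S l(1) by (cases l) (auto simp: m_def)
  have im: "(!) l ` {..m} = S"
    using l(1) len by (auto simp: set_conv_nth less_Suc_eq_le image_def)
  have bnd: "0 \<le> x \<and> x \<le> T" if "x \<in> S" for x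
  proof -
    have *: "0 \<le> us i \<and> us i \<le> T" if "partition_in T k us" "i \<le> k" for k us i
      using partition_mono[of k us 0 i] partition_mono[of k us i k] that by (auto simp: partition_in_def)
    show ?thesis using that assms * unfolding S_def by blast
  qed
  have str: "l ! j < l ! Suc j" if "j < m" for j
    using l that len sorted_wrt_nth_less[of "(<)" l j "Suc j"] by (simp add: strict_sorted_iff)
  show ?thesis
  proof
    show "0 \<le> l ! 0" "l ! m \<le> T" using bnd[of "l ! 0"] bnd[of "l ! m"] im by auto
    show "\<And>j. j < m \<Longrightarrow> l ! j < l ! Suc j" by (rule str)
    show "step_fun n ts cs = step_fun m ((!) l) (\<lambda>j. step_fun n ts cs (l ! Suc j))"
      "step_fun n' ts' cs' = step_fun m ((!) l) (\<lambda>j. step_fun n' ts' cs' (l ! Suc j))"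
      by (rule step_fun_refine; use str assms im in \<open>auto simp: partition_in_def S_def\<close>)+
    show "step_int W n ts cs = step_int W m ((!) l) (\<lambda>j. step_fun n ts cs (l ! Suc j))"
      "step_int W n' ts' cs' = step_int W m ((!) l) (\<lambda>j. step_fun n' ts' cs' (l ! Suc j))"
      for W :: "real \<Rightarrow> 'a \<Rightarrow> real"
      by (rule step_int_refine; use str assms im in \<open>auto simp: partition_in_def S_def\<close>)+
  qed
qed

section \<open>Algebra and integrals of step functions on one partition\<close>

lemma step_fun_eq:
  assumes p: "\<And>j. j < m \<Longrightarrow> p j \<le> p (Suc j)" and i: "i < m" and s: "p i < s" "s \<le> p (Suc i)"
  shows "step_fun m p c s = c i"
proof -
  have "c j * indicator {p j<..p (Suc j)} s = (if j = i then c i else 0)" if "j < m" for j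
  proof -
    have "s \<notin> {p j<..p (Suc j)}" if "j \<noteq> i"
      using partition_mono[where n = m and p = p, OF p, of "Suc i" j] partition_mono[where n = m and p = p, OF p, of "Suc j" i] s i that \<open>j < m\<close>
      by (cases i j rule: linorder_cases) auto
    then show ?thesis using s by auto
  qed
  then have "step_fun m p c s = (\<Sum>j<m. if j = i then c i else 0)"
    unfolding step_fun_def by (intro sum.cong) auto
  then show ?thesis using i by simp
qed

lemma step_fun_eq_0:
  assumes "\<And>j. j < m \<Longrightarrow> s \<notin> {p j<..p (Suc j)}"
  shows "step_fun m p c s = 0"
  unfolding step_fun_def using assms by (intro sum.neutral) auto

text \<open>Cells are disjoint, so cross terms vanish; squares and products are again step
  functions, which \<open>step_fun_integral\<close> can integrate.\<close>

lemma step_fun_mult: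
  assumes p: "\<And>j. j < m \<Longrightarrow> p j \<le> p (Suc j)"
  shows "step_fun m p a s * step_fun m p b s = step_fun m p (\<lambda>j. a j * b j) s"
proof (cases "\<exists>i<m. s \<in> {p i<..p (Suc i)}")
  case True
  then obtain i where "i < m" "p i < s" "s \<le> p (Suc i)" by auto
  then show ?thesis by (simp add: step_fun_eq[where m = m and p = p, OF p])
next
  case False
  then show ?thesis by (subst (1 2 3) step_fun_eq_0) auto
qed

lemma step_fun_diff: "step_fun m p (\<lambda>j. a j - b j) s = step_fun m p a s - step_fun m p b s"
  by (simp add: step_fun_def sum_subtractf left_diff_distrib)

lemma step_fun_integral:
  assumes "0 \<le> p 0" "p m \<le> T" and p: "\<And>j. j < m \<Longrightarrow> p j \<le> p (Suc j)"
  shows "integrable (lebT T) (step_fun m p c)"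
    and "(\<integral>s. step_fun m p c s \<partial>lebT T) = (\<Sum>j<m. c j * (p (Suc j) - p j))"
proof -
  have sub: "{p j<..p (Suc j)} \<subseteq> {0..T}" if "j < m" for j
    using partition_mono[where n = m and p = p, OF p, of 0 j] partition_mono[where n = m and p = p, OF p, of "Suc j" m] assms(1,2) that by auto
  have *: "has_bochner_integral (lebT T) (indicator {p j<..p (Suc j)} :: real \<Rightarrow> real) (p (Suc j) - p j)"
    if j: "j < m" for j
  proof -
    interpret finite_measure "lebT T" by (rule finite_measure_lebT)
    have b: "has_bochner_integral (lebT T) (indicator {p j<..p (Suc j)} :: real \<Rightarrow> real)
        (measure (lebT T) {p j<..p (Suc j)})"
      by (intro has_bochner_integral_real_indicator) (auto simp: emeasure_eq_measure)
    have "measure (lebT T) {p j<..p (Suc j)} = p (Suc j) - p j"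
      using sub[OF j] p[OF j] by (simp add: measure_def emeasure_lebT Int_absorb1)
    with b show ?thesis by simp
  qed
  have "has_bochner_integral (lebT T) (\<lambda>s. \<Sum>j<m. c j * indicator {p j<..p (Suc j)} s)
      (\<Sum>j<m. c j * (p (Suc j) - p j))"
    by (intro has_bochner_integral_sum has_bochner_integral_mult_right *) auto
  then have "has_bochner_integral (lebT T) (step_fun m p c) (\<Sum>j<m. c j * (p (Suc j) - p j))"
    unfolding step_fun_def[abs_def] .
  then show "integrable (lebT T) (step_fun m p c)"
    "(\<integral>s. step_fun m p c s \<partial>lebT T) = (\<Sum>j<m. c j * (p (Suc j) - p j))"
    by (auto simp: has_bochner_integral_iff)
qed

lemma step_fun_sq_integrable:
  assumes "partition_in T n ts"
  shows "integrable (lebT T) (\<lambda>s. (step_fun n ts cs s)\<^sup>2)"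
proof -
  have "(\<lambda>s. (step_fun n ts cs s)\<^sup>2) = step_fun n ts (\<lambda>j. cs j * cs j)"
    unfolding power2_eq_square using assms
    by (intro ext step_fun_mult) (auto simp: partition_in_def)
  then show ?thesis
    using step_fun_integral(1)[of ts n T] assms unfolding partition_in_def by metis
qed

section \<open>Density of step functions in L2 of [0,T]\<close>

text \<open>A non-integrable function has Bochner integral 0, so this is informative only for f
  square integrable on [0,T], which is how it is used.\<close>

definition step_approximable :: "real \<Rightarrow> (real \<Rightarrow> real) \<Rightarrow> bool" where
  "step_approximable T f \<longleftrightarrow> (\<forall>e>0. \<exists>n ts cs. partition_in T n ts \<and>
     (\<integral>s. (f s - step_fun n ts cs s)\<^sup>2 \<partial>lebT T) < e)"

lemma step_approximable_closure:
  assumes [measurable]: "f \<in> borel_measurable borel"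
    and f: "integrable (lebT T) (\<lambda>s. (f s)\<^sup>2)"
    and g: "\<And>k::nat. g k \<in> borel_measurable borel" "\<And>k. integrable (lebT T) (\<lambda>s. (g k s)\<^sup>2)"
      "\<And>k. step_approximable T (g k)"
    and lim: "(\<lambda>k. \<integral>s. (f s - g k s)\<^sup>2 \<partial>lebT T) \<longlonglongrightarrow> 0"
  shows "step_approximable T f"
  unfolding step_approximable_def
proof (intro allI impI)
  fix e :: real assume e: "e > 0"
  \<comment> \<open>A quarter, because squaring the sum of two errors costs a factor 2 on each of
    them.\<close>
  then obtain k where k: "(\<integral>s. (f s - g k s)\<^sup>2 \<partial>lebT T) < e / 4"
    using eventually_happens'[OF sequentially_bot order_tendstoD(2)[OF lim, of "e/4"]] by auto
  obtain n ts cs where p: "partition_in T n ts"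
    and s: "(\<integral>s. (g k s - step_fun n ts cs s)\<^sup>2 \<partial>lebT T) < e / 4"
    using g(3)[of k, unfolded step_approximable_def, rule_format, of "e/4"] e by auto
  note [measurable] = g(1)
  have i1: "integrable (lebT T) (\<lambda>s. (f s - g k s)\<^sup>2)"
    by (rule integrable_sq_diff) (use f g in simp_all)
  have i2: "integrable (lebT T) (\<lambda>s. (g k s - step_fun n ts cs s)\<^sup>2)"
    by (rule integrable_sq_diff) (use g step_fun_sq_integrable[OF p] in simp_all)
  have i3: "integrable (lebT T) (\<lambda>s. (f s - step_fun n ts cs s)\<^sup>2)"
    by (rule integrable_sq_diff) (use f step_fun_sq_integrable[OF p] in simp_all)
  have "(\<integral>s. (f s - step_fun n ts cs s)\<^sup>2 \<partial>lebT T)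
      \<le> (\<integral>s. 2 * (f s - g k s)\<^sup>2 + 2 * (g k s - step_fun n ts cs s)\<^sup>2 \<partial>lebT T)"
  proof (rule integral_mono)
    fix s
    have "(x + y)\<^sup>2 \<le> 2 * x\<^sup>2 + 2 * y\<^sup>2" for x y :: real
      using sum_squares_bound[of x y] by (simp add: power2_sum)
    from this[of "f s - g k s" "g k s - step_fun n ts cs s"]
    show "(f s - step_fun n ts cs s)\<^sup>2 \<le> 2 * (f s - g k s)\<^sup>2 + 2 * (g k s - step_fun n ts cs s)\<^sup>2"
      by (simp only: diff_add_cancel add_diff_eq)
  qed (use i1 i2 i3 in simp_all)
  also have "\<dots> = 2 * (\<integral>s. (f s - g k s)\<^sup>2 \<partial>lebT T) + 2 * (\<integral>s. (g k s - step_fun n ts cs s)\<^sup>2 \<partial>lebT T)"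
    using i1 i2 by simp
  also have "\<dots> < e" using k s by simp
  finally show "\<exists>n ts cs. partition_in T n ts \<and> (\<integral>s. (f s - step_fun n ts cs s)\<^sup>2 \<partial>lebT T) < e"
    using p by blast
qed

lemma continuous_step_approximable:
  fixes g :: "real \<Rightarrow> real"
  assumes T: "T > 0" and g: "continuous_on UNIV g"
  shows "step_approximable T g"
  unfolding step_approximable_def
proof (intro allI impI)
  fix e :: real assume e: "e > 0"
  \<comment> \<open>Chosen so that a uniform error r, squared and integrated over [0,T], gives
    e/2.\<close>
  define r where "r = sqrt (e / (2 * T))"
  have r: "r > 0" "r\<^sup>2 * T = e / 2" using e T by (simp_all add: r_def)
  have "uniformly_continuous_on {0..T} g"
    by (rule compact_uniformly_continuous) (auto intro: continuous_on_subset[OF g])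
  then obtain d where d: "d > 0" and
    close: "\<And>x y. x \<in> {0..T} \<Longrightarrow> y \<in> {0..T} \<Longrightarrow> \<bar>x - y\<bar> < d \<Longrightarrow> \<bar>g x - g y\<bar> < r"
    using r(1) unfolding uniformly_continuous_on_def dist_real_def by metis
  obtain n :: nat where n: "T / d < n" using reals_Archimedean2 by blast
  have n0: "real n > 0" using n T d by (meson divide_pos_pos less_trans)
  define ts where "ts i = real i * T / n" for i
  define cs where "cs i = g (ts (Suc i))" for i
  have mono: "ts i \<le> ts (Suc i)" for i using T n0 by (simp add: ts_def divide_right_mono)
  have part: "partition_in T n ts" using n0 mono by (simp add: partition_in_def ts_def)
  have gap: "ts (Suc i) - ts i < d" for i
    using n T d n0 by (simp add: ts_def field_simps)
  have bnd: "(g s - step_fun n ts cs s)\<^sup>2 \<le> r\<^sup>2" if s: "s \<in> {0<..T}" for s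
  proof -
    \<comment> \<open>Cells are open on the left, so the cell of s has the index ceiling of s n / T,
      minus 1. The point 0 lies in no cell and is discarded below as a null set.\<close>
    have "s * n / T > 0" "s * n / T \<le> n" using s T n0 by (auto simp: divide_le_eq)
    then have c: "\<lceil>s * n / T\<rceil> \<ge> 1" "\<lceil>s * n / T\<rceil> \<le> int n" by linarith+
    then obtain i where i: "\<lceil>s * n / T\<rceil> - 1 = int i" using zero_le_imp_eq_int[of "\<lceil>s * n / T\<rceil> - 1"] by auto
    then have iz: "\<lceil>s * n / T\<rceil> = int i + 1" by linarith
    have "i < n" using c(2) iz by linarith
    have "real i < s * n / T" "s * n / T \<le> real i + 1" using iz by linarith+
    then have si: "ts i < s" "s \<le> ts (Suc i)" using T n0 by (simp_all add: ts_def field_simps)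
    have "ts (Suc i) \<le> ts n" by (rule partition_mono[where n = n and p = ts]) (use mono \<open>i < n\<close> in auto)
    then have "ts (Suc i) \<in> {0..T}" using si s n0 by (simp add: ts_def)
    then have "\<bar>g s - g (ts (Suc i))\<bar> < r" using si s gap[of i] by (intro close) auto
    moreover have "step_fun n ts cs s = g (ts (Suc i))"
      using step_fun_eq[where m = n and p = ts, OF mono \<open>i < n\<close> si] by (simp add: cs_def)
    ultimately have "\<bar>g s - step_fun n ts cs s\<bar> \<le> \<bar>r\<bar>" using r by simp
    then show ?thesis by (simp only: abs_le_square_iff)
  qed
  have gm[measurable]: "g \<in> borel_measurable borel"
    using g by (rule borel_measurable_continuous_onI)
  interpret finite_measure "lebT T" by (rule finite_measure_lebT)
  have ae: "AE s in lebT T. (g s - step_fun n ts cs s)\<^sup>2 \<le> r\<^sup>2"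
    unfolding AE_lebT_iff using AE_lborel_singleton[of 0]
    by eventually_elim (use bnd in auto)
  have "(\<integral>s. (g s - step_fun n ts cs s)\<^sup>2 \<partial>lebT T) \<le> (\<integral>s. r\<^sup>2 \<partial>lebT T)"
    by (rule integral_mono_AE) (use ae in \<open>auto intro!: integrable_const_bound[where B = "r\<^sup>2"]\<close>)
  also have "\<dots> = r\<^sup>2 * T" using T by (simp add: measure_def emeasure_lebT)
  also have "\<dots> < e" using r e by simp
  finally show "\<exists>n ts cs. partition_in T n ts \<and> (\<integral>s. (g s - step_fun n ts cs s)\<^sup>2 \<partial>lebT T) < e"
    using part by blast
qed

lemma abs_clip_le: "\<bar>max (- c) (min c x)\<bar> \<le> c" if "0 \<le> c" for c x :: real
  using that by (simp add: max_def min_def abs_le_iff)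

text \<open>A measurable function is a limit, off a negligible set, of continuous functions.
  Clipping these to [-B, B] keeps continuity and the limit and supplies the constant bound that
  dominated convergence needs.\<close>

lemma bounded_step_approximable:
  fixes f :: "real \<Rightarrow> real"
  assumes T: "T > 0" and [measurable]: "f \<in> borel_measurable borel" and B: "\<And>s. \<bar>f s\<bar> \<le> B"
  shows "step_approximable T f"
proof -
  have B0: "0 \<le> B" using B[of 0] by linarith
  have "f \<in> borel_measurable (lebesgue_on UNIV)" by (simp add: lebesgue_on_UNIV_eq measurable_completion)
  then have "f measurable_on UNIV" by (simp add: measurable_on_iff_borel_measurable)
  then obtain N g where N: "negligible N" and gc: "\<And>n. continuous_on UNIV (g n)"
    and lim: "\<And>x. x \<notin> N \<Longrightarrow> (\<lambda>n. g n x) \<longlonglongrightarrow> f x"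
    unfolding measurable_on_def by auto
  define G where "G n x = max (- B) (min B (g n x))" for n x
  have Gc: "continuous_on UNIV (G n)" for n
    unfolding G_def[abs_def] by (intro continuous_intros gc)
  have Gm[measurable]: "G n \<in> borel_measurable borel" for n
    using Gc by (rule borel_measurable_continuous_onI)
  have GB: "\<bar>G n x\<bar> \<le> B" for n x unfolding G_def by (rule abs_clip_le[OF B0])
  interpret finite_measure "lebT T" by (rule finite_measure_lebT)
  have sq: "u\<^sup>2 \<le> B\<^sup>2" if "\<bar>u\<bar> \<le> B" for u :: real
    using that B0 by (metis abs_le_square_iff abs_of_nonneg)
  have "AE x in lebesgue. x \<notin> N"
    using N by (auto simp: negligible_iff_null_sets intro: AE_not_in)
  then have aeN: "AE x in lborel. x \<notin> N"
    by (simp add: AE_completion_iff)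
  have Glim: "(\<lambda>n. G n x) \<longlonglongrightarrow> f x" if "x \<notin> N" for x
  proof -
    have "(\<lambda>n. G n x) \<longlonglongrightarrow> max (- B) (min B (f x))"
      unfolding G_def by (intro tendsto_max tendsto_min tendsto_const lim that)
    moreover have "max (- B) (min B (f x)) = f x" using B[of x] by (simp add: abs_le_iff)
    ultimately show ?thesis by simp
  qed
  show ?thesis
  proof (rule step_approximable_closure[where g = G])
    show "integrable (lebT T) (\<lambda>s. (f s)\<^sup>2)" "\<And>k. integrable (lebT T) (\<lambda>s. (G k s)\<^sup>2)"
      by (rule integrable_const_bound[where B = "B\<^sup>2"]; use B GB sq in simp)+
    show "\<And>k. step_approximable T (G k)" by (rule continuous_step_approximable[OF T Gc])
    have "(\<lambda>k. \<integral>s. (f s - G k s)\<^sup>2 \<partial>lebT T) \<longlonglongrightarrow> (\<integral>s. 0 \<partial>lebT T)"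
    proof (rule integral_dominated_convergence[where w = "\<lambda>_. (2 * B)\<^sup>2"])
      show "AE x in lebT T. (\<lambda>k. (f x - G k x)\<^sup>2) \<longlonglongrightarrow> 0"
        unfolding AE_lebT_iff using aeN
      proof eventually_elim
        case (elim x)
        have "(\<lambda>k. (f x - G k x)\<^sup>2) \<longlonglongrightarrow> (f x - f x)\<^sup>2"
          by (intro tendsto_power tendsto_diff tendsto_const Glim elim)
        then show ?case by simp
      qed
      show "AE x in lebT T. norm ((f x - G k x)\<^sup>2) \<le> (2 * B)\<^sup>2" for k
      proof (rule AE_I2)
        fix x
        have "\<bar>f x - G k x\<bar> \<le> \<bar>2 * B\<bar>" using B[of x] GB[of k x] by (simp add: abs_le_iff)
        from abs_le_square_iff[THEN iffD1, OF this]
        show "norm ((f x - G k x)\<^sup>2) \<le> (2 * B)\<^sup>2" by simp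
      qed
    qed auto
    then show "(\<lambda>k. \<integral>s. (f s - G k s)\<^sup>2 \<partial>lebT T) \<longlonglongrightarrow> 0" by simp
  qed auto
qed

text \<open>Truncation at height k reduces to the bounded case: the error is eventually 0 at every
  point and its square is dominated by that of f.\<close>

lemma L2_step_approximable:
  fixes f :: "real \<Rightarrow> real"
  assumes T: "T > 0" and [measurable]: "f \<in> borel_measurable borel" and f: "integrable (lebT T) (\<lambda>s. (f s)\<^sup>2)"
  shows "step_approximable T f"
proof (rule step_approximable_closure[where g = "\<lambda>k x. max (- real k) (min (real k) (f x))"])
  let ?g = "\<lambda>(k::nat) x. max (- real k) (min (real k) (f x))"
  have le: "\<bar>?g k x\<bar> \<le> \<bar>f x\<bar>" for k x by (simp add: max_def min_def)
  have le2: "\<bar>f x - ?g k x\<bar> \<le> \<bar>f x\<bar>" for k x by (simp add: max_def min_def)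
  show "integrable (lebT T) (\<lambda>s. (?g k s)\<^sup>2)" for k
    by (rule Bochner_Integration.integrable_bound[OF f]) (use abs_le_square_iff[THEN iffD1, OF le] in simp_all)
  show "step_approximable T (?g k)" for k
    by (rule bounded_step_approximable[OF T _ abs_clip_le]) auto
  have "(\<lambda>k. \<integral>s. (f s - ?g k s)\<^sup>2 \<partial>lebT T) \<longlonglongrightarrow> (\<integral>s. 0 \<partial>lebT T)"
  proof (rule integral_dominated_convergence[where w = "\<lambda>s. (f s)\<^sup>2"])
    show "AE x in lebT T. (\<lambda>k. (f x - ?g k x)\<^sup>2) \<longlonglongrightarrow> 0"
    proof (rule AE_I2)
      fix x
      obtain K :: nat where K: "\<bar>f x\<bar> \<le> K" using real_arch_simple by blast
      have "\<forall>\<^sub>F k in sequentially. (f x - ?g k x)\<^sup>2 = 0"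
        using eventually_ge_at_top[of K]
      proof eventually_elim
        case (elim k)
        then have "real K \<le> real k" by simp
        then show ?case using K by (simp add: max_def min_def abs_le_iff)
      qed
      then show "(\<lambda>k. (f x - ?g k x)\<^sup>2) \<longlonglongrightarrow> 0" by (rule tendsto_eventually)
    qed
    show "AE x in lebT T. norm ((f x - ?g k x)\<^sup>2) \<le> (f x)\<^sup>2" for k
      using abs_le_square_iff[THEN iffD1, OF le2[of _ k]] by simp
  qed (use f in auto)
  then show "(\<lambda>k. \<integral>s. (f s - ?g k s)\<^sup>2 \<partial>lebT T) \<longlonglongrightarrow> 0" by simp
qed (use f in auto)

section \<open>Wiener integrals\<close>

lemma expectation_iexp_normal:
  assumes "prob_space M" and D: "distributed M lborel X (\<lambda>x. ennreal (normal_density \<mu> \<sigma> x))" and s: "\<sigma> > 0"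
  shows "(CLINT \<omega>|M. iexp (u * X \<omega>)) = iexp (u * \<mu>) * exp (- (u * \<sigma>)\<^sup>2 / 2)"
proof -
  interpret prob_space M by fact
  have [measurable]: "X \<in> borel_measurable M" using D by (simp add: distributed_def)
  let ?Y = "\<lambda>\<omega>. (X \<omega> - \<mu>) / \<sigma>"
  have "distributed M lborel ?Y std_normal_density"
    using D normal_standard_normal_convert[OF s, of X \<mu>] by simp
  then have "distr M lborel ?Y = std_normal_distribution" by (simp add: distributed_def)
  then have "char (distr M lborel ?Y) (u * \<sigma>) = exp (- (u * \<sigma>)\<^sup>2 / 2)"
    by (simp add: char_std_normal_distribution exp_of_real[symmetric] del: exp_of_real)
  then have Y: "(CLINT \<omega>|M. iexp ((u * \<sigma>) * ?Y \<omega>)) = exp (- (u * \<sigma>)\<^sup>2 / 2)"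
    unfolding char_def by (subst (asm) integral_distr) auto
  have "(CLINT \<omega>|M. iexp (u * X \<omega>)) = (CLINT \<omega>|M. iexp (u * \<mu>) * iexp ((u * \<sigma>) * ?Y \<omega>))"
  proof (rule Bochner_Integration.integral_cong[OF refl])
    fix \<omega>
    have "u * X \<omega> = u * \<mu> + (u * \<sigma>) * ?Y \<omega>" using s by (simp add: field_simps)
    then show "iexp (u * X \<omega>) = iexp (u * \<mu>) * iexp ((u * \<sigma>) * ?Y \<omega>)"
      by (simp only: of_real_add distrib_left exp_add)
  qed
  also have "\<dots> = iexp (u * \<mu>) * exp (- (u * \<sigma>)\<^sup>2 / 2)"
    using Y by simp
  finally show ?thesis .
qed

text \<open>Completing the square in the real part of the exponent leaves the characteristic
  function of a shifted normal law.\<close>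
lemma has_bochner_integral_exp_normal:
  fixes z :: complex
  assumes "prob_space M" and D: "distributed M lborel X (\<lambda>x. ennreal (normal_density 0 \<sigma> x))" and s: "\<sigma> > 0"
  shows "has_bochner_integral M (\<lambda>\<omega>. exp (z * complex_of_real (X \<omega>))) (exp (z\<^sup>2 * complex_of_real (\<sigma>\<^sup>2) / 2))"
proof -
  interpret prob_space M by fact
  have [measurable]: "X \<in> borel_measurable M" using D by (simp add: distributed_def)
  define c u where "c = Re z" and "u = Im z"
  have z: "z = complex_of_real c + \<i> * complex_of_real u" by (simp add: c_def u_def complex_eq)
  define \<mu> where "\<mu> = c * \<sigma>\<^sup>2"
  let ?N = "density lborel (\<lambda>x. ennreal (normal_density \<mu> \<sigma> x))"
  interpret N: prob_space ?N using s by (rule prob_space_normal_density)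
  have dN: "distributed ?N lborel (\<lambda>x. x) (\<lambda>x. ennreal (normal_density \<mu> \<sigma> x))"
    by (auto simp: distributed_def distr_id2 intro!: measurable_ident_sets)
  have sq: "normal_density 0 \<sigma> x * exp (c * x) = exp (c\<^sup>2 * \<sigma>\<^sup>2 / 2) * normal_density \<mu> \<sigma> x" for x
  proof -
    have "- (x - 0)\<^sup>2 / (2 * \<sigma>\<^sup>2) + c * x = c\<^sup>2 * \<sigma>\<^sup>2 / 2 + - (x - \<mu>)\<^sup>2 / (2 * \<sigma>\<^sup>2)"
      using s unfolding \<mu>_def by (simp add: field_simps power2_eq_square)
    then show ?thesis
      unfolding normal_density_def by (simp flip: exp_add)
  qed
  have eq: "normal_density 0 \<sigma> x *\<^sub>R exp (z * complex_of_real x)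
      = exp (c\<^sup>2 * \<sigma>\<^sup>2 / 2) *\<^sub>R (normal_density \<mu> \<sigma> x *\<^sub>R iexp (u * x))" for x
  proof -
    have "exp (z * complex_of_real x) = complex_of_real (exp (c * x)) * iexp (u * x)"
      unfolding z by (simp add: distrib_right exp_add exp_of_real mult.assoc flip: of_real_mult)
    then have "normal_density 0 \<sigma> x *\<^sub>R exp (z * complex_of_real x)
        = complex_of_real (normal_density 0 \<sigma> x * exp (c * x)) * iexp (u * x)"
      by (simp add: scaleR_conv_of_real mult.assoc)
    also have "\<dots> = complex_of_real (exp (c\<^sup>2 * \<sigma>\<^sup>2 / 2) * normal_density \<mu> \<sigma> x) * iexp (u * x)"
      by (simp only: sq)
    finally show ?thesis by (simp add: scaleR_conv_of_real mult.assoc)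
  qed
  have i: "integrable lborel (\<lambda>x. normal_density \<mu> \<sigma> x *\<^sub>R iexp (u * x))"
  proof -
    have "complex_integrable ?N (\<lambda>x. iexp (u * x))"
      by (rule N.integrable_iexp) auto
    then show ?thesis by (subst (asm) integrable_density) auto
  qed
  have I: "(CLBINT x. normal_density \<mu> \<sigma> x *\<^sub>R iexp (u * x)) = iexp (u * \<mu>) * exp (- (u * \<sigma>)\<^sup>2 / 2)"
    using expectation_iexp_normal[OF N.prob_space_axioms dN s, of u]
    by (subst (asm) integral_density) auto
  have dX: "distr M lborel X = density lborel (\<lambda>x. ennreal (normal_density 0 \<sigma> x))"
    using D by (simp add: distributed_def)
  have "has_bochner_integral lborel (\<lambda>x. normal_density 0 \<sigma> x *\<^sub>R exp (z * complex_of_real x))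
      (exp (c\<^sup>2 * \<sigma>\<^sup>2 / 2) *\<^sub>R (iexp (u * \<mu>) * exp (- (u * \<sigma>)\<^sup>2 / 2)))"
    unfolding eq using i I by (intro has_bochner_integral_scaleR_right) (auto simp: has_bochner_integral_iff)
  then have "has_bochner_integral (density lborel (\<lambda>x. ennreal (normal_density 0 \<sigma> x))) (\<lambda>x. exp (z * complex_of_real x))
      (exp (c\<^sup>2 * \<sigma>\<^sup>2 / 2) *\<^sub>R (iexp (u * \<mu>) * exp (- (u * \<sigma>)\<^sup>2 / 2)))"
    by (intro has_bochner_integral_density) auto
  then have "has_bochner_integral M (\<lambda>\<omega>. exp (z * complex_of_real (X \<omega>)))
      (exp (c\<^sup>2 * \<sigma>\<^sup>2 / 2) *\<^sub>R (iexp (u * \<mu>) * exp (- (u * \<sigma>)\<^sup>2 / 2)))"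
    unfolding dX[symmetric] has_bochner_integral_iff by (simp add: integrable_distr_eq integral_distr)
  moreover have "exp (c\<^sup>2 * \<sigma>\<^sup>2 / 2) *\<^sub>R (iexp (u * \<mu>) * exp (- (u * \<sigma>)\<^sup>2 / 2))
      = exp (z\<^sup>2 * complex_of_real (\<sigma>\<^sup>2) / 2)"
  proof -
    have "z\<^sup>2 * complex_of_real (\<sigma>\<^sup>2) / 2 = complex_of_real (c\<^sup>2 * \<sigma>\<^sup>2 / 2) + (\<i> * complex_of_real (u * \<mu>) + complex_of_real (- (u * \<sigma>)\<^sup>2 / 2))"
      unfolding z \<mu>_def by (simp add: field_simps power2_eq_square)
    from arg_cong[OF this, of exp] show ?thesis
      by (simp only: exp_add scaleR_conv_of_real exp_of_real)
  qed
  ultimately show ?thesis by simp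
qed

lemma wiener_process_prob_space: "wiener_process M W \<Longrightarrow> prob_space M"
  by (simp add: wiener_process_def)

lemma wiener_process_measurable: "wiener_process M W \<Longrightarrow> W t \<in> borel_measurable M"
  by (simp add: wiener_process_def)

lemma wiener_process_increment:
  assumes "wiener_process M W" "0 \<le> s" "s < t"
  shows "distributed M lborel (\<lambda>\<omega>. W t \<omega> - W s \<omega>) (\<lambda>x. ennreal (normal_density 0 (sqrt (t - s)) x))"
  using assms by (simp add: wiener_process_def)

lemma wiener_process_indep:
  assumes "wiener_process M W" "0 \<le> p 0" "\<And>j. j < (m::nat) \<Longrightarrow> p j < p (Suc j)"
  shows "prob_space.indep_vars M (\<lambda>_. borel) (\<lambda>j \<omega>. W (p (Suc j)) \<omega> - W (p j) \<omega>) {..<m}"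
  using assms by (simp add: wiener_process_def less_imp_le)

lemma borel_measurable_step_int:
  assumes "wiener_process M W"
  shows "step_int W n ts cs \<in> borel_measurable M"
  unfolding step_int_def[abs_def] using wiener_process_measurable[OF assms] by measurable

lemma partition_nonneg:
  assumes "0 \<le> p 0" "\<And>j. j < (m::nat) \<Longrightarrow> p j < (p (Suc j) :: real)" "j \<le> m"
  shows "0 \<le> p j"
  using partition_mono[where p = p and n = m and i = 0 and j = j] assms by (auto simp: less_imp_le)

text \<open>Independence factorises the expectation. Complex coefficients let one formula cover the
  imaginary part of the exponent, which tests the law, and the real part, which is the tilt.\<close>

lemma has_bochner_integral_exp_increments:
  fixes z :: "nat \<Rightarrow> complex"
  assumes W: "wiener_process M W" and p: "0 \<le> p 0" "\<And>j. j < m \<Longrightarrow> p j < p (Suc j)"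
  shows "has_bochner_integral M (\<lambda>\<omega>. exp (\<Sum>j<m. z j * complex_of_real (W (p (Suc j)) \<omega> - W (p j) \<omega>)))
    (exp ((\<Sum>j<m. (z j)\<^sup>2 * complex_of_real (p (Suc j) - p j)) / 2))"
proof -
  interpret prob_space M using W by (rule wiener_process_prob_space)
  let ?D = "\<lambda>j \<omega>. W (p (Suc j)) \<omega> - W (p j) \<omega>"
  have ind: "indep_vars (\<lambda>_. borel) (\<lambda>j \<omega>. exp (z j * complex_of_real (?D j \<omega>))) {..<m}"
    by (rule indep_vars_compose2[OF wiener_process_indep[OF W p]]) auto
  have b: "has_bochner_integral M (\<lambda>\<omega>. exp (z j * complex_of_real (?D j \<omega>)))
      (exp ((z j)\<^sup>2 * complex_of_real (p (Suc j) - p j) / 2))" if j: "j < m" for j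
  proof -
    have "0 \<le> p j" using partition_nonneg[where p = p and m = m and j = j] p j by auto
    from has_bochner_integral_exp_normal[OF prob_space_axioms wiener_process_increment[OF W this p(2)[OF j]], of "z j"]
    show ?thesis using p(2)[OF j] by simp
  qed
  have "(\<integral>\<omega>. (\<Prod>j<m. exp (z j * complex_of_real (?D j \<omega>))) \<partial>M)
      = (\<Prod>j<m. exp ((z j)\<^sup>2 * complex_of_real (p (Suc j) - p j) / 2))"
    using b by (subst indep_vars_lebesgue_integral[OF _ ind]) (auto simp: has_bochner_integral_iff)
  moreover have "integrable M (\<lambda>\<omega>. (\<Prod>j<m. exp (z j * complex_of_real (?D j \<omega>))))"
    using b by (intro indep_vars_integrable[OF _ ind]) (auto simp: has_bochner_integral_iff)
  ultimately show ?thesis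
    by (simp add: has_bochner_integral_iff exp_sum sum_divide_distrib)
qed

section \<open>The isometry and existence of Wiener integrals\<close>

text \<open>Distinct increments are independent and centred, so in the expanded square only the
  diagonal terms survive, and these are the cell lengths.\<close>

lemma step_int_isometry:
  assumes W: "wiener_process M W" and p: "0 \<le> p 0" "p m \<le> T" "\<And>j. j < m \<Longrightarrow> p j < p (Suc j)"
  shows "integrable M (\<lambda>\<omega>. (step_int W m p c \<omega>)\<^sup>2)"
    and "(\<integral>\<omega>. (step_int W m p c \<omega>)\<^sup>2 \<partial>M) = (\<integral>s. (step_fun m p c s)\<^sup>2 \<partial>lebT T)"
proof -
  interpret prob_space M using W by (rule wiener_process_prob_space)
  let ?D = "\<lambda>j \<omega>. W (p (Suc j)) \<omega> - W (p j) \<omega>"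
  have D: "distributed M lborel (?D j) (\<lambda>x. ennreal (normal_density 0 (sqrt (p (Suc j) - p j)) x))"
    and pos: "sqrt (p (Suc j) - p j) > 0" if j: "j < m" for j
    using wiener_process_increment[OF W _ p(3)[OF j]] p(3)[OF j] partition_nonneg[where p = p and m = m and j = j] p j
    by auto
  have i1: "integrable M (?D j)" and e1: "expectation (?D j) = 0" if j: "j < m" for j
    using integrable_normal_moment_nz_1[OF pos[OF j], of 0]
    by (intro distributed_integrable_var[OF D[OF j]]; simp) (rule normal_distributed_expectation[OF pos D]; fact)
  have i2: "integrable M (\<lambda>\<omega>. (?D j \<omega>)\<^sup>2)" if j: "j < m" for j
    using distributed_integrable[OF D[OF j], of "\<lambda>x. x\<^sup>2"] integrable_normal_moment[OF pos[OF j], of 0 2] by simp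
  have e2: "expectation (\<lambda>\<omega>. (?D j \<omega>)\<^sup>2) = p (Suc j) - p j" if j: "j < m" for j
    using normal_distributed_variance[OF pos[OF j] D[OF j]] e1[OF j] p(3)[OF j] by simp
  have cross: "integrable M (\<lambda>\<omega>. ?D i \<omega> * ?D j \<omega>)
      \<and> expectation (\<lambda>\<omega>. ?D i \<omega> * ?D j \<omega>) = (if i = j then p (Suc j) - p j else 0)"
    if ij: "i < m" "j < m" for i j
  proof (cases "i = j")
    case True
    then show ?thesis using i2[OF ij(2)] e2[OF ij(2)] by (simp add: power2_eq_square)
  next
    case False
    have ind: "indep_vars (\<lambda>_. borel) ?D {i, j}"
      by (rule indep_vars_subset[OF wiener_process_indep[OF W p(1,3)]]) (use ij in auto)
    have ii: "\<And>k. k \<in> {i, j} \<Longrightarrow> integrable M (?D k)" using i1 ij by auto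
    show ?thesis
      using indep_vars_lebesgue_integral[OF _ ind ii] indep_vars_integrable[OF _ ind ii] False e1 ij by simp
  qed
  have sq: "(step_int W m p c \<omega>)\<^sup>2 = (\<Sum>i<m. \<Sum>j<m. (c i * c j) * (?D i \<omega> * ?D j \<omega>))" for \<omega>
    by (simp add: step_int_def power2_eq_square sum_product mult_ac)
  show "integrable M (\<lambda>\<omega>. (step_int W m p c \<omega>)\<^sup>2)"
    unfolding sq using cross by (intro Bochner_Integration.integrable_sum integrable_mult_right) auto
  have "(\<integral>\<omega>. (step_int W m p c \<omega>)\<^sup>2 \<partial>M) = (\<Sum>i<m. \<Sum>j<m. (c i * c j) * (if i = j then p (Suc j) - p j else 0))"
    unfolding sq using cross
    by (subst Bochner_Integration.integral_sum) (auto simp: Bochner_Integration.integral_sum intro!: sum.cong)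
  also have "\<dots> = (\<Sum>i<m. (c i * c i) * (p (Suc i) - p i))"
    by (intro sum.cong refl) (simp add: if_distrib[of "\<lambda>x. _ * x"] cong: if_cong)
  also have "\<dots> = (\<integral>s. (step_fun m p c s)\<^sup>2 \<partial>lebT T)"
    using step_fun_integral(2)[where p = p and m = m and T = T and c = "\<lambda>j. c j * c j"] p
      step_fun_mult[where p = p and m = m and a = c and b = c]
    by (simp add: power2_eq_square less_imp_le)
  finally show "(\<integral>\<omega>. (step_int W m p c \<omega>)\<^sup>2 \<partial>M) = (\<integral>s. (step_fun m p c s)\<^sup>2 \<partial>lebT T)" .
qed

text \<open>On a common refinement a difference of step integrals is a single step integral. This
  carries the Cauchy property from functions to random variables.\<close>

lemma step_int_diff_isometry:
  assumes W: "wiener_process M W" and p: "partition_in T n ts" "partition_in T n' ts'"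
  shows "integrable M (\<lambda>\<omega>. (step_int W n ts cs \<omega>)\<^sup>2)"
    and "(\<integral>\<omega>. (step_int W n ts cs \<omega> - step_int W n' ts' cs' \<omega>)\<^sup>2 \<partial>M)
      = (\<integral>s. (step_fun n ts cs s - step_fun n' ts' cs' s)\<^sup>2 \<partial>lebT T)"
proof -
  obtain m p a b where r: "0 \<le> p 0" "p m \<le> T" "\<And>j. j < m \<Longrightarrow> p j < p (Suc j)"
    "step_fun n ts cs = step_fun m p a" "step_fun n' ts' cs' = step_fun m p b"
    "step_int W n ts cs = step_int W m p a" "step_int W n' ts' cs' = step_int W m p b"
    using common_refinement[OF p, of cs cs'] by metis
  have d: "step_int W m p a \<omega> - step_int W m p b \<omega> = step_int W m p (\<lambda>j. a j - b j) \<omega>" for \<omega>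
    by (simp add: step_int_def sum_subtractf left_diff_distrib)
  show "integrable M (\<lambda>\<omega>. (step_int W n ts cs \<omega>)\<^sup>2)"
    unfolding r(6) by (rule step_int_isometry(1)[OF W r(1-3)])
  show "(\<integral>\<omega>. (step_int W n ts cs \<omega> - step_int W n' ts' cs' \<omega>)\<^sup>2 \<partial>M)
      = (\<integral>s. (step_fun n ts cs s - step_fun n' ts' cs' s)\<^sup>2 \<partial>lebT T)"
    unfolding r(4-7) d step_fun_diff[symmetric] by (rule step_int_isometry(2)[OF W r(1-3)])
qed

text \<open>Without existence nothing would be known about the \<open>SOME\<close> in
  \<open>wiener_integral\<close>. Step functions at squared distance below 1/(k+1) from f have, by
  the isometry, an L2 Cauchy sequence of integrals; the limit is a version.\<close>

lemma is_wiener_integral_exists: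
  assumes W: "wiener_process M W" and T: "T > 0" and fm: "f \<in> borel_measurable borel"
    and f: "integrable (lebT T) (\<lambda>s. (f s)\<^sup>2)"
  shows "\<exists>Y. is_wiener_integral M W T f Y"
proof -
  interpret prob_space M using W by (rule wiener_process_prob_space)
  note [measurable] = fm
  define err where "err n ts cs = (\<integral>s. (f s - step_fun n ts cs s)\<^sup>2 \<partial>lebT T)" for n ts cs
  have "\<exists>n ts cs. partition_in T n ts \<and> err n ts cs < inverse (real (Suc k))" for k
    using L2_step_approximable[OF T fm f] unfolding step_approximable_def err_def by simp
  then obtain n ts cs where p: "\<And>k. partition_in T (n k) (ts k)"
    and e: "\<And>k. err (n k) (ts k) (cs k) < inverse (real (Suc k))"
    by metis
  let ?s = "\<lambda>k. step_fun (n k) (ts k) (cs k)"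
  let ?Y = "\<lambda>k. step_int W (n k) (ts k) (cs k)"
  have Ym: "?Y k \<in> borel_measurable M" for k by (rule borel_measurable_step_int[OF W])
  have Yi: "integrable M (\<lambda>\<omega>. (?Y k \<omega>)\<^sup>2)" for k by (rule step_int_diff_isometry(1)[OF W p p])
  have idf: "integrable (lebT T) (\<lambda>s. (f s - ?s k s)\<^sup>2)" for k
    by (rule integrable_sq_diff) (use f step_fun_sq_integrable[OF p] in auto)
  have iss: "integrable (lebT T) (\<lambda>s. (?s i s - ?s j s)\<^sup>2)" for i j
    by (rule integrable_sq_diff) (use step_fun_sq_integrable[OF p] in auto)
  have bnd: "(\<integral>\<omega>. (?Y i \<omega> - ?Y j \<omega>)\<^sup>2 \<partial>M) \<le> 2 * inverse (real (Suc i)) + 2 * inverse (real (Suc j))" for i j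
  proof -
    have sq: "(x - y)\<^sup>2 \<le> 2 * (z - x)\<^sup>2 + 2 * (z - y)\<^sup>2" for x y z :: real
    proof -
      have "0 \<le> ((z - x) + (z - y))\<^sup>2" by simp
      then show ?thesis by (simp add: power2_eq_square algebra_simps)
    qed
    have "(\<integral>\<omega>. (?Y i \<omega> - ?Y j \<omega>)\<^sup>2 \<partial>M) = (\<integral>s. (?s i s - ?s j s)\<^sup>2 \<partial>lebT T)"
      by (rule step_int_diff_isometry(2)[OF W p p])
    also have "\<dots> \<le> (\<integral>s. 2 * (f s - ?s i s)\<^sup>2 + 2 * (f s - ?s j s)\<^sup>2 \<partial>lebT T)"
      by (rule integral_mono) (use idf iss sq in auto)
    also have "\<dots> = 2 * err (n i) (ts i) (cs i) + 2 * err (n j) (ts j) (cs j)"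
      using idf by (simp add: err_def)
    also have "\<dots> \<le> 2 * inverse (real (Suc i)) + 2 * inverse (real (Suc j))"
      using e[of i] e[of j] by linarith
    finally show ?thesis .
  qed
  have C: "\<exists>N. \<forall>i\<ge>N. \<forall>j\<ge>N. (\<integral>\<omega>. (?Y i \<omega> - ?Y j \<omega>)\<^sup>2 \<partial>M) < e" if e: "e > 0" for e
  proof -
    obtain N where N: "inverse (real (Suc N)) < e / 4" using reals_Archimedean[of "e/4"] e by auto
    have "(\<integral>\<omega>. (?Y i \<omega> - ?Y j \<omega>)\<^sup>2 \<partial>M) < e" if "i \<ge> N" "j \<ge> N" for i j
    proof -
      have "inverse (real (Suc i)) \<le> inverse (real (Suc N))" "inverse (real (Suc j)) \<le> inverse (real (Suc N))"
        using that by (auto intro!: le_imp_inverse_le)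
      then show ?thesis using bnd[of i j] N by linarith
    qed
    then show ?thesis by blast
  qed
  obtain Z where Z: "Z \<in> borel_measurable M" "integrable M (\<lambda>\<omega>. (Z \<omega>)\<^sup>2)"
    "(\<lambda>k. \<integral>\<omega>. (Z \<omega> - ?Y k \<omega>)\<^sup>2 \<partial>M) \<longlonglongrightarrow> 0"
    using L2_complete[OF Ym Yi C] by blast
  have "(\<lambda>k. err (n k) (ts k) (cs k)) \<longlonglongrightarrow> 0"
  proof (rule tendsto_sandwich[OF _ _ tendsto_const LIMSEQ_inverse_real_of_nat])
    show "\<forall>\<^sub>F k in sequentially. 0 \<le> err (n k) (ts k) (cs k)" by (simp add: err_def)
    show "\<forall>\<^sub>F k in sequentially. err (n k) (ts k) (cs k) \<le> inverse (real (Suc k))"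
      using e by (simp add: less_imp_le)
  qed
  then have "(\<lambda>k. LINT s:{0..T}|lborel. (f s - ?s k s)\<^sup>2) \<longlonglongrightarrow> 0"
    unfolding err_def by (subst set_integral_eq_lebT) auto
  moreover have "set_integrable lborel {0..T} (\<lambda>s. (f s)\<^sup>2)"
    using f by (subst set_integrable_iff_lebT) auto
  ultimately have "is_wiener_integral M W T f Z"
    unfolding is_wiener_integral_def using p Z fm unfolding partition_in_def by auto
  then show ?thesis by blast
qed

lemma is_wiener_integral_wiener_integral:
  assumes "wiener_process M W" "T > 0" "f \<in> borel_measurable borel" "integrable (lebT T) (\<lambda>s. (f s)\<^sup>2)"
  shows "is_wiener_integral M W T f (wiener_integral M W T f)"
  unfolding wiener_integral_def using is_wiener_integral_exists[OF assms] by (rule someI_ex)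

lemma is_wiener_integralE:
  assumes "is_wiener_integral M W T f Y"
  obtains n ts cs where "\<And>k. partition_in T (n k) (ts k)"
    "(\<lambda>k. \<integral>s. (f s - step_fun (n k) (ts k) (cs k) s)\<^sup>2 \<partial>lebT T) \<longlonglongrightarrow> 0"
    "(\<lambda>k. \<integral>\<omega>. (Y \<omega> - step_int W (n k) (ts k) (cs k) \<omega>)\<^sup>2 \<partial>M) \<longlonglongrightarrow> 0"
    "f \<in> borel_measurable borel" "integrable (lebT T) (\<lambda>s. (f s)\<^sup>2)"
    "Y \<in> borel_measurable M" "integrable M (\<lambda>\<omega>. (Y \<omega>)\<^sup>2)"
proof -
  have f[measurable]: "f \<in> borel_measurable borel" using assms by (simp add: is_wiener_integral_def)
  from assms obtain n ts cs where
    "\<forall>k. 0 \<le> ts k 0 \<and> ts k (n k) \<le> T \<and> (\<forall>i<n k. ts k i \<le> ts k (Suc i))"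
    and l: "(\<lambda>k. LINT s:{0..T}|lborel. (f s - step_fun (n k) (ts k) (cs k) s)\<^sup>2) \<longlonglongrightarrow> 0"
    and 3: "(\<lambda>k. \<integral>\<omega>. (Y \<omega> - step_int W (n k) (ts k) (cs k) \<omega>)\<^sup>2 \<partial>M) \<longlonglongrightarrow> 0"
    unfolding is_wiener_integral_def by blast
  then have "\<And>k. partition_in T (n k) (ts k)" by (simp add: partition_in_def)
  moreover have "(\<lambda>k. \<integral>s. (f s - step_fun (n k) (ts k) (cs k) s)\<^sup>2 \<partial>lebT T) \<longlonglongrightarrow> 0"
    using l by (subst (asm) set_integral_eq_lebT) auto
  moreover have "integrable (lebT T) (\<lambda>s. (f s)\<^sup>2)"
    using assms unfolding is_wiener_integral_def by (subst set_integrable_iff_lebT[symmetric]) auto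
  ultimately show ?thesis using that 3 f assms unfolding is_wiener_integral_def by blast
qed

section \<open>The mixed transform of Wiener integrals\<close>

text \<open>On a common refinement the exponent has coefficients z = i a d + c b. In z^2 the squares
  give the two variances as real part, and the cross term gives the covariance as imaginary part;
  the latter becomes the mean shift under the tilted measure.\<close>

lemma has_bochner_integral_exp_step_int:
  fixes a c :: real
  assumes W: "wiener_process M W" and p: "partition_in T n ts" "partition_in T n' ts'"
  shows "has_bochner_integral M
    (\<lambda>\<omega>. exp (\<i> * complex_of_real (a * step_int W n ts cs \<omega>) + complex_of_real (c * step_int W n' ts' cs' \<omega>)))
    (exp (complex_of_real ((c\<^sup>2 * (\<integral>s. (step_fun n' ts' cs' s)\<^sup>2 \<partial>lebT T)
        - a\<^sup>2 * (\<integral>s. (step_fun n ts cs s)\<^sup>2 \<partial>lebT T)) / 2)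
      + \<i> * complex_of_real (a * c * (\<integral>s. step_fun n ts cs s * step_fun n' ts' cs' s \<partial>lebT T))))"
proof -
  obtain m p d b where r: "0 \<le> p 0" "p m \<le> T" "\<And>j. j < m \<Longrightarrow> p j < p (Suc j)"
    "step_fun n ts cs = step_fun m p d" "step_fun n' ts' cs' = step_fun m p b"
    "step_int W n ts cs = step_int W m p d" "step_int W n' ts' cs' = step_int W m p b"
    using common_refinement[OF p, of cs cs'] by metis
  define z where "z j = \<i> * complex_of_real (a * d j) + complex_of_real (c * b j)" for j
  define \<delta> where "\<delta> j = p (Suc j) - p j" for j
  have I: "(\<integral>s. step_fun m p e s * step_fun m p g s \<partial>lebT T) = (\<Sum>j<m. e j * g j * \<delta> j)" for e g
    unfolding \<delta>_def using step_fun_integral(2)[where p = p and m = m and T = T and c = "\<lambda>j. e j * g j"] r(1-3)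
      step_fun_mult[where p = p and m = m and a = e and b = g]
    by (simp add: less_imp_le)
  have 1: "\<i> * complex_of_real (a * step_int W m p d \<omega>) + complex_of_real (c * step_int W m p b \<omega>)
      = (\<Sum>j<m. z j * complex_of_real (W (p (Suc j)) \<omega> - W (p j) \<omega>))" for \<omega>
    by (simp add: step_int_def z_def sum_distrib_left sum.distrib distrib_right mult.assoc)
  have "(\<Sum>j<m. (z j)\<^sup>2 * complex_of_real (\<delta> j))
      = (\<Sum>j<m. complex_of_real (c\<^sup>2 * (b j * b j * \<delta> j) - a\<^sup>2 * (d j * d j * \<delta> j))
          + 2 * \<i> * complex_of_real (a * c * (d j * b j * \<delta> j)))"
    by (intro sum.cong refl) (simp add: z_def power2_eq_square algebra_simps)
  also have "\<dots> = complex_of_real (c\<^sup>2 * (\<Sum>j<m. b j * b j * \<delta> j) - a\<^sup>2 * (\<Sum>j<m. d j * d j * \<delta> j))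
      + 2 * \<i> * complex_of_real (a * c * (\<Sum>j<m. d j * b j * \<delta> j))"
    by (simp add: sum.distrib sum_subtractf sum_distrib_left)
  finally have 2: "(\<Sum>j<m. (z j)\<^sup>2 * complex_of_real (\<delta> j)) / 2
      = complex_of_real ((c\<^sup>2 * (\<Sum>j<m. b j * b j * \<delta> j) - a\<^sup>2 * (\<Sum>j<m. d j * d j * \<delta> j)) / 2)
      + \<i> * complex_of_real (a * c * (\<Sum>j<m. d j * b j * \<delta> j))"
    by (simp add: add_divide_distrib)
  show ?thesis
    unfolding r(4-7) power2_eq_square[of "step_fun _ _ _ _"] I 1 2[symmetric]
    using has_bochner_integral_exp_increments[OF W r(1,3), where z = z] unfolding \<delta>_def .
qed

lemma has_bochner_integral_exp_step_int2:
  fixes u \<alpha> c :: real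
  assumes W1: "wiener_process M W1" and W2: "wiener_process M W2" and ind: "indep_processes M W1 W2"
    and p: "partition_in T n1 t1" "partition_in T n2 t2" "partition_in T n3 t3"
  shows "has_bochner_integral M
    (\<lambda>\<omega>. exp (\<i> * complex_of_real (u * (\<alpha> * step_int W1 n1 t1 c1 \<omega> + step_int W2 n3 t3 c3 \<omega>))
        + complex_of_real (c * step_int W1 n2 t2 c2 \<omega>)))
    (exp (complex_of_real ((c\<^sup>2 * (\<integral>s. (step_fun n2 t2 c2 s)\<^sup>2 \<partial>lebT T)
        - u\<^sup>2 * (\<alpha>\<^sup>2 * (\<integral>s. (step_fun n1 t1 c1 s)\<^sup>2 \<partial>lebT T)
           + (\<integral>s. (step_fun n3 t3 c3 s)\<^sup>2 \<partial>lebT T))) / 2)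
      + \<i> * complex_of_real (u * \<alpha> * c * (\<integral>s. step_fun n1 t1 c1 s * step_fun n2 t2 c2 s \<partial>lebT T))))"
proof -
  interpret prob_space M using W1 by (rule wiener_process_prob_space)
  let ?P = "PiM UNIV (\<lambda>_::real. borel) :: (real \<Rightarrow> real) measure"
  \<comment> \<open>Step integrals as measurable functionals of the whole path, so that independence
    of the two paths passes to them.\<close>
  define \<Phi> where "\<Phi> n t (e :: nat \<Rightarrow> real) w = (\<Sum>i<n. e i * (w (t (Suc i)) - w (t i)))" for n :: nat and t :: "nat \<Rightarrow> real" and e and w :: "real \<Rightarrow> real"
  have \<Phi>[measurable]: "\<Phi> n t e \<in> borel_measurable ?P" for n t e
    unfolding \<Phi>_def[abs_def] by measurable
  let ?X = "\<lambda>\<omega>. exp (\<i> * complex_of_real (u * \<alpha> * step_int W1 n1 t1 c1 \<omega>) + complex_of_real (c * step_int W1 n2 t2 c2 \<omega>))"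
  \<comment> \<open>The vanishing summand only brings the second factor into the shape of
    \<open>has_bochner_integral_exp_step_int\<close> with c = 0.\<close>
  let ?Y = "\<lambda>\<omega>. exp (\<i> * complex_of_real (u * step_int W2 n3 t3 c3 \<omega>) + complex_of_real (0 * step_int W2 n3 t3 c3 \<omega>))"
  have i: "indep_var borel ((\<lambda>w. exp (\<i> * complex_of_real (u * \<alpha> * \<Phi> n1 t1 c1 w) + complex_of_real (c * \<Phi> n2 t2 c2 w))) \<circ> (\<lambda>\<omega> t. W1 t \<omega>))
      borel ((\<lambda>w. exp (\<i> * complex_of_real (u * \<Phi> n3 t3 c3 w) + complex_of_real (0 * \<Phi> n3 t3 c3 w))) \<circ> (\<lambda>\<omega> t. W2 t \<omega>))"
    by (rule indep_var_compose[OF ind[unfolded indep_processes_def]]) measurable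
  have ind: "indep_var borel ?X borel ?Y"
    using i by (simp add: comp_def \<Phi>_def step_int_def)
  note X = has_bochner_integral_exp_step_int[OF W1 p(1,2), of "u * \<alpha>" c1 c c2]
  note Y = has_bochner_integral_exp_step_int[OF W2 p(3,3), of u c3 0 c3]
  have "has_bochner_integral M (\<lambda>\<omega>. ?X \<omega> * ?Y \<omega>) (integral\<^sup>L M ?X * integral\<^sup>L M ?Y)"
    using indep_var_lebesgue_integral[OF ind] indep_var_integrable[OF ind] X Y
    unfolding has_bochner_integral_iff by blast
  moreover have "?X \<omega> * ?Y \<omega> = exp (\<i> * complex_of_real (u * (\<alpha> * step_int W1 n1 t1 c1 \<omega> + step_int W2 n3 t3 c3 \<omega>))
        + complex_of_real (c * step_int W1 n2 t2 c2 \<omega>))" for \<omega>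
    unfolding exp_add[symmetric] by (rule arg_cong[where f = exp]) (simp add: algebra_simps)
  moreover have "integral\<^sup>L M ?X * integral\<^sup>L M ?Y = exp (complex_of_real ((c\<^sup>2 * (\<integral>s. (step_fun n2 t2 c2 s)\<^sup>2 \<partial>lebT T)
        - u\<^sup>2 * (\<alpha>\<^sup>2 * (\<integral>s. (step_fun n1 t1 c1 s)\<^sup>2 \<partial>lebT T)
           + (\<integral>s. (step_fun n3 t3 c3 s)\<^sup>2 \<partial>lebT T))) / 2)
      + \<i> * complex_of_real (u * \<alpha> * c * (\<integral>s. step_fun n1 t1 c1 s * step_fun n2 t2 c2 s \<partial>lebT T)))"
    unfolding X[unfolded has_bochner_integral_iff, THEN conjunct2] Y[unfolded has_bochner_integral_iff, THEN conjunct2]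
      exp_add[symmetric]
    by (rule arg_cong[where f = exp]) (simp add: algebra_simps power_mult_distrib add_divide_distrib diff_divide_distrib)
  ultimately show ?thesis by simp
qed

lemma norm_iexp_diff_le: "norm (iexp a - iexp b) \<le> \<bar>a - b\<bar>"
proof -
  have "iexp a - iexp b = iexp b * (iexp (a - b) - 1)"
    by (simp add: right_diff_distrib flip: exp_add)
  then have "norm (iexp a - iexp b) = norm (iexp (a - b) - 1)" by (simp add: norm_mult)
  also have "\<dots> \<le> \<bar>a - b\<bar>" using iexp_approx1[of "a - b" 0] by simp
  finally show ?thesis .
qed

text \<open>The tangent inequality 1 + x \<le> exp x, applied at either point. The symmetric factor
  avoids deciding which argument is larger and, once expanded, pairs each error with one
  exponential, ready for Cauchy--Schwarz.\<close>

lemma abs_exp_diff_le: "\<bar>exp a - exp b\<bar> \<le> \<bar>a - b\<bar> * (exp a + exp b)" for a b :: real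
proof -
  have *: "exp x - exp y \<le> \<bar>x - y\<bar> * exp x" for x y :: real
  proof -
    have "exp x * (1 + (y - x)) \<le> exp x * exp (y - x)"
      by (intro mult_left_mono) simp_all
    then have "exp x - exp y \<le> exp x * (x - y)" by (simp add: algebra_simps flip: exp_add)
    also have "\<dots> \<le> exp x * \<bar>x - y\<bar>" by (intro mult_left_mono) simp_all
    finally show ?thesis by (simp add: mult.commute)
  qed
  have "exp a - exp b \<le> \<bar>a - b\<bar> * exp a" "exp b - exp a \<le> \<bar>a - b\<bar> * exp b"
    using *[of a b] *[of b a] by (simp_all add: abs_minus_commute)
  moreover have "0 \<le> \<bar>a - b\<bar> * exp a" "0 \<le> \<bar>a - b\<bar> * exp b" by simp_all
  ultimately show ?thesis unfolding distrib_left by linarith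
qed

text \<open>The difference of the integrands splits into a change of phase times an exponential and
  a change of exponential. Both are an L2 error times an exponential, and Cauchy--Schwarz absorbs
  the latter because its second moments, the moments at 2c, are bounded uniformly. For the limit Z
  this bound comes from Fatou's lemma along an almost everywhere convergent subsequence.\<close>

lemma (in prob_space) tendsto_expectation_exp_L2:
  fixes A Z :: "'a \<Rightarrow> real"
  assumes [measurable]: "A \<in> borel_measurable M" "Z \<in> borel_measurable M"
      "\<And>k. As k \<in> borel_measurable M" "\<And>k. Zs k \<in> borel_measurable M"
    and iA: "\<And>k. integrable M (\<lambda>\<omega>. (A \<omega> - As k \<omega>)\<^sup>2)" and iZ: "\<And>k. integrable M (\<lambda>\<omega>. (Z \<omega> - Zs k \<omega>)\<^sup>2)"
    and lA: "(\<lambda>k. \<integral>\<omega>. (A \<omega> - As k \<omega>)\<^sup>2 \<partial>M) \<longlonglongrightarrow> 0" and lZ: "(\<lambda>k. \<integral>\<omega>. (Z \<omega> - Zs k \<omega>)\<^sup>2 \<partial>M) \<longlonglongrightarrow> 0"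
    and e: "\<And>k. integrable M (\<lambda>\<omega>. exp (2 * c * Zs k \<omega>))" and eB: "\<And>k. (\<integral>\<omega>. exp (2 * c * Zs k \<omega>) \<partial>M) \<le> B"
  shows "integrable M (\<lambda>\<omega>. exp (c * Z \<omega>))"
    and "(\<lambda>k. \<integral>\<omega>. exp (\<i> * complex_of_real (As k \<omega>) + complex_of_real (c * Zs k \<omega>)) \<partial>M)
      \<longlonglongrightarrow> (\<integral>\<omega>. exp (\<i> * complex_of_real (A \<omega>) + complex_of_real (c * Z \<omega>)) \<partial>M)"
proof -
  define a where "a k = (\<integral>\<omega>. (A \<omega> - As k \<omega>)\<^sup>2 \<partial>M)" for k
  define b where "b k = (\<integral>\<omega>. (Z \<omega> - Zs k \<omega>)\<^sup>2 \<partial>M)" for k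
  have iZ1: "integrable M (\<lambda>\<omega>. Z \<omega> - Zs k \<omega>)" for k
    by (rule square_integrable_imp_integrable) (use iZ in auto)
  have "(\<lambda>k. \<integral>\<omega>. norm (Z \<omega> - Zs k \<omega>) \<partial>M) \<longlonglongrightarrow> 0"
  proof (rule tendsto_sandwich[OF _ _ tendsto_const])
    show "\<forall>\<^sub>F k in sequentially. (\<integral>\<omega>. norm (Z \<omega> - Zs k \<omega>) \<partial>M) \<le> sqrt (b k)"
      using integral_abs_le_sqrt[OF _ iZ] by (simp add: b_def prob_space)
    show "(\<lambda>k. sqrt (b k)) \<longlonglongrightarrow> 0" using tendsto_real_sqrt[OF lZ] by (simp add: b_def)
  qed simp
  from tendsto_L1_AE_subseq[OF iZ1 this] obtain r where r: "strict_mono r"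
    and ae: "AE \<omega> in M. (\<lambda>k. Z \<omega> - Zs (r k) \<omega>) \<longlonglongrightarrow> 0" by blast
  have "(\<integral>\<^sup>+\<omega>. ennreal (exp (2 * c * Z \<omega>)) \<partial>M) = (\<integral>\<^sup>+\<omega>. liminf (\<lambda>k. ennreal (exp (2 * c * Zs (r k) \<omega>))) \<partial>M)"
    using ae
  proof (intro nn_integral_cong_AE, eventually_elim)
    fix \<omega> assume elim: "(\<lambda>k. Z \<omega> - Zs (r k) \<omega>) \<longlonglongrightarrow> 0"
    have "(\<lambda>k. Z \<omega> - (Z \<omega> - Zs (r k) \<omega>)) \<longlonglongrightarrow> Z \<omega> - 0"
      by (rule tendsto_diff[OF tendsto_const elim])
    then have "(\<lambda>k. Zs (r k) \<omega>) \<longlonglongrightarrow> Z \<omega>" by simp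
    then have "(\<lambda>k. ennreal (exp (2 * c * Zs (r k) \<omega>))) \<longlonglongrightarrow> ennreal (exp (2 * c * Z \<omega>))"
      by (intro tendsto_ennrealI tendsto_exp tendsto_mult tendsto_const)
    then show "ennreal (exp (2 * c * Z \<omega>)) = liminf (\<lambda>k. ennreal (exp (2 * c * Zs (r k) \<omega>)))" by (intro lim_imp_Liminf[symmetric]) auto
  qed
  also have "\<dots> \<le> liminf (\<lambda>k. \<integral>\<^sup>+\<omega>. ennreal (exp (2 * c * Zs (r k) \<omega>)) \<partial>M)"
    by (rule nn_integral_liminf) simp
  also have "\<dots> \<le> ennreal B"
    by (rule Liminf_le) (auto simp: nn_integral_eq_integral[OF e] intro!: always_eventually ennreal_leI eB)
  finally have fin: "(\<integral>\<^sup>+\<omega>. ennreal (exp (2 * c * Z \<omega>)) \<partial>M) \<le> ennreal B" .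
  have ie: "integrable M (\<lambda>\<omega>. exp (2 * c * Z \<omega>))"
    using fin by (intro integrableI_bounded) (auto intro: le_less_trans)
  have eZ: "(\<integral>\<omega>. exp (2 * c * Z \<omega>) \<partial>M) \<le> B"
  proof -
    have "0 \<le> (\<integral>\<omega>. exp (2 * c * Zs 0 \<omega>) \<partial>M)" by simp
    then have "0 \<le> B" using eB[of 0] by linarith
    then show ?thesis using fin by (simp add: nn_integral_eq_integral[OF ie])
  qed
  have sq: "(exp (c * x))\<^sup>2 = exp (2 * c * x)" for x by (simp add: power2_eq_square flip: exp_add)
  have s: "integrable M (\<lambda>\<omega>. (exp (c * Z \<omega>))\<^sup>2)" "integrable M (\<lambda>\<omega>. (exp (c * Zs k \<omega>))\<^sup>2)" for k
    using ie e by (simp_all add: sq)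
  show i1: "integrable M (\<lambda>\<omega>. exp (c * Z \<omega>))"
    by (rule square_integrable_imp_integrable) (use s in auto)
  have i2: "integrable M (\<lambda>\<omega>. exp (c * Zs k \<omega>))" for k
    by (rule square_integrable_imp_integrable) (use s in auto)
  let ?F = "\<lambda>k \<omega>. exp (\<i> * complex_of_real (As k \<omega>) + complex_of_real (c * Zs k \<omega>))"
  let ?G = "\<lambda>\<omega>. exp (\<i> * complex_of_real (A \<omega>) + complex_of_real (c * Z \<omega>))"
  have iF: "integrable M (?F k)" for k
    by (rule Bochner_Integration.integrable_bound[OF i2[of k]]) auto
  have iG: "integrable M ?G"
    by (rule Bochner_Integration.integrable_bound[OF i1]) auto
  have ptw: "norm (?F k \<omega> - ?G \<omega>) \<le> \<bar>(A \<omega> - As k \<omega>) * exp (c * Z \<omega>)\<bar>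
      + \<bar>c\<bar> * (\<bar>(Z \<omega> - Zs k \<omega>) * exp (c * Zs k \<omega>)\<bar> + \<bar>(Z \<omega> - Zs k \<omega>) * exp (c * Z \<omega>)\<bar>)" for k \<omega>
  proof -
    have "?F k \<omega> - ?G \<omega> = iexp (As k \<omega>) * complex_of_real (exp (c * Zs k \<omega>) - exp (c * Z \<omega>))
        + complex_of_real (exp (c * Z \<omega>)) * (iexp (As k \<omega>) - iexp (A \<omega>))"
      by (simp add: exp_add exp_of_real algebra_simps flip: of_real_mult)
    then have "norm (?F k \<omega> - ?G \<omega>) \<le> norm (iexp (As k \<omega>) * complex_of_real (exp (c * Zs k \<omega>) - exp (c * Z \<omega>)))
        + norm (complex_of_real (exp (c * Z \<omega>)) * (iexp (As k \<omega>) - iexp (A \<omega>)))"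
      using norm_triangle_ineq by metis
    also have "\<dots> = \<bar>exp (c * Zs k \<omega>) - exp (c * Z \<omega>)\<bar> + exp (c * Z \<omega>) * norm (iexp (As k \<omega>) - iexp (A \<omega>))"
      by (simp add: norm_mult del: of_real_diff)
    also have "\<dots> \<le> \<bar>c * Zs k \<omega> - c * Z \<omega>\<bar> * (exp (c * Zs k \<omega>) + exp (c * Z \<omega>)) + exp (c * Z \<omega>) * \<bar>As k \<omega> - A \<omega>\<bar>"
      by (intro add_mono abs_exp_diff_le mult_left_mono norm_iexp_diff_le) simp
    also have "c * Zs k \<omega> - c * Z \<omega> = c * (Zs k \<omega> - Z \<omega>)" by (simp add: right_diff_distrib)
    also have "\<bar>c * (Zs k \<omega> - Z \<omega>)\<bar> * (exp (c * Zs k \<omega>) + exp (c * Z \<omega>)) + exp (c * Z \<omega>) * \<bar>As k \<omega> - A \<omega>\<bar>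
        = \<bar>(A \<omega> - As k \<omega>) * exp (c * Z \<omega>)\<bar>
          + \<bar>c\<bar> * (\<bar>(Z \<omega> - Zs k \<omega>) * exp (c * Zs k \<omega>)\<bar> + \<bar>(Z \<omega> - Zs k \<omega>) * exp (c * Z \<omega>)\<bar>)"
      unfolding abs_mult abs_exp_cancel abs_minus_commute[of "Zs k \<omega>"] abs_minus_commute[of "As k \<omega>"]
      by (simp only: distrib_left mult_ac add_ac)
    finally show ?thesis .
  qed
  have nF: "norm (integral\<^sup>L M (?F k) - integral\<^sup>L M ?G)
      \<le> sqrt (a k) * sqrt B + \<bar>c\<bar> * (sqrt (b k) * sqrt B + sqrt (b k) * sqrt B)" for k
  proof -
    have i: "integrable M (\<lambda>\<omega>. (A \<omega> - As k \<omega>) * exp (c * Z \<omega>))"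
      "integrable M (\<lambda>\<omega>. (Z \<omega> - Zs k \<omega>) * exp (c * Zs k \<omega>))"
      "integrable M (\<lambda>\<omega>. (Z \<omega> - Zs k \<omega>) * exp (c * Z \<omega>))"
      using iA iZ s by (auto intro!: integrable_mult_of_sq)
    have CS: "(\<integral>\<omega>. \<bar>(A \<omega> - As k \<omega>) * exp (c * Z \<omega>)\<bar> \<partial>M) \<le> sqrt (a k) * sqrt (\<integral>\<omega>. (exp (c * Z \<omega>))\<^sup>2 \<partial>M)"
      "(\<integral>\<omega>. \<bar>(Z \<omega> - Zs k \<omega>) * exp (c * Zs k \<omega>)\<bar> \<partial>M) \<le> sqrt (b k) * sqrt (\<integral>\<omega>. (exp (c * Zs k \<omega>))\<^sup>2 \<partial>M)"
      "(\<integral>\<omega>. \<bar>(Z \<omega> - Zs k \<omega>) * exp (c * Z \<omega>)\<bar> \<partial>M) \<le> sqrt (b k) * sqrt (\<integral>\<omega>. (exp (c * Z \<omega>))\<^sup>2 \<partial>M)"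
      unfolding a_def b_def by (rule Cauchy_Schwarz_integral_sqrt; use iA iZ s in simp)+
    have B: "sqrt (\<integral>\<omega>. (exp (c * Z \<omega>))\<^sup>2 \<partial>M) \<le> sqrt B" "sqrt (\<integral>\<omega>. (exp (c * Zs k \<omega>))\<^sup>2 \<partial>M) \<le> sqrt B"
      using eZ eB by (simp_all add: sq)
    have ab: "0 \<le> sqrt (a k)" "0 \<le> sqrt (b k)" by (simp_all add: a_def b_def)
    have "norm (integral\<^sup>L M (?F k) - integral\<^sup>L M ?G) = norm (\<integral>\<omega>. ?F k \<omega> - ?G \<omega> \<partial>M)"
      using iF iG by simp
    also have "\<dots> \<le> (\<integral>\<omega>. norm (?F k \<omega> - ?G \<omega>) \<partial>M)" by (rule integral_norm_bound)
    also have "\<dots> \<le> (\<integral>\<omega>. \<bar>(A \<omega> - As k \<omega>) * exp (c * Z \<omega>)\<bar>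
      + \<bar>c\<bar> * (\<bar>(Z \<omega> - Zs k \<omega>) * exp (c * Zs k \<omega>)\<bar> + \<bar>(Z \<omega> - Zs k \<omega>) * exp (c * Z \<omega>)\<bar>) \<partial>M)"
      by (rule integral_mono) (use i iF iG ptw in auto)
    also have "\<dots> = (\<integral>\<omega>. \<bar>(A \<omega> - As k \<omega>) * exp (c * Z \<omega>)\<bar> \<partial>M)
      + \<bar>c\<bar> * ((\<integral>\<omega>. \<bar>(Z \<omega> - Zs k \<omega>) * exp (c * Zs k \<omega>)\<bar> \<partial>M) + (\<integral>\<omega>. \<bar>(Z \<omega> - Zs k \<omega>) * exp (c * Z \<omega>)\<bar> \<partial>M))"
      using i by (simp add: integrable_abs)
    also have "\<dots> \<le> sqrt (a k) * sqrt B + \<bar>c\<bar> * (sqrt (b k) * sqrt B + sqrt (b k) * sqrt B)"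
      by (intro add_mono mult_left_mono order_trans[OF CS(1)] order_trans[OF CS(2)] order_trans[OF CS(3)] B ab) simp
    finally show ?thesis .
  qed
  have sa: "(\<lambda>k. sqrt (a k)) \<longlonglongrightarrow> 0" "(\<lambda>k. sqrt (b k)) \<longlonglongrightarrow> 0"
    using tendsto_real_sqrt[OF lA] tendsto_real_sqrt[OF lZ] by (simp_all add: a_def b_def)
  have "(\<lambda>k. sqrt (a k) * sqrt B + \<bar>c\<bar> * (sqrt (b k) * sqrt B + sqrt (b k) * sqrt B)) \<longlonglongrightarrow>
      0 * sqrt B + \<bar>c\<bar> * (0 * sqrt B + 0 * sqrt B)"
    by (intro tendsto_add tendsto_mult tendsto_const sa)
  then have l0: "(\<lambda>k. sqrt (a k) * sqrt B + \<bar>c\<bar> * (sqrt (b k) * sqrt B + sqrt (b k) * sqrt B)) \<longlonglongrightarrow> 0" by simp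
  have "(\<lambda>k. integral\<^sup>L M (?F k) - integral\<^sup>L M ?G) \<longlonglongrightarrow> 0"
    by (rule Lim_null_comparison[OF _ l0]) (use nF in simp)
  then show "(\<lambda>k. integral\<^sup>L M (?F k)) \<longlonglongrightarrow> integral\<^sup>L M ?G" by (simp add: LIM_zero_iff)
qed

text \<open>The transform is known for step integrals; the left side passes to the limit by
  \<open>tendsto_expectation_exp_L2\<close>, the variances and the covariance on the right by
  \<open>tendsto_integral_mult_L2\<close>. The three approximating sequences need no relation to
  each other.\<close>

lemma wiener_integral_transform:
  fixes u \<alpha> c :: real
  assumes W1: "wiener_process M W1" and W2: "wiener_process M W2" and ind: "indep_processes M W1 W2"
    and Y: "is_wiener_integral M W1 T f Y" and Z: "is_wiener_integral M W1 T g Z" and V: "is_wiener_integral M W2 T k V"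
  shows "integrable M (\<lambda>\<omega>. exp (c * Z \<omega>))"
    and "(\<integral>\<omega>. exp (\<i> * complex_of_real (u * (\<alpha> * Y \<omega> + V \<omega>)) + complex_of_real (c * Z \<omega>)) \<partial>M)
      = exp (complex_of_real ((c\<^sup>2 * (\<integral>s. (g s)\<^sup>2 \<partial>lebT T)
          - u\<^sup>2 * (\<alpha>\<^sup>2 * (\<integral>s. (f s)\<^sup>2 \<partial>lebT T) + (\<integral>s. (k s)\<^sup>2 \<partial>lebT T))) / 2)
        + \<i> * complex_of_real (u * \<alpha> * c * (\<integral>s. f s * g s \<partial>lebT T)))"
proof -
  interpret prob_space M using W1 by (rule wiener_process_prob_space)
  obtain n1 t1 c1 where p1: "\<And>q. partition_in T (n1 q) (t1 q)"
    and f1: "(\<lambda>q. \<integral>s. (f s - step_fun (n1 q) (t1 q) (c1 q) s)\<^sup>2 \<partial>lebT T) \<longlonglongrightarrow> 0"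
    and Y1: "(\<lambda>q. \<integral>\<omega>. (Y \<omega> - step_int W1 (n1 q) (t1 q) (c1 q) \<omega>)\<^sup>2 \<partial>M) \<longlonglongrightarrow> 0"
    and fm[measurable]: "f \<in> borel_measurable borel" and fi: "integrable (lebT T) (\<lambda>s. (f s)\<^sup>2)"
    and Ym[measurable]: "Y \<in> borel_measurable M" and Yi: "integrable M (\<lambda>\<omega>. (Y \<omega>)\<^sup>2)"
    by (rule is_wiener_integralE[OF Y]) blast
  obtain n2 t2 c2 where p2: "\<And>q. partition_in T (n2 q) (t2 q)"
    and f2: "(\<lambda>q. \<integral>s. (g s - step_fun (n2 q) (t2 q) (c2 q) s)\<^sup>2 \<partial>lebT T) \<longlonglongrightarrow> 0"
    and Y2: "(\<lambda>q. \<integral>\<omega>. (Z \<omega> - step_int W1 (n2 q) (t2 q) (c2 q) \<omega>)\<^sup>2 \<partial>M) \<longlonglongrightarrow> 0"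
    and gm[measurable]: "g \<in> borel_measurable borel" and gi: "integrable (lebT T) (\<lambda>s. (g s)\<^sup>2)"
    and Zm[measurable]: "Z \<in> borel_measurable M" and Zi: "integrable M (\<lambda>\<omega>. (Z \<omega>)\<^sup>2)"
    by (rule is_wiener_integralE[OF Z]) blast
  obtain n3 t3 c3 where p3: "\<And>q. partition_in T (n3 q) (t3 q)"
    and f3: "(\<lambda>q. \<integral>s. (k s - step_fun (n3 q) (t3 q) (c3 q) s)\<^sup>2 \<partial>lebT T) \<longlonglongrightarrow> 0"
    and Y3: "(\<lambda>q. \<integral>\<omega>. (V \<omega> - step_int W2 (n3 q) (t3 q) (c3 q) \<omega>)\<^sup>2 \<partial>M) \<longlonglongrightarrow> 0"
    and km[measurable]: "k \<in> borel_measurable borel" and ki: "integrable (lebT T) (\<lambda>s. (k s)\<^sup>2)"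
    and Vm[measurable]: "V \<in> borel_measurable M" and Vi: "integrable M (\<lambda>\<omega>. (V \<omega>)\<^sup>2)"
    by (rule is_wiener_integralE[OF V]) blast
  define s1 s2 s3 where "s1 q = step_fun (n1 q) (t1 q) (c1 q)" and "s2 q = step_fun (n2 q) (t2 q) (c2 q)"
    and "s3 q = step_fun (n3 q) (t3 q) (c3 q)" for q
  define S1 S2 S3 where "S1 q = step_int W1 (n1 q) (t1 q) (c1 q)" and "S2 q = step_int W1 (n2 q) (t2 q) (c2 q)"
    and "S3 q = step_int W2 (n3 q) (t3 q) (c3 q)" for q
  note f1 = f1[folded s1_def] and f2 = f2[folded s2_def] and f3 = f3[folded s3_def]
  note Y1 = Y1[folded S1_def] and Y2 = Y2[folded S2_def] and Y3 = Y3[folded S3_def]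
  have sm[measurable]: "s1 q \<in> borel_measurable borel" "s2 q \<in> borel_measurable borel" "s3 q \<in> borel_measurable borel" for q
    by (simp_all add: s1_def s2_def s3_def)
  have si: "integrable (lebT T) (\<lambda>s. (s1 q s)\<^sup>2)" "integrable (lebT T) (\<lambda>s. (s2 q s)\<^sup>2)" "integrable (lebT T) (\<lambda>s. (s3 q s)\<^sup>2)" for q
    unfolding s1_def s2_def s3_def by (rule step_fun_sq_integrable[OF p1] step_fun_sq_integrable[OF p2] step_fun_sq_integrable[OF p3])+
  have Sm[measurable]: "S1 q \<in> borel_measurable M" "S2 q \<in> borel_measurable M" "S3 q \<in> borel_measurable M" for q
    unfolding S1_def S2_def S3_def by (rule borel_measurable_step_int[OF W1] borel_measurable_step_int[OF W2])+
  have Si: "integrable M (\<lambda>\<omega>. (S1 q \<omega>)\<^sup>2)" "integrable M (\<lambda>\<omega>. (S2 q \<omega>)\<^sup>2)" "integrable M (\<lambda>\<omega>. (S3 q \<omega>)\<^sup>2)" for q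
    unfolding S1_def S2_def S3_def
    by (rule step_int_diff_isometry(1)[OF W1 p1 p1] step_int_diff_isometry(1)[OF W1 p2 p2] step_int_diff_isometry(1)[OF W2 p3 p3])+
  have A: "(\<lambda>q. \<integral>s. (s1 q s)\<^sup>2 \<partial>lebT T) \<longlonglongrightarrow> (\<integral>s. (f s)\<^sup>2 \<partial>lebT T)"
    unfolding power2_eq_square by (rule tendsto_integral_mult_L2) (use fi si f1 in auto)
  have B: "(\<lambda>q. \<integral>s. s1 q s * s2 q s \<partial>lebT T) \<longlonglongrightarrow> (\<integral>s. f s * g s \<partial>lebT T)"
    by (rule tendsto_integral_mult_L2) (use fi gi si f1 f2 in auto)
  have C: "(\<lambda>q. \<integral>s. (s2 q s)\<^sup>2 \<partial>lebT T) \<longlonglongrightarrow> (\<integral>s. (g s)\<^sup>2 \<partial>lebT T)"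
    unfolding power2_eq_square by (rule tendsto_integral_mult_L2) (use gi si f2 in auto)
  have D: "(\<lambda>q. \<integral>s. (s3 q s)\<^sup>2 \<partial>lebT T) \<longlonglongrightarrow> (\<integral>s. (k s)\<^sup>2 \<partial>lebT T)"
    unfolding power2_eq_square by (rule tendsto_integral_mult_L2) (use ki si f3 in auto)
  define As where "As q \<omega> = u * (\<alpha> * S1 q \<omega> + S3 q \<omega>)" for q \<omega>
  define AA where "AA \<omega> = u * (\<alpha> * Y \<omega> + V \<omega>)" for \<omega>
  have [measurable]: "As q \<in> borel_measurable M" "AA \<in> borel_measurable M" for q
    unfolding As_def[abs_def] AA_def[abs_def] by measurable
  have dY: "integrable M (\<lambda>\<omega>. (Y \<omega> - S1 q \<omega>)\<^sup>2)" for q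
    by (rule integrable_sq_diff) (use Yi Si in auto)
  have dZ: "integrable M (\<lambda>\<omega>. (Z \<omega> - S2 q \<omega>)\<^sup>2)" for q
    by (rule integrable_sq_diff) (use Zi Si in auto)
  have dV: "integrable M (\<lambda>\<omega>. (V \<omega> - S3 q \<omega>)\<^sup>2)" for q
    by (rule integrable_sq_diff) (use Vi Si in auto)
  have sq: "(AA \<omega> - As q \<omega>)\<^sup>2 \<le> 2 * u\<^sup>2 * \<alpha>\<^sup>2 * (Y \<omega> - S1 q \<omega>)\<^sup>2 + 2 * u\<^sup>2 * (V \<omega> - S3 q \<omega>)\<^sup>2" for q \<omega>
  proof -
    have "(x + y)\<^sup>2 \<le> 2 * x\<^sup>2 + 2 * y\<^sup>2" for x y :: real
      using sum_squares_bound[of x y] by (simp add: power2_sum)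
    from this[of "u * \<alpha> * (Y \<omega> - S1 q \<omega>)" "u * (V \<omega> - S3 q \<omega>)"]
    moreover have "AA \<omega> - As q \<omega> = u * \<alpha> * (Y \<omega> - S1 q \<omega>) + u * (V \<omega> - S3 q \<omega>)"
      by (simp add: AA_def As_def algebra_simps)
    ultimately show ?thesis by (simp only: power_mult_distrib mult.assoc)
  qed
  have bi: "integrable M (\<lambda>\<omega>. 2 * u\<^sup>2 * \<alpha>\<^sup>2 * (Y \<omega> - S1 q \<omega>)\<^sup>2 + 2 * u\<^sup>2 * (V \<omega> - S3 q \<omega>)\<^sup>2)" for q
    using dY dV by (intro Bochner_Integration.integrable_add integrable_mult_right) auto
  have dA: "integrable M (\<lambda>\<omega>. (AA \<omega> - As q \<omega>)\<^sup>2)" for q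
    by (rule Bochner_Integration.integrable_bound[OF bi[of q]]) (use sq in \<open>auto intro: order_trans\<close>)
  have lA: "(\<lambda>q. \<integral>\<omega>. (AA \<omega> - As q \<omega>)\<^sup>2 \<partial>M) \<longlonglongrightarrow> 0"
  proof (rule tendsto_sandwich[OF _ _ tendsto_const])
    show "\<forall>\<^sub>F q in sequentially. (\<integral>\<omega>. (AA \<omega> - As q \<omega>)\<^sup>2 \<partial>M)
        \<le> 2 * u\<^sup>2 * \<alpha>\<^sup>2 * (\<integral>\<omega>. (Y \<omega> - S1 q \<omega>)\<^sup>2 \<partial>M) + 2 * u\<^sup>2 * (\<integral>\<omega>. (V \<omega> - S3 q \<omega>)\<^sup>2 \<partial>M)"
    proof (intro always_eventually allI)
      fix q
      have "(\<integral>\<omega>. (AA \<omega> - As q \<omega>)\<^sup>2 \<partial>M) \<le> (\<integral>\<omega>. 2 * u\<^sup>2 * \<alpha>\<^sup>2 * (Y \<omega> - S1 q \<omega>)\<^sup>2 + 2 * u\<^sup>2 * (V \<omega> - S3 q \<omega>)\<^sup>2 \<partial>M)"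
        by (rule integral_mono) (use dA bi sq in auto)
      also have "\<dots> = 2 * u\<^sup>2 * \<alpha>\<^sup>2 * (\<integral>\<omega>. (Y \<omega> - S1 q \<omega>)\<^sup>2 \<partial>M) + 2 * u\<^sup>2 * (\<integral>\<omega>. (V \<omega> - S3 q \<omega>)\<^sup>2 \<partial>M)"
        using dY dV by simp
      finally show "(\<integral>\<omega>. (AA \<omega> - As q \<omega>)\<^sup>2 \<partial>M)
        \<le> 2 * u\<^sup>2 * \<alpha>\<^sup>2 * (\<integral>\<omega>. (Y \<omega> - S1 q \<omega>)\<^sup>2 \<partial>M) + 2 * u\<^sup>2 * (\<integral>\<omega>. (V \<omega> - S3 q \<omega>)\<^sup>2 \<partial>M)" .
    qed
    show "(\<lambda>q. 2 * u\<^sup>2 * \<alpha>\<^sup>2 * (\<integral>\<omega>. (Y \<omega> - S1 q \<omega>)\<^sup>2 \<partial>M) + 2 * u\<^sup>2 * (\<integral>\<omega>. (V \<omega> - S3 q \<omega>)\<^sup>2 \<partial>M)) \<longlonglongrightarrow> 0"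
      using tendsto_add[OF tendsto_mult_left[OF Y1] tendsto_mult_left[OF Y3], of "2 * u\<^sup>2 * \<alpha>\<^sup>2" "2 * u\<^sup>2"] by simp
  qed simp
  have e: "has_bochner_integral M (\<lambda>\<omega>. exp (2 * c * S2 q \<omega>)) (exp (2 * c\<^sup>2 * (\<integral>s. (s2 q s)\<^sup>2 \<partial>lebT T)))" for q
  proof -
    have "has_bochner_integral M (\<lambda>\<omega>. complex_of_real (exp (2 * c * S2 q \<omega>)))
        (complex_of_real (exp (2 * c\<^sup>2 * (\<integral>s. (s2 q s)\<^sup>2 \<partial>lebT T))))"
      using has_bochner_integral_exp_step_int[OF W1 p2 p2, of 0 _ _ "2 * c" q "c2 q"]
      unfolding S2_def[symmetric] s2_def[symmetric]
      by (simp add: exp_of_real power_mult_distrib mult.assoc flip: of_real_mult)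
    then show ?thesis by (simp add: has_bochner_integral_iff complex_of_real_integrable_eq)
  qed
  \<comment> \<open>The moment at 2c of a step integral is exp(2 c^2 times its variance). The
    variances converge, hence are bounded, and this gives the uniform moment bound.\<close>
  obtain K where K: "\<And>q. \<bar>\<integral>s. (s2 q s)\<^sup>2 \<partial>lebT T\<bar> \<le> K"
    using convergent_imp_Bseq[OF convergentI[OF C]] unfolding Bseq_def by auto
  have eB: "(\<integral>\<omega>. exp (2 * c * S2 q \<omega>) \<partial>M) \<le> exp (2 * c\<^sup>2 * K)" for q
  proof -
    have "(\<integral>s. (s2 q s)\<^sup>2 \<partial>lebT T) \<le> K" using K[of q] by linarith
    then show ?thesis using e[of q] by (simp add: has_bochner_integral_iff mult_left_mono)
  qed
  have ei: "integrable M (\<lambda>\<omega>. exp (2 * c * S2 q \<omega>))" for q using e[of q] by (simp add: has_bochner_integral_iff)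
  note lim = tendsto_expectation_exp_L2[of AA Z As S2 c "exp (2 * c\<^sup>2 * K)", OF _ Zm _ _ dA dZ lA Y2 ei eB]
  show "integrable M (\<lambda>\<omega>. exp (c * Z \<omega>))" by (rule lim(1)) auto
  have 1: "(\<lambda>q. \<integral>\<omega>. exp (\<i> * complex_of_real (As q \<omega>) + complex_of_real (c * S2 q \<omega>)) \<partial>M)
      \<longlonglongrightarrow> (\<integral>\<omega>. exp (\<i> * complex_of_real (AA \<omega>) + complex_of_real (c * Z \<omega>)) \<partial>M)"
    by (rule lim(2)) auto
  have 2: "(\<integral>\<omega>. exp (\<i> * complex_of_real (As q \<omega>) + complex_of_real (c * S2 q \<omega>)) \<partial>M)
      = exp (complex_of_real ((c\<^sup>2 * (\<integral>s. (s2 q s)\<^sup>2 \<partial>lebT T)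
          - u\<^sup>2 * (\<alpha>\<^sup>2 * (\<integral>s. (s1 q s)\<^sup>2 \<partial>lebT T) + (\<integral>s. (s3 q s)\<^sup>2 \<partial>lebT T))) / 2)
        + \<i> * complex_of_real (u * \<alpha> * c * (\<integral>s. s1 q s * s2 q s \<partial>lebT T)))" for q
    using has_bochner_integral_exp_step_int2[OF W1 W2 ind p1 p2 p3, of u \<alpha> q "c1 q" q "c3 q" c q "c2 q"]
    unfolding As_def S1_def[symmetric] S2_def[symmetric] S3_def[symmetric] s1_def[symmetric] s2_def[symmetric] s3_def[symmetric]
      has_bochner_integral_iff by blast
  have 3: "(\<lambda>q. exp (complex_of_real ((c\<^sup>2 * (\<integral>s. (s2 q s)\<^sup>2 \<partial>lebT T)
          - u\<^sup>2 * (\<alpha>\<^sup>2 * (\<integral>s. (s1 q s)\<^sup>2 \<partial>lebT T) + (\<integral>s. (s3 q s)\<^sup>2 \<partial>lebT T))) / 2)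
        + \<i> * complex_of_real (u * \<alpha> * c * (\<integral>s. s1 q s * s2 q s \<partial>lebT T))))
      \<longlonglongrightarrow> exp (complex_of_real ((c\<^sup>2 * (\<integral>s. (g s)\<^sup>2 \<partial>lebT T)
          - u\<^sup>2 * (\<alpha>\<^sup>2 * (\<integral>s. (f s)\<^sup>2 \<partial>lebT T) + (\<integral>s. (k s)\<^sup>2 \<partial>lebT T))) / 2)
        + \<i> * complex_of_real (u * \<alpha> * c * (\<integral>s. f s * g s \<partial>lebT T)))"
    by (rule tendsto_exp[OF tendsto_add[OF tendsto_of_real[OF tendsto_divide[OF tendsto_diff[OF tendsto_mult_left[OF C]
          tendsto_mult_left[OF tendsto_add[OF tendsto_mult_left[OF A] D]]] tendsto_const]]
        tendsto_mult_left[OF tendsto_of_real[OF tendsto_mult_left[OF B]]]]]) simp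
  show "(\<integral>\<omega>. exp (\<i> * complex_of_real (u * (\<alpha> * Y \<omega> + V \<omega>)) + complex_of_real (c * Z \<omega>)) \<partial>M)
      = exp (complex_of_real ((c\<^sup>2 * (\<integral>s. (g s)\<^sup>2 \<partial>lebT T)
          - u\<^sup>2 * (\<alpha>\<^sup>2 * (\<integral>s. (f s)\<^sup>2 \<partial>lebT T) + (\<integral>s. (k s)\<^sup>2 \<partial>lebT T))) / 2)
        + \<i> * complex_of_real (u * \<alpha> * c * (\<integral>s. f s * g s \<partial>lebT T)))"
    using LIMSEQ_unique[OF 1[unfolded 2 AA_def] 3] .
qed

section \<open>Change of measure\<close>

lemma real_distribution_normal:
  assumes "\<sigma> > 0"
  shows "real_distribution (density lborel (\<lambda>x. ennreal (normal_density \<mu> \<sigma> x)))"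
  using prob_space_normal_density[OF assms, of \<mu>]
  by (simp add: real_distribution_def real_distribution_axioms_def)

text \<open>The Cameron--Martin theorem for the Gaussian pair \<open>(\<alpha> Y + V, Z)\<close>: tilting by
  \<open>exp (c Z)\<close> shifts the mean by the covariance with \<open>c Z\<close>.\<close>
lemma distributed_wiener_integral_tilted:
  assumes W1: "wiener_process M W1" and W2: "wiener_process M W2" and ind: "indep_processes M W1 W2"
    and Y: "is_wiener_integral M W1 T f Y" and Z: "is_wiener_integral M W1 T g Z" and V: "is_wiener_integral M W2 T k V"
    and var: "\<sigma>\<^sup>2 = \<alpha>\<^sup>2 * (\<integral>s. (f s)\<^sup>2 \<partial>lebT T) + (\<integral>s. (k s)\<^sup>2 \<partial>lebT T)" and s: "\<sigma> > 0"
    and Q: "Q = density M (\<lambda>\<omega>. ennreal (exp (c * Z \<omega> - c\<^sup>2 * (\<integral>s. (g s)\<^sup>2 \<partial>lebT T) / 2)))"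
  shows "prob_space Q"
    and "distributed Q lborel (\<lambda>\<omega>. \<alpha> * Y \<omega> + V \<omega>)
      (\<lambda>x. ennreal (normal_density (\<alpha> * c * (\<integral>s. f s * g s \<partial>lebT T)) \<sigma> x))"
proof -
  interpret prob_space M using W1 by (rule wiener_process_prob_space)
  have [measurable]: "Y \<in> borel_measurable M" "Z \<in> borel_measurable M" "V \<in> borel_measurable M"
    using Y Z V by (simp_all add: is_wiener_integral_def)
  define G where "G = (\<integral>s. (g s)\<^sup>2 \<partial>lebT T)"
  define \<mu> where "\<mu> = \<alpha> * c * (\<integral>s. f s * g s \<partial>lebT T)"
  let ?d = "\<lambda>\<omega>. exp (c * Z \<omega> - c\<^sup>2 * G / 2)"
  let ?N = "\<lambda>\<omega>. \<alpha> * Y \<omega> + V \<omega>"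
  note tr = wiener_integral_transform[OF W1 W2 ind Y Z V, where c = c]
  have d: "?d \<omega> = exp (c * Z \<omega>) * exp (- c\<^sup>2 * G / 2)" for \<omega> by (simp flip: exp_add)
  have di: "integrable M ?d" unfolding d using tr(1) by simp
  \<comment> \<open>The normalising factor of the density cancels the variance of c Z, so the tilt
    survives only in the phase, as the mean \<mu>. At u = 0 this also shows that the density has
    mass 1.\<close>
  have chr: "(\<integral>\<omega>. ?d \<omega> *\<^sub>R iexp (u * ?N \<omega>) \<partial>M) = exp (complex_of_real (- u\<^sup>2 * \<sigma>\<^sup>2 / 2) + \<i> * complex_of_real (u * \<mu>))" for u
  proof -
    have cd: "complex_of_real (?d \<omega>) = exp (complex_of_real (- c\<^sup>2 * G / 2)) * exp (complex_of_real (c * Z \<omega>))" for \<omega>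
      unfolding d of_real_mult[of "exp _"] exp_of_real by (rule mult.commute)
    have "(\<integral>\<omega>. ?d \<omega> *\<^sub>R iexp (u * ?N \<omega>) \<partial>M)
        = (\<integral>\<omega>. exp (complex_of_real (- c\<^sup>2 * G / 2)) * exp (\<i> * complex_of_real (u * ?N \<omega>) + complex_of_real (c * Z \<omega>)) \<partial>M)"
      unfolding scaleR_conv_of_real cd exp_add mult.assoc by (simp only: mult.commute)
    also have "\<dots> = exp (complex_of_real (- c\<^sup>2 * G / 2))
        * exp (complex_of_real ((c\<^sup>2 * G - u\<^sup>2 * \<sigma>\<^sup>2) / 2) + \<i> * complex_of_real (u * \<mu>))"
      using tr(2)[where u = u and \<alpha> = \<alpha>] by (simp only: integral_mult_right_zero var G_def \<mu>_def mult.assoc)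
    also have "\<dots> = exp (complex_of_real (- u\<^sup>2 * \<sigma>\<^sup>2 / 2) + \<i> * complex_of_real (u * \<mu>))"
      unfolding exp_add[symmetric] by (rule arg_cong[where f = exp]) (simp add: diff_divide_distrib)
    finally show ?thesis .
  qed
  have Q': "Q = density M (\<lambda>\<omega>. ennreal (?d \<omega>))" by (simp add: Q G_def)
  have one: "(\<integral>\<omega>. ?d \<omega> \<partial>M) = 1"
  proof -
    have "complex_of_real (\<integral>\<omega>. ?d \<omega> \<partial>M) = 1"
      using chr[of 0] unfolding integral_complex_of_real[symmetric] by (simp add: scaleR_conv_of_real)
    then show ?thesis by (simp only: of_real_eq_1_iff)
  qed
  show pQ: "prob_space Q"
  proof
    show "emeasure Q (space Q) = 1"
      unfolding Q' using one by (simp add: emeasure_density nn_integral_eq_integral[OF di])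
  qed
  interpret Q: prob_space Q by (rule pQ)
  have [measurable]: "?N \<in> borel_measurable Q" by (simp add: Q')
  let ?D = "density lborel (\<lambda>x. ennreal (normal_density \<mu> \<sigma> x))"
  have rd: "real_distribution ?D" by (rule real_distribution_normal[OF s])
  have "distr Q borel ?N = ?D"
  proof (rule Levy_uniqueness[OF _ rd])
    show "real_distribution (distr Q borel ?N)" by (rule Q.real_distribution_distr) simp
    show "char (distr Q borel ?N) = char ?D"
    proof
      fix u
      have "char (distr Q borel ?N) u = (\<integral>\<omega>. iexp (u * ?N \<omega>) \<partial>Q)"
        unfolding char_def by (rule integral_distr) auto
      also have "\<dots> = (\<integral>\<omega>. ?d \<omega> *\<^sub>R iexp (u * ?N \<omega>) \<partial>M)"
        unfolding Q' by (rule integral_density) auto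
      also have "\<dots> = iexp (u * \<mu>) * exp (- (u * \<sigma>)\<^sup>2 / 2)"
        unfolding chr exp_add exp_of_real power_mult_distrib minus_mult_left[symmetric] by (rule mult.commute)
      also have "\<dots> = char ?D u"
        unfolding char_def
        by (rule expectation_iexp_normal[symmetric, OF prob_space_normal_density[OF s] _ s])
          (auto simp: distributed_def distr_id2 intro!: measurable_ident_sets)
      finally show "char (distr Q borel ?N) u = char ?D u" .
    qed
  qed
  then have "distr Q lborel ?N = ?D" using distr_cong[of Q Q lborel borel ?N ?N] by simp
  then show "distributed Q lborel ?N (\<lambda>x. ennreal (normal_density (\<alpha> * c * (\<integral>s. f s * g s \<partial>lebT T)) \<sigma> x))"
    by (simp add: distributed_def \<mu>_def)
qed

section \<open>The derivative of the kernel\<close>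

text \<open>By the mean value theorem the difference quotients inherit the bound b on the
  derivative, so dominated convergence applies along every sequence that tends to t.\<close>

lemma DERIV_integral_dominated:
  fixes f f' :: "real \<Rightarrow> 'b \<Rightarrow> real"
  assumes fi: "\<And>y. l < y \<Longrightarrow> integrable M (f y)"
    and fd: "\<And>y x. l < y \<Longrightarrow> x \<in> space M \<Longrightarrow> ((\<lambda>y. f y x) has_real_derivative f' y x) (at y)"
    and bd: "\<And>y x. l < y \<Longrightarrow> x \<in> space M \<Longrightarrow> \<bar>f' y x\<bar> \<le> b x"
    and bi: "integrable M b" and f'm[measurable]: "f' t \<in> borel_measurable M" and t: "l < t"
  shows "((\<lambda>y. \<integral>x. f y x \<partial>M) has_real_derivative (\<integral>x. f' t x \<partial>M)) (at t)"
  unfolding has_field_derivative_iff tendsto_at_iff_sequentially comp_def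
proof (intro allI impI)
  fix X :: "nat \<Rightarrow> real"
  assume X: "\<forall>i. X i \<in> UNIV - {t}" "X \<longlonglongrightarrow> t"
  from order_tendstoD(1)[OF X(2) t] obtain N where N: "\<And>i. i \<ge> N \<Longrightarrow> l < X i"
    by (auto simp: eventually_sequentially)
  \<comment> \<open>The first terms of the sequence may lie at or below l, where nothing is assumed;
    they are dropped.\<close>
  define Y where "Y i = X (i + N)" for i
  have Y: "l < Y i" "Y i \<noteq> t" for i using N X(1) by (auto simp: Y_def)
  have Yt: "Y \<longlonglongrightarrow> t" unfolding Y_def using X(2) by (rule LIMSEQ_ignore_initial_segment)
  have bnd: "\<bar>(f y x - f t x) / (y - t)\<bar> \<le> b x" if y: "l < y" "y \<noteq> t" and x: "x \<in> space M" for y x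
  proof -
    have "\<exists>z>l. f y x - f t x = (y - t) * f' z x"
    proof (cases "y < t")
      case True
      obtain z where "y < z" "z < t" "f t x - f y x = (t - y) * f' z x"
        using MVT2[OF True, of "\<lambda>y. f y x" "\<lambda>y. f' y x"] fd x y by auto
      then show ?thesis using y by (intro exI[of _ z]) (auto simp: algebra_simps)
    next
      case False
      then have "t < y" using y by simp
      from MVT2[OF this, of "\<lambda>y. f y x" "\<lambda>y. f' y x"] fd x t
      obtain z where "t < z" "z < y" "f y x - f t x = (y - t) * f' z x" by auto
      then show ?thesis using t by (intro exI[of _ z]) auto
    qed
    then obtain z where "z > l" "f y x - f t x = (y - t) * f' z x" by blast
    then show ?thesis using bd[of z x] x y by simp
  qed
  have lim: "(\<lambda>i. (f (Y i) x - f t x) / (Y i - t)) \<longlonglongrightarrow> f' t x" if x: "x \<in> space M" for x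
  proof -
    have "((\<lambda>y. (f y x - f t x) / (y - t)) \<longlongrightarrow> f' t x) (at t)"
      using fd[OF t x] by (simp add: has_field_derivative_iff)
    moreover have "filterlim Y (at t) sequentially"
      using Yt Y by (simp add: filterlim_at)
    ultimately show ?thesis by (rule filterlim_compose)
  qed
  have "(\<lambda>i. \<integral>x. (f (Y i) x - f t x) / (Y i - t) \<partial>M) \<longlonglongrightarrow> (\<integral>x. f' t x \<partial>M)"
  proof (rule integral_dominated_convergence[OF f'm _ bi])
    show "(\<lambda>x. (f (Y i) x - f t x) / (Y i - t)) \<in> borel_measurable M" for i
      using fi[OF Y(1)[of i]] fi[OF t] by simp
  qed (use lim bnd Y in auto)
  moreover have "(\<integral>x. (f (Y i) x - f t x) / (Y i - t) \<partial>M)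
      = ((\<integral>x. f (Y i) x \<partial>M) - (\<integral>x. f t x \<partial>M)) / (Y i - t)" for i
    using fi[OF Y(1)[of i]] fi[OF t] by simp
  ultimately have "(\<lambda>i. ((\<integral>x. f (Y i) x \<partial>M) - (\<integral>x. f t x \<partial>M)) / (Y i - t)) \<longlonglongrightarrow> (\<integral>x. f' t x \<partial>M)"
    by (simp only:)
  then show "(\<lambda>i. ((\<integral>x. f (X i) x \<partial>M) - (\<integral>x. f t x \<partial>M)) / (X i - t)) \<longlonglongrightarrow> (\<integral>x. f' t x \<partial>M)"
    unfolding Y_def by (rule LIMSEQ_offset)
qed

section \<open>The kernel after substitution, its derivative and the resulting bound\<close>

text \<open>The integrand of \<open>Beta (H2 - 1/2) (3/2 - H1)\<close>: what the two endpoint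
  singularities of \<open>KH\<close> become on [0,1].\<close>

definition beta_weight :: "real \<Rightarrow> real \<Rightarrow> real \<Rightarrow> real" where
  "beta_weight H1 H2 x = indicator {0..1} x * ((1 - x) powr (1/2 - H1) * x powr (H2 - 3/2))"

lemma beta_weight_nonneg: "0 \<le> beta_weight H1 H2 x"
  by (simp add: beta_weight_def)

lemma borel_measurable_beta_weight [measurable]: "beta_weight H1 H2 \<in> borel_measurable borel"
  unfolding beta_weight_def[abs_def] by measurable

lemma integrable_beta_weight:
  assumes "H1 < 3/2" "1/2 < H2"
  shows "integrable lborel (beta_weight H1 H2)"
  using integrable_Beta[of "H2 - 1/2" "3/2 - H1"] assms
  unfolding set_integrable_def beta_weight_def[abs_def] by (simp add: mult_ac)

text \<open>The substitution \<open>u = s + (t - s) x\<close> turns \<open>KH\<close> into \<open>(t - s) powr (H2 - H1)\<close> times an integral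
  over \<open>[0, 1]\<close> that can be differentiated in \<open>t\<close> under the integral sign.\<close>
definition KG :: "real \<Rightarrow> real \<Rightarrow> real \<Rightarrow> real \<Rightarrow> real" where
  "KG H1 H2 t s = (\<integral>x. beta_weight H1 H2 x * (s + (t - s) * x) powr (H2 - H1) \<partial>lborel)"

definition KG' :: "real \<Rightarrow> real \<Rightarrow> real \<Rightarrow> real \<Rightarrow> real" where
  "KG' H1 H2 t s = (\<integral>x. beta_weight H1 H2 x * ((H2 - H1) * (s + (t - s) * x) powr (H2 - H1 - 1) * x) \<partial>lborel)"

lemma KH_eq:
  assumes s: "0 < s" and t: "s < t"
  shows "KH H1 H2 t s = betaH H2 * s powr (1/2 - H2) * ((t - s) powr (H2 - H1) * KG H1 H2 t s)"
proof -
  let ?f = "\<lambda>u. indicator {s..t} u * ((t - u) powr (1/2 - H1) * u powr (H2 - H1) * (u - s) powr (H2 - 3/2))"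
  have "(\<integral>u. ?f u \<partial>lborel) = \<bar>t - s\<bar> *\<^sub>R (\<integral>x. ?f (s + (t - s) * x) \<partial>lborel)"
    using t by (intro lborel_integral_real_affine) simp
  also have "\<dots> = (\<integral>x. (t - s) * ?f (s + (t - s) * x) \<partial>lborel)" using t by simp
  also have "\<dots> = (\<integral>x. (t - s) powr (H2 - H1) * (beta_weight H1 H2 x * (s + (t - s) * x) powr (H2 - H1)) \<partial>lborel)"
  proof (rule Bochner_Integration.integral_cong[OF refl])
    fix x :: real
    show "(t - s) * ?f (s + (t - s) * x) = (t - s) powr (H2 - H1) * (beta_weight H1 H2 x * (s + (t - s) * x) powr (H2 - H1))"
    proof (cases "x \<in> {0..1}")
      case True
      have "0 \<le> (t - s) * x" "(t - s) * x \<le> (t - s) * 1"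
        using True t by (auto intro!: mult_left_mono)
      then have i: "s + (t - s) * x \<in> {s..t}" by auto
      have "t - (s + (t - s) * x) = (t - s) * (1 - x)" by (simp add: algebra_simps)
      \<comment> \<open>The Jacobian and the two endpoint factors contribute the exponents 1, 1/2 -
        H1 and H2 - 3/2.\<close>
      moreover have "(t - s) * (t - s) powr (1/2 - H1) * (t - s) powr (H2 - 3/2) = (t - s) powr (H2 - H1)"
        using t powr_add[of "t - s" 1 "1/2 - H1"] powr_add[of "t - s" "1 + (1/2 - H1)" "H2 - 3/2"] by simp
      ultimately show ?thesis
        using i True t by (simp add: beta_weight_def powr_mult mult_ac)
    next
      case False
      have "s + (t - s) * x \<notin> {s..t}"
      proof
        assume "s + (t - s) * x \<in> {s..t}"
        then have "0 \<le> (t - s) * x" "(t - s) * x \<le> (t - s) * 1" by auto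
        then have "x \<in> {0..1}" using t by (simp add: zero_le_mult_iff mult_le_cancel_left)
        with False show False by simp
      qed
      then show ?thesis using False by (simp add: beta_weight_def)
    qed
  qed
  finally have "(\<integral>u. ?f u \<partial>lborel) = (t - s) powr (H2 - H1) * KG H1 H2 t s" by (simp add: KG_def)
  then show ?thesis using s t by (simp add: KH_def set_lebesgue_integral_def)
qed

text \<open>On the diagonal \<open>KH\<close> is not differentiable in \<open>t\<close> and \<open>dKH\<close> is a junk value; everywhere else
  \<open>dKH\<close> is the following function.\<close>
definition KD :: "real \<Rightarrow> real \<Rightarrow> real \<Rightarrow> real \<Rightarrow> real" where
  "KD H1 H2 t s = (if 0 < s \<and> s < t then betaH H2 * s powr (1/2 - H2) *
     ((H2 - H1) * (t - s) powr (H2 - H1 - 1) * KG H1 H2 t s + (t - s) powr (H2 - H1) * KG' H1 H2 t s) else 0)"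

context
  fixes H1 H2 :: real
  assumes H1: "1/2 < H1" and H12: "H1 < H2" and H2: "H2 < 1"
begin

text \<open>A nonzero weight excludes x = 0 as well, since 0 raised by \<open>powr\<close> is 0. The
  strict inequality is used in \<open>KG'_bounds\<close>, where x carries a negative power.\<close>

lemma segment_bounds:
  assumes "s < y" "beta_weight H1 H2 x \<noteq> 0"
  shows "0 < x" "x \<le> 1" "s \<le> s + (y - s) * x" "s + (y - s) * x \<le> y"
proof -
  have x: "0 \<le> x" "x \<le> 1" "x \<noteq> 0" using assms(2) by (auto simp: beta_weight_def indicator_def split: if_splits)
  then show "0 < x" "x \<le> 1" by auto
  have "(y - s) * x \<le> (y - s) * 1" using x assms by (intro mult_left_mono) auto
  then show "s + (y - s) * x \<le> y" by (simp add: algebra_simps)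
  have "0 \<le> (y - s) * x" using x assms by simp
  then show "s \<le> s + (y - s) * x" by linarith
qed

lemma KG_bounds:
  assumes s: "0 < s" and y: "s < y"
  shows "integrable lborel (\<lambda>x. beta_weight H1 H2 x * (s + (y - s) * x) powr (H2 - H1))"
    and "0 \<le> KG H1 H2 y s" and "KG H1 H2 y s \<le> y powr (H2 - H1) * (\<integral>x. beta_weight H1 H2 x \<partial>lborel)"
proof -
  have w: "integrable lborel (beta_weight H1 H2)" using H1 H12 H2 by (intro integrable_beta_weight) auto
  have le: "beta_weight H1 H2 x * (s + (y - s) * x) powr (H2 - H1) \<le> y powr (H2 - H1) * beta_weight H1 H2 x" for x
  proof (cases "beta_weight H1 H2 x = 0")
    case False
    note b = segment_bounds[OF y False]
    have "(s + (y - s) * x) powr (H2 - H1) \<le> y powr (H2 - H1)"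
      using b s H12 by (intro powr_mono2) auto
    from mult_left_mono[OF this beta_weight_nonneg[of H1 H2 x]] show ?thesis by (simp add: mult.commute)
  qed simp
  have nn: "0 \<le> beta_weight H1 H2 x * (s + (y - s) * x) powr (H2 - H1)" for x
    using beta_weight_nonneg[of H1 H2 x] by simp
  show i: "integrable lborel (\<lambda>x. beta_weight H1 H2 x * (s + (y - s) * x) powr (H2 - H1))"
    by (rule Bochner_Integration.integrable_bound[of _ "\<lambda>x. y powr (H2 - H1) * beta_weight H1 H2 x"])
       (use w le nn beta_weight_nonneg in auto)
  show "0 \<le> KG H1 H2 y s" unfolding KG_def by (intro Bochner_Integration.integral_nonneg nn)
  have "KG H1 H2 y s \<le> (\<integral>x. y powr (H2 - H1) * beta_weight H1 H2 x \<partial>lborel)"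
    unfolding KG_def by (rule integral_mono[OF i]) (use w le in auto)
  then show "KG H1 H2 y s \<le> y powr (H2 - H1) * (\<integral>x. beta_weight H1 H2 x \<partial>lborel)" by simp
qed

text \<open>For fixed s > 0 the segment stays above s, so the negative power is at most its value at
  s, uniformly in y > s. This provides the integrable majorant.\<close>

lemma KG_deriv:
  assumes s: "0 < s" and t: "s < t"
  shows "((\<lambda>t. KG H1 H2 t s) has_real_derivative KG' H1 H2 t s) (at t)"
  unfolding KG_def KG'_def
proof (rule DERIV_integral_dominated[where l = s and b = "\<lambda>x. beta_weight H1 H2 x * ((H2 - H1) * s powr (H2 - H1 - 1))"])
  fix y x :: real assume y: "s < y"
  show "((\<lambda>y. beta_weight H1 H2 x * (s + (y - s) * x) powr (H2 - H1)) has_real_derivative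
      beta_weight H1 H2 x * ((H2 - H1) * (s + (y - s) * x) powr (H2 - H1 - 1) * x)) (at y)"
  proof (cases "beta_weight H1 H2 x = 0")
    case False
    have "0 < s + (y - s) * x" using segment_bounds[OF y False] s by linarith
    then show ?thesis
      by (auto intro!: derivative_eq_intros simp: mult_ac)
  qed simp
  show "\<bar>beta_weight H1 H2 x * ((H2 - H1) * (s + (y - s) * x) powr (H2 - H1 - 1) * x)\<bar>
      \<le> beta_weight H1 H2 x * ((H2 - H1) * s powr (H2 - H1 - 1))"
  proof (cases "beta_weight H1 H2 x = 0")
    case False
    note b = segment_bounds[OF y False]
    have "(s + (y - s) * x) powr (H2 - H1 - 1) \<le> s powr (H2 - H1 - 1)"
      using b s H1 H2 H12 by (intro powr_mono2') auto
    then have "(s + (y - s) * x) powr (H2 - H1 - 1) * x \<le> s powr (H2 - H1 - 1) * 1"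
      using b by (intro mult_mono) auto
    then have "(H2 - H1) * ((s + (y - s) * x) powr (H2 - H1 - 1) * x) \<le> (H2 - H1) * s powr (H2 - H1 - 1)"
      using H12 by (intro mult_left_mono) auto
    then show ?thesis using b H12 beta_weight_nonneg[of H1 H2 x]
      by (simp add: abs_mult mult_left_mono mult.assoc)
  qed simp
qed (use KG_bounds(1)[OF s] t integrable_beta_weight[of H1 H2] H1 H2 H12 in auto)

text \<open>The majorant of \<open>KG_deriv\<close> would be too singular as s tends to 0. Here s is
  dropped from the base instead: ((t - s) x) powr (H2 - H1 - 1) is singular at x = 0, but the inner
  derivative x compensates, and only a power of t - s remains.\<close>

lemma KG'_bounds:
  assumes s: "0 < s" and t: "s < t"
  shows "\<bar>KG' H1 H2 t s\<bar> \<le> (H2 - H1) * (t - s) powr (H2 - H1 - 1) * (\<integral>x. beta_weight H1 H2 x \<partial>lborel)"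
proof -
  have w: "integrable lborel (beta_weight H1 H2)" using H1 H12 H2 by (intro integrable_beta_weight) auto
  let ?F = "\<lambda>x. beta_weight H1 H2 x * ((H2 - H1) * (s + (t - s) * x) powr (H2 - H1 - 1) * x)"
  let ?c = "(H2 - H1) * (t - s) powr (H2 - H1 - 1)"
  have le: "\<bar>?F x\<bar> \<le> ?c * beta_weight H1 H2 x" for x
  proof (cases "beta_weight H1 H2 x = 0")
    case False
    note b = segment_bounds[OF t False]
    have p: "0 < (t - s) * x" using b t by simp
    have "(s + (t - s) * x) powr (H2 - H1 - 1) * x \<le> ((t - s) * x) powr (H2 - H1 - 1) * x"
      using b s p H1 H2 H12 by (intro mult_right_mono powr_mono2') auto
    also have "\<dots> = (t - s) powr (H2 - H1 - 1) * x powr (H2 - H1)"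
      using b t powr_add[of x "H2 - H1 - 1" 1] by (simp add: powr_mult mult.assoc)
    also have "\<dots> \<le> (t - s) powr (H2 - H1 - 1) * 1"
      using b H12 by (intro mult_left_mono powr_le1) auto
    finally have "(H2 - H1) * ((s + (t - s) * x) powr (H2 - H1 - 1) * x) \<le> ?c"
      using H12 by (simp add: mult_left_mono)
    from mult_left_mono[OF this beta_weight_nonneg[of H1 H2 x]]
    show ?thesis using b H12 beta_weight_nonneg[of H1 H2 x]
      by (simp add: abs_mult mult_ac)
  qed simp
  have "\<bar>KG' H1 H2 t s\<bar> \<le> (\<integral>x. ?c * beta_weight H1 H2 x \<partial>lborel)"
    unfolding KG'_def using integral_abs_bound[of lborel ?F]
  proof (rule order_trans)
    have "integrable lborel ?F"
      by (rule Bochner_Integration.integrable_bound[of _ "\<lambda>x. ?c * beta_weight H1 H2 x"])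
         (use w le H12 beta_weight_nonneg[of H1 H2] in \<open>auto intro: order_trans[OF _ abs_ge_self]\<close>)
    then show "(\<integral>x. \<bar>?F x\<bar> \<partial>lborel) \<le> (\<integral>x. ?c * beta_weight H1 H2 x \<partial>lborel)"
      by (intro integral_mono) (use w le in auto)
  qed
  then show ?thesis by simp
qed

lemma dKH_eq_KD:
  assumes "t \<noteq> s"
  shows "dKH H1 H2 t s = KD H1 H2 t s"
proof (cases "0 < s \<and> s < t")
  case True
  then have s: "0 < s" and t: "s < t" by auto
  have "((\<lambda>t. betaH H2 * s powr (1/2 - H2) * ((t - s) powr (H2 - H1) * KG H1 H2 t s)) has_real_derivative KD H1 H2 t s) (at t)"
    using t s KG_deriv[OF s t] by (auto intro!: derivative_eq_intros simp: KD_def algebra_simps)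
  moreover have ev: "\<forall>\<^sub>F y in nhds t. KH H1 H2 y s = betaH H2 * s powr (1/2 - H2) * ((y - s) powr (H2 - H1) * KG H1 H2 y s)"
    using eventually_nhds_in_open[of "{s<..}" t] t by (auto elim!: eventually_mono intro!: KH_eq[OF s])
  ultimately have "((\<lambda>y. KH H1 H2 y s) has_real_derivative KD H1 H2 t s) (at t)"
    using DERIV_cong_ev[OF refl ev refl] by simp
  then show ?thesis unfolding dKH_def by (rule DERIV_imp_deriv)
next
  case False
  have "\<forall>\<^sub>F y in nhds t. KH H1 H2 y s = 0"
  proof (cases "0 < s")
    case True
    then have "t < s" using False assms by auto
    then show ?thesis using eventually_nhds_in_open[of "{..<s}" t] by (auto elim!: eventually_mono simp: KH_def)
  qed (simp add: KH_def)
  then have "((\<lambda>y. KH H1 H2 y s) has_real_derivative 0) (at t)"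
    using DERIV_cong_ev[OF refl _ refl, of "\<lambda>y. KH H1 H2 y s" "\<lambda>_. 0" t 0] by simp
  then have "dKH H1 H2 t s = 0" unfolding dKH_def by (rule DERIV_imp_deriv)
  then show ?thesis using False by (auto simp: KD_def)
qed

lemma borel_measurable_KD [measurable]: "(\<lambda>(t, s). KD H1 H2 t s) \<in> borel_measurable (borel \<Otimes>\<^sub>M borel)"
proof -
  have [measurable]: "(\<lambda>(t, s). KG H1 H2 t s) \<in> borel_measurable (borel \<Otimes>\<^sub>M borel)"
    unfolding KG_def case_prod_beta by measurable
  have [measurable]: "(\<lambda>(t, s). KG' H1 H2 t s) \<in> borel_measurable (borel \<Otimes>\<^sub>M borel)"
    unfolding KG'_def case_prod_beta by measurable
  show ?thesis unfolding KD_def case_prod_beta by measurable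
qed

text \<open>The two terms of the product rule obey the same bound, hence the factor 2 in the
  constant. In the first, \<open>KG\<close> is at most t powr (H2 - H1) times the Beta integral; in
  the second, (t - s) powr (H2 - H1) is enlarged to t powr (H2 - H1).\<close>

lemma KD_bound:
  obtains C where "C \<ge> 0" "\<And>t s. 0 < s \<Longrightarrow> s < t \<Longrightarrow>
    \<bar>KD H1 H2 t s\<bar> \<le> C * (s powr (1/2 - H2) * (t powr (H2 - H1) * (t - s) powr (H2 - H1 - 1)))"
proof
  define I where "I = (\<integral>x. beta_weight H1 H2 x \<partial>lborel)"
  have I: "0 \<le> I" unfolding I_def by (intro Bochner_Integration.integral_nonneg beta_weight_nonneg)
  show "0 \<le> \<bar>betaH H2\<bar> * (2 * (H2 - H1) * I)" using I H12 by simp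
  fix t s :: real assume s: "0 < s" and t: "s < t"
  let ?a = "H2 - H1"
  let ?A = "?a * (t - s) powr (?a - 1) * KG H1 H2 t s"
  let ?B = "(t - s) powr ?a * KG' H1 H2 t s"
  let ?M = "t powr ?a * (t - s) powr (?a - 1)"
  have "\<bar>?A\<bar> = ?a * (t - s) powr (?a - 1) * KG H1 H2 t s"
    using KG_bounds(2)[OF s t] H12 by simp
  also have "\<dots> \<le> ?a * (t - s) powr (?a - 1) * (t powr ?a * I)"
    unfolding I_def using KG_bounds(3)[OF s t] H12 by (intro mult_left_mono) auto
  finally have A: "\<bar>?A\<bar> \<le> ?a * I * ?M" by (simp add: mult_ac)
  have "\<bar>?B\<bar> = (t - s) powr ?a * \<bar>KG' H1 H2 t s\<bar>" by (simp add: abs_mult)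
  also have "\<dots> \<le> t powr ?a * (?a * (t - s) powr (?a - 1) * I)"
    unfolding I_def using s t H12 by (intro mult_mono KG'_bounds powr_mono2) auto
  finally have B: "\<bar>?B\<bar> \<le> ?a * I * ?M" by (simp add: mult_ac)
  have "\<bar>KD H1 H2 t s\<bar> = \<bar>betaH H2\<bar> * s powr (1/2 - H2) * \<bar>?A + ?B\<bar>"
    using s t by (simp add: KD_def abs_mult)
  also have "\<dots> \<le> \<bar>betaH H2\<bar> * s powr (1/2 - H2) * (2 * (?a * I * ?M))"
    using A B by (intro mult_left_mono) (auto simp: abs_le_iff)
  finally show "\<bar>KD H1 H2 t s\<bar> \<le> \<bar>betaH H2\<bar> * (2 * (H2 - H1) * I) * (s powr (1/2 - H2) * ?M)"
    by (simp only: mult_ac)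
qed

end

section \<open>An L2 bound for the fractional kernel\<close>

text \<open>For a < 1 the integrand is singular at v, but the antiderivative is continuous there
  because a > 0, so derivatives in the interior are enough.\<close>

lemma nn_integral_powr_interval:
  assumes a: "0 < a" and v: "v \<le> T"
  shows "(\<integral>\<^sup>+t. ennreal ((t - v) powr (a - 1)) * indicator {v..T} t \<partial>lborel) = ennreal ((T - v) powr a / a)"
proof -
  have d: "((\<lambda>t. (t - v) powr a / a) has_real_derivative (t - v) powr (a - 1)) (at t)" if "v < t" for t
    using that a by (auto intro!: derivative_eq_intros)
  have i: "((\<lambda>t. (t - v) powr (a - 1)) has_integral ((T - v) powr a / a - (v - v) powr a / a)) {v..T}"
  proof (rule fundamental_theorem_of_calculus_interior[OF v])
    show "continuous_on {v..T} (\<lambda>t. (t - v) powr a / a)"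
      using a by (intro continuous_intros continuous_on_powr') auto
    show "((\<lambda>t. (t - v) powr a / a) has_vector_derivative (x - v) powr (a - 1)) (at x)" if "x \<in> {v<..<T}" for x
      using d[of x] that by (simp add: has_real_derivative_iff_has_vector_derivative)
  qed
  have "(\<integral>\<^sup>+t. ennreal (indicator {v..T} t * (t - v) powr (a - 1)) \<partial>lborel) = ennreal ((T - v) powr a / a)"
    by (rule nn_integral_has_integral_lebesgue) (use i in simp_all)
  then show ?thesis by (simp add: ennreal_mult' ennreal_indicator mult.commute)
qed

lemma nn_integral_powr_Beta:
  assumes a: "0 < a" and b: "0 < b" and t: "0 < t"
  shows "(\<integral>\<^sup>+v. ennreal (v powr (a - 1) * (t - v) powr (b - 1)) * indicator {0..t} v \<partial>lborel)
    = ennreal (t powr (a + b - 1) * Beta a b)"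
proof -
  let ?f = "\<lambda>v. ennreal (v powr (a - 1) * (t - v) powr (b - 1)) * indicator {0..t} v"
  have "(\<integral>\<^sup>+v. ?f v \<partial>lborel) = ennreal \<bar>t\<bar> * (\<integral>\<^sup>+x. ?f (0 + t * x) \<partial>lborel)"
    using t by (intro nn_integral_real_affine) auto
  also have "(\<integral>\<^sup>+x. ?f (0 + t * x) \<partial>lborel)
      = (\<integral>\<^sup>+x. ennreal (t powr (a + b - 2)) * ennreal (indicator {0..1} x * (x powr (a - 1) * (1 - x) powr (b - 1))) \<partial>lborel)"
  proof (rule nn_integral_cong)
    fix x :: real
    have ind: "(t * x \<in> {0..t}) = (x \<in> {0..1})" using t by (simp add: zero_le_mult_iff mult_le_cancel_left1)
    show "?f (0 + t * x) = ennreal (t powr (a + b - 2)) * ennreal (indicator {0..1} x * (x powr (a - 1) * (1 - x) powr (b - 1)))"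
    proof (cases "x \<in> {0..1}")
      case True
      have "t - t * x = t * (1 - x)" by (simp add: algebra_simps)
      moreover have "t powr (a - 1) * t powr (b - 1) = t powr (a + b - 2)" by (simp flip: powr_add)
      ultimately have "(t * x) powr (a - 1) * (t - t * x) powr (b - 1) = t powr (a + b - 2) * (x powr (a - 1) * (1 - x) powr (b - 1))"
        using True t by (simp add: powr_mult mult_ac)
      then show ?thesis using True ind by (simp add: ennreal_mult)
    qed (use ind in simp)
  qed
  also have "\<dots> = ennreal (t powr (a + b - 2)) * ennreal (Beta a b)"
    using has_integral_Beta_real[OF a b]
    by (subst nn_integral_cmult) (auto intro!: arg_cong2[where f = "(*)"] nn_integral_has_integral_lebesgue)
  also have "ennreal \<bar>t\<bar> * (ennreal (t powr (a + b - 2)) * ennreal (Beta a b)) = ennreal (t * t powr (a + b - 2) * Beta a b)"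
    using t by (simp add: ennreal_mult' mult.assoc)
  also have "t * t powr (a + b - 2) = t powr (a + b - 1)"
    using t powr_add[of t 1 "a + b - 2"] by simp
  finally show ?thesis .
qed

text \<open>Schur's test with the weight \<open>v powr (- \<delta>)\<close>: Cauchy--Schwarz splits the fractional
  kernel into two square roots.\<close>
lemma fractional_kernel_L2_bound:
  fixes \<phi> :: "real \<Rightarrow> real"
  assumes a: "0 < a" and d: "0 \<le> \<delta>" "\<delta> < 1/2" and T: "0 < T" and [measurable]: "\<phi> \<in> borel_measurable borel"
  shows "(\<integral>\<^sup>+v. ennreal (v powr (- 2 * \<delta>)) * indicator {0<..T} v
      * (\<integral>\<^sup>+t. ennreal (\<bar>\<phi> t\<bar> * t powr \<delta> * (t - v) powr (a - 1)) * indicator {v<..T} t \<partial>lborel)\<^sup>2 \<partial>lborel)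
    \<le> ennreal (T powr a / a * (T powr a * Beta (1 - 2 * \<delta>) a)) * (\<integral>\<^sup>+t. ennreal ((\<phi> t)\<^sup>2) * indicator {0<..T} t \<partial>lborel)"
proof -
  define k where "k t v = (t - v) powr (a - 1)" for t v :: real
  define \<psi> where "\<psi> t = \<bar>\<phi> t\<bar> * t powr \<delta>" for t
  have [measurable]: "\<psi> \<in> borel_measurable borel" unfolding \<psi>_def[abs_def] by measurable
  have [measurable]: "(\<lambda>(t, v). k t v) \<in> borel_measurable (borel \<Otimes>\<^sub>M borel)"
    unfolding k_def case_prod_beta by measurable
  have k0: "0 \<le> k t v" for t v by (simp add: k_def)
  have p0: "0 \<le> \<psi> t" for t by (simp add: \<psi>_def)
  have CS: "(\<integral>\<^sup>+t. ennreal (\<psi> t * k t v) * indicator {v<..T} t \<partial>lborel)\<^sup>2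
      \<le> (\<integral>\<^sup>+t. ennreal ((\<psi> t)\<^sup>2 * k t v) * indicator {v<..T} t \<partial>lborel) * ennreal (T powr a / a)"
    if v: "0 < v" "v \<le> T" for v
  proof -
    have "(\<integral>\<^sup>+t. ennreal (\<psi> t * k t v) * indicator {v<..T} t \<partial>lborel)\<^sup>2
        = (\<integral>\<^sup>+t. (ennreal (\<psi> t * sqrt (k t v)) * indicator {v<..T} t) * (ennreal (sqrt (k t v)) * indicator {v<..T} t) \<partial>lborel)\<^sup>2"
      by (intro arg_cong[where f = "\<lambda>x. x\<^sup>2"] nn_integral_cong)
         (use k0 p0 in \<open>auto simp: indicator_def mult.assoc simp flip: ennreal_mult\<close>)
    also have "\<dots> \<le> (\<integral>\<^sup>+t. (ennreal (\<psi> t * sqrt (k t v)) * indicator {v<..T} t)\<^sup>2 \<partial>lborel)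
        * (\<integral>\<^sup>+t. (ennreal (sqrt (k t v)) * indicator {v<..T} t)\<^sup>2 \<partial>lborel)"
      by (rule Cauchy_Schwarz_nn_integral) measurable
    also have "(\<integral>\<^sup>+t. (ennreal (\<psi> t * sqrt (k t v)) * indicator {v<..T} t)\<^sup>2 \<partial>lborel)
        = (\<integral>\<^sup>+t. ennreal ((\<psi> t)\<^sup>2 * k t v) * indicator {v<..T} t \<partial>lborel)"
      by (intro nn_integral_cong) (use k0 p0 in \<open>auto simp: indicator_def ennreal_power power_mult_distrib\<close>)
    also have "(\<integral>\<^sup>+t. (ennreal (sqrt (k t v)) * indicator {v<..T} t)\<^sup>2 \<partial>lborel)
        \<le> (\<integral>\<^sup>+t. ennreal ((t - v) powr (a - 1)) * indicator {v..T} t \<partial>lborel)"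
      by (intro nn_integral_mono) (use k0 in \<open>auto simp: indicator_def ennreal_power k_def\<close>)
    also have "\<dots> = ennreal ((T - v) powr a / a)" by (rule nn_integral_powr_interval[OF a v(2)])
    also have "\<dots> \<le> ennreal (T powr a / a)"
      using v a by (intro ennreal_leI divide_right_mono powr_mono2) auto
    finally show ?thesis by (simp add: mult_left_mono)
  qed
  let ?w = "\<lambda>v. ennreal (v powr (- 2 * \<delta>)) * indicator {0<..T} v"
  let ?K = "ennreal (T powr a / a)"
  have "(\<integral>\<^sup>+v. ?w v * (\<integral>\<^sup>+t. ennreal (\<psi> t * k t v) * indicator {v<..T} t \<partial>lborel)\<^sup>2 \<partial>lborel)
      \<le> (\<integral>\<^sup>+v. ?w v * ((\<integral>\<^sup>+t. ennreal ((\<psi> t)\<^sup>2 * k t v) * indicator {v<..T} t \<partial>lborel) * ?K) \<partial>lborel)"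
    by (intro nn_integral_mono) (use CS in \<open>auto simp: indicator_def intro!: mult_left_mono\<close>)
  also have "\<dots> = (\<integral>\<^sup>+v. (\<integral>\<^sup>+t. ?K * ?w v * (ennreal ((\<psi> t)\<^sup>2 * k t v) * indicator {v<..T} t) \<partial>lborel) \<partial>lborel)"
  proof (rule nn_integral_cong)
    fix v :: real
    have "?w v * ((\<integral>\<^sup>+t. ennreal ((\<psi> t)\<^sup>2 * k t v) * indicator {v<..T} t \<partial>lborel) * ?K)
        = ?K * ?w v * (\<integral>\<^sup>+t. ennreal ((\<psi> t)\<^sup>2 * k t v) * indicator {v<..T} t \<partial>lborel)"
      by (simp only: mult_ac)
    also have "\<dots> = (\<integral>\<^sup>+t. ?K * ?w v * (ennreal ((\<psi> t)\<^sup>2 * k t v) * indicator {v<..T} t) \<partial>lborel)"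
      by (rule nn_integral_cmult[symmetric]) measurable
    finally show "?w v * ((\<integral>\<^sup>+t. ennreal ((\<psi> t)\<^sup>2 * k t v) * indicator {v<..T} t \<partial>lborel) * ?K)
        = (\<integral>\<^sup>+t. ?K * ?w v * (ennreal ((\<psi> t)\<^sup>2 * k t v) * indicator {v<..T} t) \<partial>lborel)" .
  qed
  also have "\<dots> = (\<integral>\<^sup>+t. (\<integral>\<^sup>+v. ?K * ?w v * (ennreal ((\<psi> t)\<^sup>2 * k t v) * indicator {v<..T} t) \<partial>lborel) \<partial>lborel)"
    by (rule lborel_pair.Fubini') (simp add: split_beta' greaterThanAtMost_def indicator_def)
  also have "\<dots> \<le> (\<integral>\<^sup>+t. ?K * (ennreal (T powr a * Beta (1 - 2 * \<delta>) a) * (ennreal ((\<phi> t)\<^sup>2) * indicator {0<..T} t)) \<partial>lborel)"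
  proof (intro nn_integral_mono)
    fix t :: real
    show "(\<integral>\<^sup>+v. ?K * ?w v * (ennreal ((\<psi> t)\<^sup>2 * k t v) * indicator {v<..T} t) \<partial>lborel)
        \<le> ?K * (ennreal (T powr a * Beta (1 - 2 * \<delta>) a) * (ennreal ((\<phi> t)\<^sup>2) * indicator {0<..T} t))"
    proof (cases "0 < t \<and> t \<le> T")
      case True
      have "(\<integral>\<^sup>+v. ?K * ?w v * (ennreal ((\<psi> t)\<^sup>2 * k t v) * indicator {v<..T} t) \<partial>lborel)
          \<le> (\<integral>\<^sup>+v. ?K * ennreal ((\<psi> t)\<^sup>2) * (ennreal (v powr ((1 - 2 * \<delta>) - 1) * (t - v) powr (a - 1)) * indicator {0..t} v) \<partial>lborel)"
        by (intro nn_integral_mono)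
           (auto simp: indicator_def k_def ennreal_mult mult_ac)
      also have "\<dots> = ?K * ennreal ((\<psi> t)\<^sup>2) * ennreal (t powr ((1 - 2 * \<delta>) + a - 1) * Beta (1 - 2 * \<delta>) a)"
      proof -
        have B: "(\<integral>\<^sup>+v. ennreal (v powr ((1 - 2 * \<delta>) - 1) * (t - v) powr (a - 1)) * indicator {0..t} v \<partial>lborel)
            = ennreal (t powr ((1 - 2 * \<delta>) + a - 1) * Beta (1 - 2 * \<delta>) a)"
          by (rule nn_integral_powr_Beta) (use True d a in auto)
        show ?thesis unfolding B[symmetric] by (rule nn_integral_cmult) measurable
      qed
      \<comment> \<open>The square of the factor t powr \<delta> in \<psi> cancels the surplus power
        in t powr (a - 2 \<delta>) from the Beta integral. What is left, t powr a, is bounded on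
        (0,T]. The Beta integral is finite because \<delta> < 1/2.\<close>
      also have "\<dots> = ?K * ennreal ((\<phi> t)\<^sup>2 * (t powr a * Beta (1 - 2 * \<delta>) a))"
      proof -
        have "(t powr \<delta>)\<^sup>2 * t powr ((1 - 2 * \<delta>) + a - 1) = t powr a"
          unfolding power2_eq_square by (simp flip: powr_add)
        then have "(\<psi> t)\<^sup>2 * (t powr ((1 - 2 * \<delta>) + a - 1) * Beta (1 - 2 * \<delta>) a) = (\<phi> t)\<^sup>2 * (t powr a * Beta (1 - 2 * \<delta>) a)"
          by (simp add: \<psi>_def power_mult_distrib mult.assoc[symmetric])
        then show ?thesis by (simp only: mult.assoc ennreal_mult'[OF zero_le_power2, symmetric])
      qed
      also have "\<dots> \<le> ?K * ennreal ((\<phi> t)\<^sup>2 * (T powr a * Beta (1 - 2 * \<delta>) a))"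
        using True a d by (intro mult_left_mono ennreal_leI mult_right_mono powr_mono2)
           (auto simp: Beta_def intro!: divide_nonneg_nonneg mult_nonneg_nonneg Gamma_real_nonneg)
      also have "\<dots> = ?K * (ennreal (T powr a * Beta (1 - 2 * \<delta>) a) * (ennreal ((\<phi> t)\<^sup>2) * indicator {0<..T} t))"
        using True by (simp add: ennreal_mult' mult_ac)
      finally show ?thesis .
    next
      case False
      then have z: "?K * ?w v * (ennreal ((\<psi> t)\<^sup>2 * k t v) * indicator {v<..T} t) = 0" for v
        by (auto simp: indicator_def)
      show ?thesis unfolding z by simp
    qed
  qed
  also have "\<dots> = ?K * (ennreal (T powr a * Beta (1 - 2 * \<delta>) a) * (\<integral>\<^sup>+t. ennreal ((\<phi> t)\<^sup>2) * indicator {0<..T} t \<partial>lborel))"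
    by (simp add: nn_integral_cmult)
  also have "\<dots> = ennreal (T powr a / a * (T powr a * Beta (1 - 2 * \<delta>) a)) * (\<integral>\<^sup>+t. ennreal ((\<phi> t)\<^sup>2) * indicator {0<..T} t \<partial>lborel)"
  proof -
    have "0 \<le> T powr a / a" using a by simp
    then show ?thesis by (simp only: ennreal_mult'[of "T powr a / a"] mult.assoc)
  qed
  finally show ?thesis unfolding \<psi>_def k_def .
qed

section \<open>The variance of the estimator\<close>

text \<open>The square of the t-integral is an integral over pairs (s,u), and the hypothesis is
  precisely absolute integrability of E s v * E u v in all three variables. Fubini between v and the
  pair then exchanges the order.\<close>

lemma integral_sq_kernel_Fubini:
  fixes E :: "real \<Rightarrow> real \<Rightarrow> real"
  assumes Em[measurable]: "(\<lambda>(t, v). E t v) \<in> borel_measurable (borel \<Otimes>\<^sub>M borel)"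
    and fin: "(\<integral>\<^sup>+v. (\<integral>\<^sup>+t. ennreal \<bar>E t v\<bar> \<partial>lborel)\<^sup>2 \<partial>lborel) < \<infinity>"
  shows "integrable lborel (\<lambda>v. (\<integral>t. E t v \<partial>lborel)\<^sup>2)"
    and "integrable lborel (\<lambda>u. \<integral>s. (\<integral>v. E s v * E u v \<partial>lborel) \<partial>lborel)"
    and "(\<integral>u. (\<integral>s. (\<integral>v. E s v * E u v \<partial>lborel) \<partial>lborel) \<partial>lborel) = (\<integral>v. (\<integral>t. E t v \<partial>lborel)\<^sup>2 \<partial>lborel)"
proof -
  let ?F = "\<lambda>v (p :: real \<times> real). E (fst p) v * E (snd p) v"
  have Es[measurable]: "(\<lambda>t. E t v) \<in> borel_measurable borel" for v
    by measurable
  have nn: "(\<integral>\<^sup>+p. ennreal \<bar>?F v p\<bar> \<partial>lborel) = (\<integral>\<^sup>+t. ennreal \<bar>E t v\<bar> \<partial>lborel)\<^sup>2" for v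
  proof -
    have "(\<integral>\<^sup>+p. ennreal \<bar>?F v p\<bar> \<partial>lborel) = (\<integral>\<^sup>+p. ennreal \<bar>?F v p\<bar> \<partial>(lborel \<Otimes>\<^sub>M lborel))"
      by (simp only: lborel_prod)
    also have "\<dots> = (\<integral>\<^sup>+s. \<integral>\<^sup>+u. ennreal \<bar>E s v * E u v\<bar> \<partial>lborel \<partial>lborel)"
      by (subst lborel.nn_integral_fst[symmetric]) simp_all
    also have "\<dots> = (\<integral>\<^sup>+s. ennreal \<bar>E s v\<bar> * (\<integral>\<^sup>+u. ennreal \<bar>E u v\<bar> \<partial>lborel) \<partial>lborel)"
      by (intro nn_integral_cong) (simp add: abs_mult ennreal_mult nn_integral_cmult)
    also have "\<dots> = (\<integral>\<^sup>+t. ennreal \<bar>E t v\<bar> \<partial>lborel)\<^sup>2"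
      by (simp add: nn_integral_multc power2_eq_square)
    finally show ?thesis .
  qed
  have Fm[measurable]: "case_prod ?F \<in> borel_measurable (lborel \<Otimes>\<^sub>M lborel)"
  proof -
    have eq: "sets (lborel \<Otimes>\<^sub>M (lborel :: (real \<times> real) measure)) = sets (borel \<Otimes>\<^sub>M ((borel :: real measure) \<Otimes>\<^sub>M (borel :: real measure)))"
      by (subst borel_prod) (rule sets_pair_measure_cong; simp)
    show ?thesis
      unfolding measurable_cong_sets[OF eq refl] case_prod_beta
      by measurable
  qed
  have "(\<integral>\<^sup>+z. ennreal (norm (case_prod ?F z)) \<partial>(lborel \<Otimes>\<^sub>M lborel)) = (\<integral>\<^sup>+v. \<integral>\<^sup>+p. ennreal \<bar>?F v p\<bar> \<partial>lborel \<partial>lborel)"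
    by (subst lborel.nn_integral_fst[symmetric]) simp_all
  then have iF: "integrable (lborel \<Otimes>\<^sub>M lborel) (case_prod ?F)"
    using fin by (intro integrableI_bounded Fm) (simp add: nn)
  \<comment> \<open>Finiteness of the v-integral makes the inner integral finite only for almost
    every v, so the factorisation is claimed only there.\<close>
  have ae: "AE v in lborel. (\<integral>p. ?F v p \<partial>lborel) = (\<integral>t. E t v \<partial>lborel)\<^sup>2"
  proof -
    have "AE v in lborel. (\<integral>\<^sup>+t. ennreal \<bar>E t v\<bar> \<partial>lborel)\<^sup>2 \<noteq> \<infinity>"
      using fin by (intro nn_integral_PInf_AE) auto
    then show ?thesis
    proof eventually_elim
      case (elim v)
      then have f: "(\<integral>\<^sup>+p. ennreal \<bar>?F v p\<bar> \<partial>lborel) < \<infinity>" by (simp add: nn less_top)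
      have [measurable]: "?F v \<in> borel_measurable borel"
        unfolding borel_prod[symmetric] by measurable
      have i: "integrable (lborel \<Otimes>\<^sub>M lborel) (\<lambda>(s, u). E s v * E u v)"
        using f unfolding lborel_prod case_prod_beta by (intro integrableI_bounded) auto
      have "(\<integral>p. ?F v p \<partial>lborel) = integral\<^sup>L (lborel \<Otimes>\<^sub>M lborel) (\<lambda>(s, u). E s v * E u v)"
        unfolding lborel_prod case_prod_beta ..
      also have "\<dots> = (\<integral>u. (\<integral>s. E s v * E u v \<partial>lborel) \<partial>lborel)"
        by (rule lborel_pair.integral_snd[OF i, symmetric])
      also have "\<dots> = (\<integral>t. E t v \<partial>lborel)\<^sup>2" by (simp add: power2_eq_square)
      finally show ?case .
    qed
  qed
  have iv: "integrable lborel (\<lambda>v. \<integral>p. ?F v p \<partial>lborel)"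
    by (rule lborel_pair.integrable_fst[OF iF])
  have sqm: "(\<lambda>v. (\<integral>t. E t v \<partial>lborel)\<^sup>2) \<in> borel_measurable lborel" by measurable
  show "integrable lborel (\<lambda>v. (\<integral>t. E t v \<partial>lborel)\<^sup>2)"
    using iv by (rule integrable_cong_AE_imp[OF _ sqm]) (use ae in \<open>auto elim: eventually_mono\<close>)
  have ip: "integrable (lborel \<Otimes>\<^sub>M lborel) (\<lambda>(s, u). \<integral>v. E s v * E u v \<partial>lborel)"
    using lborel_pair.integrable_snd[OF iF] unfolding lborel_prod case_prod_beta .
  show "integrable lborel (\<lambda>u. \<integral>s. (\<integral>v. E s v * E u v \<partial>lborel) \<partial>lborel)"
    by (rule lborel_pair.integrable_snd[OF ip])
  have "(\<integral>u. (\<integral>s. (\<integral>v. E s v * E u v \<partial>lborel) \<partial>lborel) \<partial>lborel)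
      = integral\<^sup>L (lborel \<Otimes>\<^sub>M lborel) (\<lambda>(s, u). \<integral>v. E s v * E u v \<partial>lborel)"
    by (rule lborel_pair.integral_snd[OF ip])
  also have "\<dots> = (\<integral>p. (\<integral>v. ?F v p \<partial>lborel) \<partial>lborel)"
    unfolding lborel_prod case_prod_beta ..
  also have "\<dots> = (\<integral>v. (\<integral>p. ?F v p \<partial>lborel) \<partial>lborel)"
    by (rule lborel_pair.Fubini_integral[OF iF])
  also have "\<dots> = (\<integral>v. (\<integral>t. E t v \<partial>lborel)\<^sup>2 \<partial>lborel)"
    by (rule integral_cong_AE) (use ae iv sqm in auto)
  finally show "(\<integral>u. (\<integral>s. (\<integral>v. E s v * E u v \<partial>lborel) \<partial>lborel) \<partial>lborel) = (\<integral>v. (\<integral>t. E t v \<partial>lborel)\<^sup>2 \<partial>lborel)" .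
qed

section \<open>The transform of h by the kernel derivative\<close>

text \<open>The cutoffs 0 < v < t are already in \<open>KD\<close>, so with the indicator in t all
  integrals can run over the whole line and Fubini needs no moving limits.\<close>

definition hKD :: "real \<Rightarrow> real \<Rightarrow> real \<Rightarrow> (real \<Rightarrow> real) \<Rightarrow> real \<Rightarrow> real \<Rightarrow> real" where
  "hKD H1 H2 T h t v = indicator {0<..T} t * (h t * KD H1 H2 t v)"

context
  fixes H1 H2 T :: real and h :: "real \<Rightarrow> real"
  assumes H1: "1/2 < H1" and H12: "H1 < H2" and H2: "H2 < 1" and T: "0 < T"
    and hm [measurable]: "h \<in> borel_measurable borel"
    and h2: "set_integrable lborel {0..T} (\<lambda>t. (h t * t powr (1/2 - H1))\<^sup>2)"
begin

lemma borel_measurable_hKD: "(\<lambda>(t, v). hKD H1 H2 T h t v) \<in> borel_measurable (borel \<Otimes>\<^sub>M borel)"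
proof -
  note [measurable] = borel_measurable_KD[OF H1 H12 H2]
  show ?thesis unfolding hKD_def case_prod_beta by measurable
qed

lemma nn_integral_hKD_finite:
  "(\<integral>\<^sup>+v. (\<integral>\<^sup>+t. ennreal \<bar>hKD H1 H2 T h t v\<bar> \<partial>lborel)\<^sup>2 \<partial>lborel) < \<infinity>"
proof -
  define \<phi> where "\<phi> t = h t * t powr (1/2 - H1)" for t
  have [measurable]: "\<phi> \<in> borel_measurable borel" unfolding \<phi>_def[abs_def] by measurable
  \<comment> \<open>The exponents split as H2 - H1 = (1/2 - H1) + (H2 - 1/2): the first part turns h
    into the L2 function \<phi>, the second is t powr \<delta>. The factor v powr (1/2 - H2) of the
    kernel bound is v powr (- \<delta>), the weight of Schur's test; H2 < 1 gives \<delta> <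
    1/2.\<close>
  define \<delta> a where "\<delta> = H2 - 1/2" and "a = H2 - H1"
  obtain C where C: "C \<ge> 0" "\<And>t s. 0 < s \<Longrightarrow> s < t \<Longrightarrow>
      \<bar>KD H1 H2 t s\<bar> \<le> C * (s powr (1/2 - H2) * (t powr (H2 - H1) * (t - s) powr (H2 - H1 - 1)))"
    using KD_bound[OF H1 H12 H2] by blast
  let ?k = "\<lambda>v t. ennreal (\<bar>\<phi> t\<bar> * t powr \<delta> * (t - v) powr (a - 1)) * indicator {v<..T} t"
  have ptw: "ennreal \<bar>hKD H1 H2 T h t v\<bar> \<le> ennreal (C * v powr (- \<delta>)) * indicator {0<..T} v * ?k v t" for t v
  proof (cases "0 < v \<and> v < t \<and> t \<le> T")
    case True
    have "\<bar>h t\<bar> * t powr a = \<bar>\<phi> t\<bar> * t powr \<delta>"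
      using powr_add[of t "1/2 - H1" "H2 - 1/2"] True by (simp add: \<phi>_def a_def \<delta>_def abs_mult mult.assoc)
    then have "C * v powr (- \<delta>) * (\<bar>\<phi> t\<bar> * t powr \<delta> * (t - v) powr (a - 1))
        = \<bar>h t\<bar> * (C * (v powr (1/2 - H2) * (t powr a * (t - v) powr (a - 1))))"
      by (simp add: \<delta>_def mult_ac)
    moreover have "\<bar>hKD H1 H2 T h t v\<bar> \<le> \<bar>h t\<bar> * (C * (v powr (1/2 - H2) * (t powr a * (t - v) powr (a - 1))))"
      using True C(2)[of v t] by (simp add: hKD_def abs_mult a_def mult_left_mono)
    ultimately have "\<bar>hKD H1 H2 T h t v\<bar> \<le> C * v powr (- \<delta>) * (\<bar>\<phi> t\<bar> * t powr \<delta> * (t - v) powr (a - 1))"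
      by (simp only:)
    from ennreal_leI[OF this] show ?thesis using True C(1) by (simp add: ennreal_mult)
  next
    case False
    then have "hKD H1 H2 T h t v = 0" by (auto simp: hKD_def KD_def indicator_def)
    then show ?thesis by simp
  qed
  have "(\<integral>\<^sup>+t. ennreal \<bar>hKD H1 H2 T h t v\<bar> \<partial>lborel)\<^sup>2
      \<le> ennreal (C\<^sup>2) * (ennreal (v powr (- 2 * \<delta>)) * indicator {0<..T} v * (\<integral>\<^sup>+t. ?k v t \<partial>lborel)\<^sup>2)" for v
  proof -
    have "(\<integral>\<^sup>+t. ennreal \<bar>hKD H1 H2 T h t v\<bar> \<partial>lborel)
        \<le> (\<integral>\<^sup>+t. ennreal (C * v powr (- \<delta>)) * indicator {0<..T} v * ?k v t \<partial>lborel)"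
      by (intro nn_integral_mono ptw)
    also have "\<dots> = ennreal (C * v powr (- \<delta>)) * indicator {0<..T} v * (\<integral>\<^sup>+t. ?k v t \<partial>lborel)"
      by (rule nn_integral_cmult) measurable
    finally have "(\<integral>\<^sup>+t. ennreal \<bar>hKD H1 H2 T h t v\<bar> \<partial>lborel)\<^sup>2
        \<le> (ennreal (C * v powr (- \<delta>)) * indicator {0<..T} v * (\<integral>\<^sup>+t. ?k v t \<partial>lborel))\<^sup>2"
      by (rule power_mono_ennreal)
    also have "\<dots> = (ennreal (C * v powr (- \<delta>)))\<^sup>2 * (indicator {0<..T} v)\<^sup>2 * (\<integral>\<^sup>+t. ?k v t \<partial>lborel)\<^sup>2"
      by (simp only: power_mult_distrib)
    also have "(ennreal (C * v powr (- \<delta>)))\<^sup>2 = ennreal (C\<^sup>2) * ennreal (v powr (- 2 * \<delta>))"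
    proof -
      have "(v powr (- \<delta>))\<^sup>2 = v powr (- 2 * \<delta>)" unfolding power2_eq_square by (simp flip: powr_add)
      then show ?thesis using C(1) by (simp add: ennreal_power power_mult_distrib ennreal_mult)
    qed
    also have "(indicator {0<..T} v)\<^sup>2 = (indicator {0<..T} v :: ennreal)" by (simp add: indicator_def)
    finally show ?thesis by (simp only: mult.assoc)
  qed
  then have "(\<integral>\<^sup>+v. (\<integral>\<^sup>+t. ennreal \<bar>hKD H1 H2 T h t v\<bar> \<partial>lborel)\<^sup>2 \<partial>lborel)
      \<le> (\<integral>\<^sup>+v. ennreal (C\<^sup>2) * (ennreal (v powr (- 2 * \<delta>)) * indicator {0<..T} v * (\<integral>\<^sup>+t. ?k v t \<partial>lborel)\<^sup>2) \<partial>lborel)"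
    by (rule nn_integral_mono)
  also have "\<dots> = ennreal (C\<^sup>2) * (\<integral>\<^sup>+v. ennreal (v powr (- 2 * \<delta>)) * indicator {0<..T} v * (\<integral>\<^sup>+t. ?k v t \<partial>lborel)\<^sup>2 \<partial>lborel)"
    by (rule nn_integral_cmult) (simp add: greaterThanAtMost_def indicator_def)
  also have "\<dots> \<le> ennreal (C\<^sup>2) * (ennreal (T powr a / a * (T powr a * Beta (1 - 2 * \<delta>) a))
      * (\<integral>\<^sup>+t. ennreal ((\<phi> t)\<^sup>2) * indicator {0<..T} t \<partial>lborel))"
    using H1 H12 H2 T by (intro mult_left_mono fractional_kernel_L2_bound) (auto simp: \<delta>_def a_def)
  also have "\<dots> < \<infinity>"
  proof -
    have "(\<integral>\<^sup>+t. ennreal ((\<phi> t)\<^sup>2) * indicator {0<..T} t \<partial>lborel) \<le> (\<integral>\<^sup>+t. ennreal (norm (indicator {0..T} t *\<^sub>R (\<phi> t)\<^sup>2)) \<partial>lborel)"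
      by (intro nn_integral_mono) (auto simp: indicator_def)
    also have "\<dots> < \<infinity>"
      using h2 unfolding set_integrable_def \<phi>_def by (simp add: integrable_iff_bounded)
    finally show ?thesis by (simp add: ennreal_mult_less_top)
  qed
  finally show ?thesis .
qed

lemma kernel_transform_eq:
  "(LINT t:{s..T}|lborel. h t * dKH H1 H2 t s) = (\<integral>t. hKD H1 H2 T h t s \<partial>lborel)"
proof -
  have hKm: "(\<lambda>t. hKD H1 H2 T h t s) \<in> borel_measurable lborel"
  proof -
    note [measurable] = borel_measurable_hKD
    show ?thesis by measurable
  qed
  have eq: "indicator {s..T} t *\<^sub>R (h t * dKH H1 H2 t s) = hKD H1 H2 T h t s" if "t \<noteq> s" for t
    using dKH_eq_KD[OF H1 H12 H2 that] by (auto simp: hKD_def KD_def indicator_def)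
  \<comment> \<open>Equality almost everywhere would not give Borel measurability of the integrand.
    It is therefore written as a measurable function altered at the single diagonal point.\<close>
  define c where "c = indicator {s..T} s *\<^sub>R (h s * dKH H1 H2 s s)"
  have eq': "indicator {s..T} t *\<^sub>R (h t * dKH H1 H2 t s) = (if t = s then c else hKD H1 H2 T h t s)" for t
    using eq[of t] by (cases "t = s") (simp_all add: c_def)
  show ?thesis
    unfolding set_lebesgue_integral_def
  proof (rule integral_cong_AE)
    show "(\<lambda>t. indicator {s..T} t *\<^sub>R (h t * dKH H1 H2 t s)) \<in> borel_measurable lborel"
      unfolding eq' using hKm by measurable
    show "AE t in lborel. indicator {s..T} t *\<^sub>R (h t * dKH H1 H2 t s) = hKD H1 H2 T h t s"
      using AE_lborel_singleton[of s] by eventually_elim (rule eq)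
  qed (rule hKm)
qed

lemma kH_eq:
  assumes "0 < s" "0 < u"
  shows "kH H1 H2 s u = (\<integral>v. KD H1 H2 s v * KD H1 H2 u v \<partial>lborel)"
proof -
  note [measurable] = borel_measurable_KD[OF H1 H12 H2]
  have KDm: "(\<lambda>v. KD H1 H2 s v * KD H1 H2 u v) \<in> borel_measurable lborel"
    by measurable
  have eq: "indicator {0..min s u} v *\<^sub>R (dKH H1 H2 s v * dKH H1 H2 u v) = KD H1 H2 s v * KD H1 H2 u v"
    if "v \<noteq> s" "v \<noteq> u" for v
    using dKH_eq_KD[OF H1 H12 H2, of s v] dKH_eq_KD[OF H1 H12 H2, of u v] that
    by (auto simp: KD_def indicator_def)
  \<comment> \<open>As in \<open>kernel_transform_eq\<close>, but the product meets the diagonal at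
    the two points s and u.\<close>
  define c d where "c = indicator {0..min s u} s *\<^sub>R (dKH H1 H2 s s * dKH H1 H2 u s)"
    and "d = indicator {0..min s u} u *\<^sub>R (dKH H1 H2 s u * dKH H1 H2 u u)"
  have eq': "indicator {0..min s u} v *\<^sub>R (dKH H1 H2 s v * dKH H1 H2 u v)
      = (if v = s then c else if v = u then d else KD H1 H2 s v * KD H1 H2 u v)" for v
  proof (cases "v = s \<or> v = u")
    case False
    then show ?thesis using eq[of v] by simp
  qed (auto simp: c_def d_def)
  show ?thesis
    unfolding kH_def set_lebesgue_integral_def
  proof (rule integral_cong_AE)
    show "(\<lambda>v. indicator {0..min s u} v *\<^sub>R (dKH H1 H2 s v * dKH H1 H2 u v)) \<in> borel_measurable lborel"
      unfolding eq' using KDm by measurable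
    show "AE v in lborel. indicator {0..min s u} v *\<^sub>R (dKH H1 H2 s v * dKH H1 H2 u v) = KD H1 H2 s v * KD H1 H2 u v"
      using AE_lborel_singleton[of s] AE_lborel_singleton[of u] by eventually_elim (rule eq)
  qed (rule KDm)
qed

end

lemma Beta_real_pos: "0 < Beta a b" if "0 < a" "0 < b" for a b :: real
  using that by (simp add: Beta_def Gamma_real_pos)

lemma gammaH_pos: "0 < gammaH H" if "1/2 < H" "H < 1"
  using that by (simp add: gammaH_def Gamma_real_pos Beta_real_pos)

lemma kappa_pos: "0 < kappa H" if "1/2 < H" "H < 1"
  using that gammaH_pos[OF that] by (simp add: kappa_def BH_def Beta_real_pos)

lemma powr_sq: "(t powr a)\<^sup>2 = t powr (2 * a)" for t a :: real
  unfolding power2_eq_square by (simp flip: powr_add)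

text \<open>This integral is the variance of X_1(T) divided by gamma^2. Its value identifies the
  compensator in \<open>Ptheta\<close> with half the variance of the tilting variable.\<close>

lemma integral_powr_lebT:
  assumes T: "0 < T" and H: "H < 1"
  shows "integrable (lebT T) (\<lambda>t. (t powr (1/2 - H))\<^sup>2)"
    and "(\<integral>t. (t powr (1/2 - H))\<^sup>2 \<partial>lebT T) = T powr (2 - 2 * H) / (2 - 2 * H)"
proof -
  have sq: "(t powr (1/2 - H))\<^sup>2 = t powr (2 - 2 * H - 1)" for t :: real
    unfolding powr_sq by (rule arg_cong[where f = "(powr) t"]) simp
  have "(\<integral>\<^sup>+t. ennreal ((t powr (1/2 - H))\<^sup>2) \<partial>lebT T) = (\<integral>\<^sup>+t. ennreal ((t - 0) powr (2 - 2 * H - 1)) * indicator {0..T} t \<partial>lborel)"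
    unfolding lebT_def sq by (subst nn_integral_density) (auto simp: mult.commute)
  also have "\<dots> = ennreal ((T - 0) powr (2 - 2 * H) / (2 - 2 * H))"
    by (rule nn_integral_powr_interval) (use T H in auto)
  finally have nn: "(\<integral>\<^sup>+t. ennreal ((t powr (1/2 - H))\<^sup>2) \<partial>lebT T) = ennreal (T powr (2 - 2 * H) / (2 - 2 * H))" by simp
  show i: "integrable (lebT T) (\<lambda>t. (t powr (1/2 - H))\<^sup>2)"
    by (rule integrableI_bounded) (use nn in auto)
  show "(\<integral>t. (t powr (1/2 - H))\<^sup>2 \<partial>lebT T) = T powr (2 - 2 * H) / (2 - 2 * H)"
    using nn H T by (subst integral_eq_nn_integral) auto
qed

lemma integral_lebT_eq_lborel:
  fixes F :: "real \<Rightarrow> real"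
  assumes F[measurable]: "F \<in> borel_measurable borel" and z: "\<And>t. t \<notin> {0..T} \<Longrightarrow> F t = 0"
  shows "integrable (lebT T) F \<longleftrightarrow> integrable lborel F" "(\<integral>t. F t \<partial>lebT T) = (\<integral>t. F t \<partial>lborel)"
proof -
  have eq: "(\<lambda>t. indicator {0..T} t *\<^sub>R F t) = F" using z by (auto simp: fun_eq_iff indicator_def)
  show "integrable (lebT T) F \<longleftrightarrow> integrable lborel F"
    using set_integrable_iff_lebT[OF F, of T] unfolding set_integrable_def eq by simp
  show "(\<integral>t. F t \<partial>lebT T) = (\<integral>t. F t \<partial>lborel)"
    using set_integral_eq_lebT[OF F, of T] unfolding set_lebesgue_integral_def eq by simp
qed

section \<open>From the integral equation to the variance\<close>

context
  fixes H1 H2 T :: real and h :: "real \<Rightarrow> real"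
  assumes H1: "1/2 < H1" and H12: "H1 < H2" and H2: "H2 < 1" and T: "0 < T" and h: "solves_ET H1 H2 T h"
begin

text \<open>For u in (0,T], h(u) times the integral term of (E_T), with \<open>kH\<close> written
  out as an integral over v.\<close>

abbreviation (input) "J u \<equiv> \<integral>s. (\<integral>v. hKD H1 H2 T h s v * hKD H1 H2 T h u v \<partial>lborel) \<partial>lborel"

lemma h_measurable: "h \<in> borel_measurable borel"
  using h by (simp add: solves_ET_def)

lemma h_set_integrable: "set_integrable lborel {0..T} (\<lambda>t. (h t * t powr (1/2 - H1))\<^sup>2)"
  using h by (simp add: solves_ET_def)

lemma h_sq_integrable: "integrable (lebT T) (\<lambda>t. (h t * t powr (1/2 - H1))\<^sup>2)"
proof -
  note [measurable] = h_measurable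
  show ?thesis using h_set_integrable by (subst set_integrable_iff_lebT[symmetric]) simp_all
qed

lemmas hKD_facts = borel_measurable_hKD[OF H1 H12 H2 T h_measurable h_set_integrable]
  nn_integral_hKD_finite[OF H1 H12 H2 T h_measurable h_set_integrable]

lemmas Fubini_hKD = integral_sq_kernel_Fubini[OF hKD_facts]

lemma kernel_transform_eq_hKD:
  "(\<lambda>s. LINT t:{s..T}|lborel. h t * dKH H1 H2 t s) = (\<lambda>s. \<integral>t. hKD H1 H2 T h t s \<partial>lborel)"
  by (rule ext) (rule kernel_transform_eq[OF H1 H12 H2 T h_measurable h_set_integrable])

lemma hKD_transform:
  "(\<lambda>s. \<integral>t. hKD H1 H2 T h t s \<partial>lborel) \<in> borel_measurable borel"
  "integrable (lebT T) (\<lambda>s. (\<integral>t. hKD H1 H2 T h t s \<partial>lborel)\<^sup>2)"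
  "(\<integral>s. (\<integral>t. hKD H1 H2 T h t s \<partial>lborel)\<^sup>2 \<partial>lebT T) = (\<integral>u. J u \<partial>lborel)"
proof -
  note [measurable] = hKD_facts(1)
  show m: "(\<lambda>s. \<integral>t. hKD H1 H2 T h t s \<partial>lborel) \<in> borel_measurable borel" by measurable
  have sm: "(\<lambda>s. (\<integral>t. hKD H1 H2 T h t s \<partial>lborel)\<^sup>2) \<in> borel_measurable borel" using m by measurable
  have z: "(\<integral>t. hKD H1 H2 T h t s \<partial>lborel)\<^sup>2 = 0" if "s \<notin> {0..T}" for s
  proof -
    have "hKD H1 H2 T h t s = 0" for t using that by (auto simp: hKD_def KD_def indicator_def)
    then show ?thesis by simp
  qed
  show "integrable (lebT T) (\<lambda>s. (\<integral>t. hKD H1 H2 T h t s \<partial>lborel)\<^sup>2)"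
    using Fubini_hKD(1) integral_lebT_eq_lborel(1)[OF sm z] by blast
  show "(\<integral>s. (\<integral>t. hKD H1 H2 T h t s \<partial>lborel)\<^sup>2 \<partial>lebT T) = (\<integral>u. J u \<partial>lborel)"
    using Fubini_hKD(3) integral_lebT_eq_lborel(2)[OF sm z] by simp
qed

lemma ET_times_h:
  assumes u: "u \<in> {0<..T}"
  shows "(gammaH H1)\<^sup>2 * ((h u * u powr (1/2 - H1)) * u powr (1/2 - H1))
    = (gammaH H1)\<^sup>2 * (h u * u powr (1/2 - H1))\<^sup>2 + J u"
proof -
  have p: "u powr (1 - 2 * H1) = u powr (1/2 - H1) * u powr (1/2 - H1)"
    by (simp flip: powr_add)
  have "(\<integral>v. hKD H1 H2 T h s v * hKD H1 H2 T h u v \<partial>lborel)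
      = h u * (indicator {0<..T} s *\<^sub>R (h s * kH H1 H2 s u))" for s
  proof (cases "s \<in> {0<..T}")
    case True
    then have "(\<integral>v. hKD H1 H2 T h s v * hKD H1 H2 T h u v \<partial>lborel)
        = (\<integral>v. (h u * h s) * (KD H1 H2 s v * KD H1 H2 u v) \<partial>lborel)"
      using u by (intro Bochner_Integration.integral_cong) (auto simp: hKD_def mult_ac)
    also have "\<dots> = h u * h s * kH H1 H2 s u"
      using True u by (simp add: kH_eq[OF H1 H12 H2 T h_measurable h_set_integrable])
    finally show ?thesis using True by simp
  qed (simp add: hKD_def)
  then have J: "J u = h u * (LINT s:{0<..T}|lborel. h s * kH H1 H2 s u)"
    unfolding set_lebesgue_integral_def by simp
  have eq: "(gammaH H1)\<^sup>2 * u powr (1 - 2 * H1) = (gammaH H1)\<^sup>2 * h u * u powr (1 - 2 * H1)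
      + (LINT s:{0<..T}|lborel. h s * kH H1 H2 s u)"
    using h u by (simp add: solves_ET_def)
  have "(gammaH H1)\<^sup>2 * ((h u * u powr (1/2 - H1)) * u powr (1/2 - H1))
      = h u * ((gammaH H1)\<^sup>2 * u powr (1 - 2 * H1))"
    unfolding p by (simp only: mult_ac)
  also have "\<dots> = (gammaH H1)\<^sup>2 * (h u * u powr (1/2 - H1))\<^sup>2 + J u"
    unfolding eq unfolding J p by (simp add: power2_eq_square algebra_simps)
  finally show ?thesis .
qed

lemma bracket_variance:
  "(gammaH H1)\<^sup>2 * (\<integral>t. (h t * t powr (1/2 - H1)) * t powr (1/2 - H1) \<partial>lebT T)
    = (gammaH H1)\<^sup>2 * (\<integral>t. (h t * t powr (1/2 - H1))\<^sup>2 \<partial>lebT T)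
      + (\<integral>s. (\<integral>t. hKD H1 H2 T h t s \<partial>lborel)\<^sup>2 \<partial>lebT T)"
proof -
  note [measurable] = h_measurable hKD_facts(1)
  have Jm: "(\<lambda>u. J u) \<in> borel_measurable borel" by measurable
  have Jz: "J u = 0" if "u \<notin> {0..T}" for u
  proof -
    have "hKD H1 H2 T h u v = 0" for v using that by (auto simp: hKD_def indicator_def)
    then show ?thesis by simp
  qed
  have Ji: "integrable (lebT T) (\<lambda>u. J u)"
    using Fubini_hKD(2) integral_lebT_eq_lborel(1)[OF Jm Jz] by blast
  \<comment> \<open>(E_T) holds on (0,T], while \<open>lebT T\<close> lives on [0,T]; the point 0 is
    removed as a null set.\<close>
  have ae: "AE u in lebT T. (gammaH H1)\<^sup>2 * ((h u * u powr (1/2 - H1)) * u powr (1/2 - H1))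
      = (gammaH H1)\<^sup>2 * (h u * u powr (1/2 - H1))\<^sup>2 + J u"
    unfolding AE_lebT_iff using AE_lborel_singleton[of 0]
    by eventually_elim (auto intro!: ET_times_h)
  have "(gammaH H1)\<^sup>2 * (\<integral>t. (h t * t powr (1/2 - H1)) * t powr (1/2 - H1) \<partial>lebT T)
      = (\<integral>u. (gammaH H1)\<^sup>2 * ((h u * u powr (1/2 - H1)) * u powr (1/2 - H1)) \<partial>lebT T)"
    by (rule integral_mult_right_zero[symmetric])
  also have "\<dots> = (\<integral>u. (gammaH H1)\<^sup>2 * (h u * u powr (1/2 - H1))\<^sup>2 + J u \<partial>lebT T)"
    by (rule integral_cong_AE[OF _ _ ae]) (use Jm in measurable)
  also have "\<dots> = (gammaH H1)\<^sup>2 * (\<integral>t. (h t * t powr (1/2 - H1))\<^sup>2 \<partial>lebT T) + (\<integral>u. J u \<partial>lebT T)"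
    using h_sq_integrable Ji by (subst Bochner_Integration.integral_add) simp_all
  also have "(\<integral>u. J u \<partial>lebT T) = (\<integral>s. (\<integral>t. hKD H1 H2 T h t s \<partial>lborel)\<^sup>2 \<partial>lebT T)"
    using integral_lebT_eq_lborel(2)[OF Jm Jz] hKD_transform(3) by simp
  finally show ?thesis .
qed

text \<open>By \<open>bracket_variance\<close> a nonpositive value would force the nonnegative terms
  on the right to vanish, hence h = 0 almost everywhere. The integral term of (E_T) is then 0 at
  every u, and the equation gives h = 1 throughout (0,T], a contradiction. The estimator divides by
  this quantity, and the normal law needs it as a positive variance.\<close>

lemma bracket_pos: "0 < (\<integral>t. (h t * t powr (1/2 - H1)) * t powr (1/2 - H1) \<partial>lebT T)"
proof (rule ccontr)
  note [measurable] = h_measurable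
  let ?I = "\<integral>t. (h t * t powr (1/2 - H1)) * t powr (1/2 - H1) \<partial>lebT T"
  let ?A = "\<integral>t. (h t * t powr (1/2 - H1))\<^sup>2 \<partial>lebT T"
  let ?B = "\<integral>s. (\<integral>t. hKD H1 H2 T h t s \<partial>lborel)\<^sup>2 \<partial>lebT T"
  have g: "0 < gammaH H1" using H1 H12 H2 by (intro gammaH_pos) auto
  assume "\<not> 0 < ?I"
  then have "(gammaH H1)\<^sup>2 * ?I \<le> 0" by (intro mult_nonneg_nonpos) auto
  moreover have "0 \<le> (gammaH H1)\<^sup>2 * ?A" "0 \<le> ?B" by simp_all
  ultimately have "(gammaH H1)\<^sup>2 * ?A = 0" using bracket_variance by linarith
  then have "?A = 0" using g by simp
  then have "AE t in lebT T. (h t * t powr (1/2 - H1))\<^sup>2 = 0"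
    using integral_nonneg_eq_0_iff_AE[OF h_sq_integrable] by simp
  then have h0: "AE t in lborel. t \<in> {0<..T} \<longrightarrow> h t = 0"
    unfolding AE_lebT_iff by eventually_elim auto
  have h1: "h u = 1" if u: "u \<in> {0<..T}" for u
  proof -
    have "(LINT s:{0<..T}|lborel. h s * kH H1 H2 s u) = 0"
      unfolding set_lebesgue_integral_def
      by (rule integral_eq_zero_AE) (use h0 in \<open>auto simp: indicator_def elim: eventually_mono\<close>)
    then have "(gammaH H1)\<^sup>2 * u powr (1 - 2 * H1) = (gammaH H1)\<^sup>2 * h u * u powr (1 - 2 * H1)"
      using h u by (simp add: solves_ET_def)
    then show ?thesis using g u by simp
  qed
  have "AE t in lborel. t \<notin> {0<..T}" using h0 by eventually_elim (use h1 in auto)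
  then have "emeasure lborel {0<..T} = 0" using AE_iff_null_sets[of "{0<..T}" lborel] by auto
  then show False using T by simp
qed

end

section \<open>The law of the estimator\<close>

theorem theorem2p5:
  fixes H1 H2 T :: real and P0 :: "'a measure" and W1 W2 :: "real \<Rightarrow> 'a \<Rightarrow> real"
    and h :: "real \<Rightarrow> real"
  assumes "1/2 < H1" "H1 < H2" "H2 < 1" "H2 - H1 > 1/4" "T > 0"
    and "wiener_process P0 W1" "wiener_process P0 W2" "indep_processes P0 W1 W2"
    and "solves_ET H1 H2 T h"
    and "\<And>g. solves_ET H1 H2 T g \<Longrightarrow> \<forall>u\<in>{0<..T}. g u = h u"
  shows "\<forall>\<theta>::real.
     integrable (Ptheta H1 P0 W1 T \<theta>) (mle H1 H2 P0 W1 W2 T h) \<and>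
     integral\<^sup>L (Ptheta H1 P0 W1 T \<theta>) (mle H1 H2 P0 W1 W2 T h) = \<theta> \<and>
     distributed (Ptheta H1 P0 W1 T \<theta>) lborel (\<lambda>\<omega>. mle H1 H2 P0 W1 W2 T h \<omega> - \<theta>)
       (\<lambda>x. ennreal (normal_density 0
          (sqrt (1 / ((kappa H1)\<^sup>2 * (gammaH H1)\<^sup>2 * (LINT s:{0..T}|lborel. h s * s powr (1 - 2 * H1))))) x))"
proof
  fix \<theta> :: real
  note H = \<open>1/2 < H1\<close> \<open>H1 < H2\<close> \<open>H2 < 1\<close> \<open>T > 0\<close> \<open>solves_ET H1 H2 T h\<close>
  note [measurable] = h_measurable[OF H]
  define \<gamma> \<kappa> where "\<gamma> = gammaH H1" and "\<kappa> = kappa H1"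
  have \<gamma>: "0 < \<gamma>" and \<kappa>: "0 < \<kappa>" unfolding \<gamma>_def \<kappa>_def using H by (auto intro!: gammaH_pos kappa_pos)
  define f g k where "f t = h t * t powr (1/2 - H1)" and "g t = t powr (1/2 - H1)"
    and "k = (\<lambda>s. LINT t:{s..T}|lborel. h t * dKH H1 H2 t s)" for t
  have k: "k = (\<lambda>s. \<integral>t. hKD H1 H2 T h t s \<partial>lborel)" unfolding k_def by (rule kernel_transform_eq_hKD[OF H])
  define Y Z V where "Y = wiener_integral P0 W1 T f" and "Z = wiener_integral P0 W1 T g"
    and "V = wiener_integral P0 W2 T k"
  have fm: "f \<in> borel_measurable borel" and gm: "g \<in> borel_measurable borel"
    unfolding f_def[abs_def] g_def[abs_def] by measurable
  have Y: "is_wiener_integral P0 W1 T f Y"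
    unfolding Y_def using h_sq_integrable[OF H]
    by (intro is_wiener_integral_wiener_integral assms fm) (simp add: f_def)
  have Z: "is_wiener_integral P0 W1 T g Z"
    unfolding Z_def using integral_powr_lebT(1)[of T H1] H
    by (intro is_wiener_integral_wiener_integral assms gm) (simp add: g_def)
  have V: "is_wiener_integral P0 W2 T k V"
    unfolding V_def k using hKD_transform(1,2)[OF H]
    by (intro is_wiener_integral_wiener_integral assms)
  define I where "I = (\<integral>t. f t * g t \<partial>lebT T)"
  have I0: "0 < I" using bracket_pos[OF H] by (simp add: I_def f_def g_def)
  have LI: "(LINT s:{0..T}|lborel. h s * s powr (1 - 2 * H1)) = I"
  proof -
    have "h s * s powr (1 - 2 * H1) = f s * g s" for s by (simp add: f_def g_def mult.assoc flip: powr_add)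
    then show ?thesis unfolding I_def using fm gm by (subst set_integral_eq_lebT) simp_all
  qed
  \<comment> \<open>The standard deviation of N, since its variance is <N> = gamma^2 I.\<close>
  define \<sigma> where "\<sigma> = \<gamma> * sqrt I"
  have \<sigma>: "0 < \<sigma>" using \<gamma> I0 by (simp add: \<sigma>_def)
  have var: "\<sigma>\<^sup>2 = \<gamma>\<^sup>2 * (\<integral>s. (f s)\<^sup>2 \<partial>lebT T) + (\<integral>s. (k s)\<^sup>2 \<partial>lebT T)"
    using bracket_variance[OF H] I0 by (simp add: \<sigma>_def power_mult_distrib I_def f_def g_def k \<gamma>_def)
  \<comment> \<open>The density tilts by \<theta> \<kappa> X_1(T), and X_1(T) = \<gamma> Z.\<close>
  define c where "c = \<theta> * \<kappa> * \<gamma>"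
  let ?Q = "Ptheta H1 P0 W1 T \<theta>"
  have Q: "?Q = density P0 (\<lambda>\<omega>. ennreal (exp (c * Z \<omega> - c\<^sup>2 * (\<integral>s. (g s)\<^sup>2 \<partial>lebT T) / 2)))"
  proof -
    have G: "(\<integral>s. (g s)\<^sup>2 \<partial>lebT T) = T powr (2 - 2 * H1) / (2 - 2 * H1)"
      unfolding g_def using H by (intro integral_powr_lebT) auto
    have X: "X1T H1 P0 W1 T \<omega> = \<gamma> * Z \<omega>" for \<omega>
      by (simp add: X1T_def \<gamma>_def Z_def g_def[abs_def])
    show ?thesis unfolding Ptheta_def G X c_def \<gamma>_def \<kappa>_def
      by (simp add: power_mult_distrib mult_ac)
  qed
  note D = distributed_wiener_integral_tilted[OF assms(6,7,8) Y Z V var \<sigma> Q]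
  interpret Q: prob_space ?Q by (rule D(1))
  define \<alpha> where "\<alpha> = 1 / (\<kappa> * (\<gamma>\<^sup>2 * I))"
  have \<alpha>: "0 < \<alpha>" using \<kappa> \<gamma> I0 by (simp add: \<alpha>_def)
  have mle: "mle H1 H2 P0 W1 W2 T h \<omega> = \<alpha> * (\<gamma> * Y \<omega> + V \<omega>)" for \<omega>
    unfolding mle_def NT_def bracketNT_def LI Y_def V_def f_def[abs_def] k_def \<alpha>_def \<gamma>_def \<kappa>_def by simp
  \<comment> \<open>N has mean \<theta> \<kappa> \<gamma>^2 I and standard deviation \<gamma> sqrt
    I; scaling by \<alpha> = 1 / (\<kappa> \<gamma>^2 I) turns these into \<theta> and 1 / (\<kappa>
    \<gamma> sqrt I).\<close>
  have "distributed ?Q lborel (\<lambda>\<omega>. - \<theta> + \<alpha> * (\<gamma> * Y \<omega> + V \<omega>))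
      (\<lambda>x. ennreal (normal_density (- \<theta> + \<alpha> * (\<gamma> * c * (\<integral>s. f s * g s \<partial>lebT T))) (\<bar>\<alpha>\<bar> * \<sigma>) x))"
    by (rule Q.normal_density_affine[OF D(2) \<sigma>]) (use \<alpha> in simp)
  moreover have "- \<theta> + \<alpha> * (\<gamma> * c * (\<integral>s. f s * g s \<partial>lebT T)) = 0"
    using \<kappa> \<gamma> I0 by (simp add: \<alpha>_def c_def power2_eq_square flip: I_def)
  moreover have s: "\<bar>\<alpha>\<bar> * \<sigma> = sqrt (1 / (\<kappa>\<^sup>2 * \<gamma>\<^sup>2 * I))"
  proof (rule real_sqrt_unique[symmetric])
    show "(\<bar>\<alpha>\<bar> * \<sigma>)\<^sup>2 = 1 / (\<kappa>\<^sup>2 * \<gamma>\<^sup>2 * I)"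
      using \<kappa> \<gamma> I0 by (simp add: \<alpha>_def \<sigma>_def power_mult_distrib power_divide) (simp add: power2_eq_square power4_eq_xxxx field_simps)
  qed (use \<alpha> \<sigma> in simp)
  ultimately have dist: "distributed ?Q lborel (\<lambda>\<omega>. mle H1 H2 P0 W1 W2 T h \<omega> - \<theta>)
      (\<lambda>x. ennreal (normal_density 0 (sqrt (1 / (\<kappa>\<^sup>2 * \<gamma>\<^sup>2 * I))) x))"
    by (simp add: mle)
  have pos: "0 < sqrt (1 / (\<kappa>\<^sup>2 * \<gamma>\<^sup>2 * I))" using \<kappa> \<gamma> I0 by simp
  \<comment> \<open>Integrability and unbiasedness are read off from the centred normal law of the
    error.\<close>
  have i: "integrable ?Q (\<lambda>\<omega>. mle H1 H2 P0 W1 W2 T h \<omega> - \<theta>)"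
    using integrable_normal_moment_nz_1[OF pos, of 0] by (intro distributed_integrable_var[OF dist]) simp_all
  have e: "Q.expectation (\<lambda>\<omega>. mle H1 H2 P0 W1 W2 T h \<omega> - \<theta>) = 0"
    by (rule Q.normal_distributed_expectation[OF pos dist])
  have i': "integrable ?Q (mle H1 H2 P0 W1 W2 T h)"
    using Bochner_Integration.integrable_add[OF i, of "\<lambda>_. \<theta>"] by simp
  have "Q.expectation (mle H1 H2 P0 W1 W2 T h) = \<theta>"
    using e i' by (simp add: Q.prob_space)
  then show "integrable ?Q (mle H1 H2 P0 W1 W2 T h) \<and>
     integral\<^sup>L ?Q (mle H1 H2 P0 W1 W2 T h) = \<theta> \<and>
     distributed ?Q lborel (\<lambda>\<omega>. mle H1 H2 P0 W1 W2 T h \<omega> - \<theta>)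
       (\<lambda>x. ennreal (normal_density 0
          (sqrt (1 / ((kappa H1)\<^sup>2 * (gammaH H1)\<^sup>2 * (LINT s:{0..T}|lborel. h s * s powr (1 - 2 * H1))))) x))"
    using i' dist unfolding LI \<kappa>_def \<gamma>_def by blast
qed

end
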